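(* Let $f\in C(\mathbb{R})$ be a function with $f(0)=0$, put $F(t)=\int_0^t f(\tau)\,d\tau$ for $t\in\mathbb{R}$, and assume that: (i) there exist $t_0,M>0$ such that $0<F(t)\le M|f(t)|$ for all $|t|\ge t_0$; (ii) $0<2F(t)\le f(t)t$ for all $t\ne 0$; (iii) $\limsup_{t\to 0}\frac{F(t)}{t^2}<\frac{\lambda_1}{4\pi}$; (iv) there exists $0<\alpha_0<2\pi\omega$ such that $\lim_{|t|\to\infty}\frac{|f(t)|}{e^{\alpha t^2}}=\infty$ if $0<\alpha<\alpha_0$, and $\lim_{|t|\to\infty}\frac{|f(t)|}{e^{\alpha t^2}}=0$ if $\alpha>\alpha_0$; (v) there exists $\psi\in X$ such that $\|\psi\|_X=1$ and $\sup_{t\in\mathbb{R}^+}\Big(\frac{t^2}{4\pi}-\int_0^1F(t\psi)\,dx\Big)<\frac{\omega}{2\alpha_0}$. Then the problem $$(-\Delta)^{1/2}u=f(u)\ \text{ in }(0,1),\qquad u=0\ \text{ in }\mathbb{R}\setminus(0,1)$$ has a nontrivial (weak) solution $u\in H^{1/2}(\mathbb{R})$.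
   Context: $H^{1/2}(\mathbb{R})$ is the space of real-valued $u\in L^2(\mathbb{R})$ with $[u]^2_{H^{1/2}(\mathbb{R})}:=\int_{\mathbb{R}^2}\frac{(u(x)-u(y))^2}{|x-y|^2}\,dx\,dy<\infty$. Let $X=\{u\in H^{1/2}(\mathbb{R}): u=0 \text{ a.e. in } \mathbb{R}\setminus(0,1)\}$, with norm $\|u\|_X=[u]_{H^{1/2}(\mathbb{R})}$ and inner product $\langle u,v\rangle_X=\int_{\mathbb{R}^2}\frac{(u(x)-u(y))(v(x)-v(y))}{|x-y|^2}\,dx\,dy$. The constant $\lambda_1>0$ is $\lambda_1=\inf\{\|u\|_X^2: u\in X,\ \|u\|_{L^2(0,1)}=1\}$ (the infimum is positive). $(-\Delta)^s$ is the usual fractional Laplacian on $\mathbb{R}$ (Fourier multiplier $|\xi|^{2s}$), so that $\|(-\Delta)^{1/4}u\|_{L^2(\mathbb{R})}=(2\pi)^{-1/2}[u]_{H^{1/2}(\mathbb{R})}$ for $u\in H^{1/2}(\mathbb{R})$ and $\int_{\mathbb{R}}(-\Delta)^{1/4}u\,(-\Delta)^{1/4}v\,dx=\frac{1}{2\pi}\langle u,v\rangle_X$ for $u,v\in X$. The constant $\omega$ with $0<\omega\le\pi$ is a fixed constant with the following property (such a constant exists by the known fractional Trudinger-Moser inequality of Ozawa and Kozono-Sato-Wadade): for all $0<\alpha<\omega$ there exists $H_\alpha>0$ such that $\int_{\mathbb{R}}(e^{\alpha u^2}-1)\,dx\le H_\alpha\|u\|_{L^2(\mathbb{R})}^2$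 for every $u\in H^{1/2}(\mathbb{R})$ with $\|(-\Delta)^{1/4}u\|_{L^2(\mathbb{R})}\le1$. A (weak) solution of the problem is a function $u\in X$ such that $\int_{\mathbb{R}}(-\Delta)^{1/4}u\,(-\Delta)^{1/4}v\,dx=\int_0^1 f(u)v\,dx$ for all $v\in X$. Nontrivial means $u\neq 0$. *)

theory Defs
  imports "HOL-Analysis.Analysis"
begin

text \<open>
  Elements of the function spaces are represented by everywhere defined Borel functions (every
  Lebesgue measurable function agrees almost everywhere with one); equality of elements is equality
  almost everywhere.
\<close>

definition L2_fun :: "(real \<Rightarrow> 'a::{banach, second_countable_topology}) \<Rightarrow> bool" where
  "L2_fun u \<longleftrightarrow> u \<in> borel_measurable lborel \<and> integrable lborel (\<lambda>x. (norm (u x))\<^sup>2)"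

definition L2_norm_on :: "real set \<Rightarrow> (real \<Rightarrow> real) \<Rightarrow> real" where
  "L2_norm_on A u = sqrt (LBINT x:A. (u x)\<^sup>2)"

text \<open>On the diagonal, a null set, the quotient is 0 by the convention for division by zero.\<close>

definition gagliardo_quotient :: "(real \<Rightarrow> real) \<Rightarrow> real \<times> real \<Rightarrow> real" where
  "gagliardo_quotient u = (\<lambda>(x, y). (u x - u y)\<^sup>2 / \<bar>x - y\<bar>\<^sup>2)"

definition gagliardo_seminorm :: "(real \<Rightarrow> real) \<Rightarrow> real" where
  "gagliardo_seminorm u = sqrt (LINT z|lborel. gagliardo_quotient u z)"

definition H_half :: "(real \<Rightarrow> real) set" where
  "H_half = {u. L2_fun u \<and> integrable lborel (gagliardo_quotient u)}"

definition X_space :: "(real \<Rightarrow> real) set" where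
  "X_space = {u \<in> H_half. AE x in lborel. x \<notin> {0<..<1} \<longrightarrow> u x = 0}"

abbreviation X_norm :: "(real \<Rightarrow> real) \<Rightarrow> real" where
  "X_norm \<equiv> gagliardo_seminorm"

definition lambda1 :: real where
  "lambda1 = Inf {(X_norm u)\<^sup>2 | u. u \<in> X_space \<and> L2_norm_on {0<..<1} u = 1}"

text \<open>
  The Fourier transform on \<open>L\<^sup>2\<close> (Plancherel): the limit in mean of the truncated Fourier integrals,
  in the angular frequency convention \<open>exp (- \<i> x \<xi>)\<close> with the unitary normalization.
\<close>

definition truncated_fourier :: "real \<Rightarrow> (real \<Rightarrow> complex) \<Rightarrow> real \<Rightarrow> complex" where
  "truncated_fourier R u \<xi> =
     complex_of_real (1 / sqrt (2 * pi)) * (CLBINT x:{-R..R}. cis (- (x * \<xi>)) * u x)"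

definition has_L2_fourier :: "(real \<Rightarrow> complex) \<Rightarrow> (real \<Rightarrow> complex) \<Rightarrow> bool" where
  "has_L2_fourier u g \<longleftrightarrow> L2_fun u \<and> L2_fun g \<and>
     ((\<lambda>R. \<integral>\<^sup>+ \<xi>. ennreal ((norm (truncated_fourier R u \<xi> - g \<xi>))\<^sup>2) \<partial>lborel) \<longlongrightarrow> 0) at_top"

text \<open>
  The fractional Laplacian of order \<open>2 * s\<close>, with Fourier multiplier \<open>\<bar>\<xi>\<bar> powr (2 * s)\<close>, for those
  real-valued \<open>u\<close> in \<open>L\<^sup>2\<close> whose image is again in \<open>L\<^sup>2\<close>. The relation determines \<open>w\<close> up to a null
  set; \<open>frac_laplacian s u\<close> is an arbitrary representative.
\<close>

definition has_frac_laplacian :: "real \<Rightarrow> (real \<Rightarrow> real) \<Rightarrow> (real \<Rightarrow> real) \<Rightarrow> bool" where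
  "has_frac_laplacian s u w \<longleftrightarrow>
     (\<exists>g. has_L2_fourier (\<lambda>x. complex_of_real (u x)) g \<and>
          has_L2_fourier (\<lambda>x. complex_of_real (w x))
            (\<lambda>\<xi>. complex_of_real (\<bar>\<xi>\<bar> powr (2 * s)) * g \<xi>))"

definition frac_laplacian :: "real \<Rightarrow> (real \<Rightarrow> real) \<Rightarrow> real \<Rightarrow> real" where
  "frac_laplacian s u = (SOME w. has_frac_laplacian s u w)"

text \<open>
  The left-hand side of the inequality is a nonnegative integral, so that the inequality includes
  its finiteness.
\<close>

definition trudinger_moser_constant :: "real \<Rightarrow> bool" where
  "trudinger_moser_constant \<omega> \<longleftrightarrow> 0 < \<omega> \<and> \<omega> \<le> pi \<and>
     (\<forall>\<alpha>. 0 < \<alpha> \<and> \<alpha> < \<omega> \<longrightarrow>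
        (\<exists>H>0. \<forall>u\<in>H_half. L2_norm_on UNIV (frac_laplacian (1/4) u) \<le> 1 \<longrightarrow>
           (\<integral>\<^sup>+ x. ennreal (exp (\<alpha> * (u x)\<^sup>2) - 1) \<partial>lborel)
             \<le> ennreal (H * (L2_norm_on UNIV u)\<^sup>2)))"

text \<open>The oriented integral of \<open>f\<close> from 0 to \<open>t\<close>, also for negative \<open>t\<close>.\<close>

definition primitive :: "(real \<Rightarrow> real) \<Rightarrow> real \<Rightarrow> real" where
  "primitive f t = (LBINT \<tau>=ereal 0..ereal t. f \<tau>)"

text \<open>
  Integrability of \<open>f(u) v\<close> is demanded explicitly, since the integral of a non-integrable function
  is 0 by convention.
\<close>

definition weak_solution :: "(real \<Rightarrow> real) \<Rightarrow> (real \<Rightarrow> real) \<Rightarrow> bool" where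
  "weak_solution f u \<longleftrightarrow> u \<in> X_space \<and>
     (\<forall>v\<in>X_space. set_integrable lborel {0<..<1} (\<lambda>x. f (u x) * v x) \<and>
        (LBINT x. frac_laplacian (1/4) u x * frac_laplacian (1/4) v x)
          = (LBINT x:{0<..<1}. f (u x) * v x))"

end

theory Submission
  imports Defs "HOL-Probability.Characteristic_Functions"
begin

text \<open>
  Plancherel's identity for compactly supported functions, obtained with Gaussian weights, identifies
  \<open>\<parallel>(-\<Delta>)\<^sup>1\<^sup>/\<^sup>4 u\<parallel>\<^sup>2\<close> with \<open>[u]\<^sup>2 / 2\<pi>\<close>, so that weak solutions are the critical points of
  \<open>\<Phi> u = \<parallel>u\<parallel>\<^sup>2 / 4\<pi> - \<integral> F(u)\<close> on \<open>X\<close>. By the Trudinger-Moser inequality and (iii), \<open>\<Phi>\<close> has a mountain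
  ridge around \<open>0\<close>, and it is coercive to \<open>-\<infinity>\<close> on finite-dimensional subspaces. On a finite-dimensional
  subspace containing \<open>\<psi>\<close> the mountain pass level is attained by a continuum, and one step of the gradient
  flow produces a critical point of level between the height of the ridge and
  \<open>sup \<Phi>(t\<psi>) < \<omega> / 2\<alpha>\<^sub>0\<close>. Along an exhausting sequence of subspaces these points are bounded in
  \<open>X\<close> by (i) and (ii), and a weak limit solves the equation because \<open>\<integral> f(u\<^sub>n) u\<^sub>n\<close> is bounded. If the limit
  vanished, then \<open>\<integral> F(u\<^sub>n) \<rightarrow> 0\<close>, so that eventually \<open>\<alpha>\<^sub>0 \<parallel>u\<^sub>n\<parallel>\<^sup>2 < 2\<pi>\<omega>\<close> with a margin; the Trudinger-Moser
  inequality would then give \<open>\<integral> f(u\<^sub>n) u\<^sub>n \<rightarrow> 0\<close>, hence \<open>\<parallel>u\<^sub>n\<parallel> \<rightarrow> 0\<close>, contradicting the ridge.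
\<close>

subsection \<open>Square integrable functions\<close>

text \<open>The bound in (v) is calibrated to the exponential inequality:
  \<open>(X_norm u)\<^sup>2 \<le> 2 * pi\<close> describes the unit ball for
  \<open>\<parallel>(-\<Delta>)\<^sup>1\<^sup>/\<^sup>4 u\<parallel>\<close>, so functions with
  \<open>(X_norm u)\<^sup>2\<close> near 4 pi c admit exponents below \<omega> / (2 c), which
  exceeds \<open>\<alpha>\<^sub>0\<close> exactly when c < \<omega> / (2
  \<open>\<alpha>\<^sub>0\<close>). Working in finite dimensions, the gradient step takes place on a
  compact box of coefficients, where no Palais-Smale condition is required; the loss of compactness
  caused by critical growth is met only once, when the dimension tends to infinity. There the bound
  on the integral of f(u) u gives uniform integrability of f(u), which handles bounded test
  functions only. This is why the spanning functions are bounded and why general test functions are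
  reached by truncation. Since \<open>frac_laplacian\<close> is an arbitrary choice, Plancherel's
  identity alone does not suffice: a real-valued image has to exist, and its norm must not depend on
  the choice. The first demand is the reason for proving that every square integrable Hermitian
  function is the transform of a real one.\<close>

definition sqint :: "'a measure \<Rightarrow> ('a \<Rightarrow> 'b::{banach, second_countable_topology}) \<Rightarrow> bool" where
  "sqint M f \<longleftrightarrow> f \<in> borel_measurable M \<and> integrable M (\<lambda>x. (norm (f x))\<^sup>2)"

lemma L2_fun_iff_sqint: "L2_fun u \<longleftrightarrow> sqint lborel u"
  by (simp add: L2_fun_def sqint_def)

lemma sqint_measurable: "sqint M f \<Longrightarrow> f \<in> borel_measurable M"
  and sqint_integrable: "sqint M f \<Longrightarrow> integrable M (\<lambda>x. (norm (f x))\<^sup>2)"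
  by (auto simp: sqint_def)

lemma sqint_integrable_real:
  fixes f :: "'a \<Rightarrow> real"
  shows "sqint M f \<Longrightarrow> integrable M (\<lambda>x. (f x)\<^sup>2)"
  by (auto simp: sqint_def)

lemma sqint_dominated:
  assumes "sqint M g" "f \<in> borel_measurable M" "AE x in M. norm (f x) \<le> norm (g x)"
  shows "sqint M f"
  unfolding sqint_def
proof (intro conjI)
  have "AE x in M. norm ((norm (f x))\<^sup>2) \<le> norm ((norm (g x))\<^sup>2)"
    using assms(3) by eventually_elim (simp add: power_mono)
  then show "integrable M (\<lambda>x. (norm (f x))\<^sup>2)"
    by (intro Bochner_Integration.integrable_bound[OF sqint_integrable[OF assms(1)]]) (use assms(2) in measurable)
qed (use assms in auto)

lemma norm_add_sq_le: "(norm (a + b))\<^sup>2 \<le> 2 * (norm a)\<^sup>2 + 2 * (norm (b::'a::real_normed_vector))\<^sup>2"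
proof -
  have "(norm (a + b))\<^sup>2 \<le> (norm a + norm b)\<^sup>2" by (simp add: norm_triangle_ineq power_mono)
  also have "\<dots> \<le> 2 * (norm a)\<^sup>2 + 2 * (norm b)\<^sup>2"
    using sum_squares_ge_zero[of "norm a - norm b" 0] by (simp add: power2_eq_square algebra_simps)
  finally show ?thesis .
qed

lemma norm_diff_sq_le: "(norm (a - b))\<^sup>2 \<le> 2 * (norm a)\<^sup>2 + 2 * (norm (b::'a::real_normed_vector))\<^sup>2"
  using norm_add_sq_le[of a "-b"] by simp

lemma sqint_add:
  assumes "sqint M f" "sqint M g" shows "sqint M (\<lambda>x. f x + g x)"
  unfolding sqint_def
proof (intro conjI)
  note [measurable] = assms[THEN sqint_measurable]
  have "integrable M (\<lambda>x. 2 * (norm (f x))\<^sup>2 + 2 * (norm (g x))\<^sup>2)"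
    by (intro Bochner_Integration.integrable_add integrable_mult_right integrable_divide sqint_integrable assms)
  then show "integrable M (\<lambda>x. (norm (f x + g x))\<^sup>2)"
    by (rule Bochner_Integration.integrable_bound) (auto simp: norm_add_sq_le)
  show "(\<lambda>x. f x + g x) \<in> borel_measurable M" by measurable
qed

lemma sqint_uminus: "sqint M f \<Longrightarrow> sqint M (\<lambda>x. - f x)"
  by (auto simp: sqint_def)

lemma sqint_diff: "sqint M f \<Longrightarrow> sqint M g \<Longrightarrow> sqint M (\<lambda>x. f x - g x)"
  using sqint_add[of M f "\<lambda>x. - g x"] sqint_uminus[of M g] by simp

lemma sqint_cmult:
  fixes f :: "'a \<Rightarrow> 'b::{banach, second_countable_topology, real_normed_field}"
  shows "sqint M f \<Longrightarrow> sqint M (\<lambda>x. c * f x)"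
  by (auto simp: sqint_def norm_mult power_mult_distrib)

lemma sqint_zero [simp]: "sqint M (\<lambda>x. 0)"
  by (simp add: sqint_def)

lemma norm_mult_le_half:
  fixes a b :: "'a::real_normed_algebra"
  shows "norm (a * b) \<le> ((norm a)\<^sup>2 + (norm b)\<^sup>2) / 2"
proof -
  have "norm a * norm b \<le> ((norm a)\<^sup>2 + (norm b)\<^sup>2) / 2"
    using sum_squares_ge_zero[of "norm a - norm b" 0] by (simp add: power2_eq_square algebra_simps)
  then show ?thesis using norm_mult_ineq order_trans by blast
qed

lemma sqint_mult_integrable:
  fixes f g :: "'a \<Rightarrow> 'b::{banach, second_countable_topology, real_normed_algebra}"
  assumes "sqint M f" "sqint M g" shows "integrable M (\<lambda>x. f x * g x)"
proof -
  note [measurable] = assms[THEN sqint_measurable]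
  have "integrable M (\<lambda>x. ((norm (f x))\<^sup>2 + (norm (g x))\<^sup>2) / 2)"
    by (intro Bochner_Integration.integrable_add integrable_mult_right integrable_divide sqint_integrable assms)
  then show ?thesis
    by (rule Bochner_Integration.integrable_bound) (use norm_mult_le_half in \<open>fastforce intro!: AE_I2\<close>)+
qed

text \<open>Nonnegativity of the integral of \<open>(b * f x - c * g x)\<^sup>2\<close> yields
  \<open>0 \<le> b * (a * b - c\<^sup>2)\<close>; only \<open>b = 0\<close>, where g vanishes almost
  everywhere, needs a separate argument.\<close>

lemma sqint_Cauchy_Schwarz:
  fixes f g :: "'a \<Rightarrow> real"
  assumes f: "sqint M f" and g: "sqint M g"
  shows "(LINT x|M. f x * g x)\<^sup>2 \<le> (LINT x|M. (f x)\<^sup>2) * (LINT x|M. (g x)\<^sup>2)"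
proof -
  define a b c where "a = (LINT x|M. (f x)\<^sup>2)" and "b = (LINT x|M. (g x)\<^sup>2)"
    and "c = (LINT x|M. f x * g x)"
  note [simp] = sqint_integrable_real[OF f] sqint_integrable_real[OF g] sqint_mult_integrable[OF f g]
  have "0 \<le> (LINT x|M. (b * f x - c * g x)\<^sup>2)" by simp
  also have "(\<lambda>x. (b * f x - c * g x)\<^sup>2) = (\<lambda>x. b\<^sup>2 * (f x)\<^sup>2 + (c\<^sup>2 * (g x)\<^sup>2 - 2 * b * c * (f x * g x)))"
    by (auto simp: power2_eq_square algebra_simps)
  also have "(LINT x|M. b\<^sup>2 * (f x)\<^sup>2 + (c\<^sup>2 * (g x)\<^sup>2 - 2 * b * c * (f x * g x)))
      = b\<^sup>2 * a + (c\<^sup>2 * b - 2 * b * c * c)"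
    unfolding a_def b_def c_def by simp
  finally have *: "0 \<le> b * (a * b - c\<^sup>2)" by (simp add: power2_eq_square algebra_simps)
  have "b \<ge> 0" "a \<ge> 0" by (auto simp: a_def b_def)
  show ?thesis
  proof (cases "b = 0")
    case True
    have "AE x in M. (g x)\<^sup>2 = 0"
      using True unfolding b_def by (subst (asm) integral_nonneg_eq_0_iff_AE) auto
    then have "c = 0" unfolding c_def
      using f g by (intro integral_eq_zero_AE) auto
    then show ?thesis using True by (simp add: a_def[symmetric] b_def[symmetric] c_def[symmetric])
  next
    case False
    with * \<open>b \<ge> 0\<close> have "0 \<le> a * b - c\<^sup>2" by (simp add: zero_le_mult_iff)
    then show ?thesis by (simp add: a_def[symmetric] b_def[symmetric] c_def[symmetric])
  qed
qed

text \<open>Young's inequality with weight \<delta> splits the mixed term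
  \<open>2 * d * norm b\<close>. Because \<delta> is free, convergence in mean square implies
  convergence of the squared norms without Minkowski's inequality.\<close>

lemma abs_diff_norm_sq_le:
  fixes a b :: "'a::real_normed_vector"
  assumes "0 < \<delta>"
  shows "\<bar>(norm a)\<^sup>2 - (norm b)\<^sup>2\<bar> \<le> (1 + 1 / \<delta>) * (norm (a - b))\<^sup>2 + \<delta> * (norm b)\<^sup>2"
proof -
  define d where "d = norm (a - b)"
  have d: "\<bar>norm a - norm b\<bar> \<le> d" unfolding d_def by (rule norm_triangle_ineq3)
  have "\<bar>(norm a)\<^sup>2 - (norm b)\<^sup>2\<bar> = \<bar>norm a - norm b\<bar> * (norm a + norm b)"
    by (simp add: power2_eq_square square_diff_square_factored abs_mult abs_of_nonneg)
  also have "\<dots> \<le> d * (2 * norm b + d)" using d by (intro mult_mono) auto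
  also have "\<dots> \<le> (1 + 1 / \<delta>) * d\<^sup>2 + \<delta> * (norm b)\<^sup>2"
  proof -
    have "0 \<le> (d - \<delta> * norm b)\<^sup>2 / \<delta>" using assms by simp
    also have "\<dots> = d\<^sup>2 / \<delta> + \<delta> * (norm b)\<^sup>2 - 2 * d * norm b"
      using assms by (simp add: power2_eq_square field_simps)
    finally show ?thesis by (simp add: power2_eq_square algebra_simps)
  qed
  finally show ?thesis unfolding d_def .
qed

lemma sqint_tendsto_integral_norm:
  fixes f :: "nat \<Rightarrow> 'a \<Rightarrow> 'b::{banach, second_countable_topology}"
  assumes f: "\<And>n. sqint M (f n)" and g: "sqint M g"
    and lim: "(\<lambda>n. LINT x|M. (norm (f n x - g x))\<^sup>2) \<longlonglongrightarrow> 0"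
  shows "(\<lambda>n. LINT x|M. (norm (f n x))\<^sup>2) \<longlonglongrightarrow> (LINT x|M. (norm (g x))\<^sup>2)"
proof -
  define b where "b = (LINT x|M. (norm (g x))\<^sup>2)"
  have b: "b \<ge> 0" by (simp add: b_def)
  note [simp] = sqint_integrable[OF f] sqint_integrable[OF g] sqint_integrable[OF sqint_diff[OF f g]]
  have bound: "\<bar>(LINT x|M. (norm (f n x))\<^sup>2) - b\<bar>
      \<le> (1 + 1 / \<delta>) * (LINT x|M. (norm (f n x - g x))\<^sup>2) + \<delta> * b" if "\<delta> > 0" for \<delta> n
  proof -
    have "\<bar>(LINT x|M. (norm (f n x))\<^sup>2) - b\<bar> = \<bar>LINT x|M. (norm (f n x))\<^sup>2 - (norm (g x))\<^sup>2\<bar>"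
      unfolding b_def by simp
    also have "\<dots> \<le> (LINT x|M. \<bar>(norm (f n x))\<^sup>2 - (norm (g x))\<^sup>2\<bar>)"
      by (rule integral_abs_bound)
    also have "\<dots> \<le> (LINT x|M. (1 + 1 / \<delta>) * (norm (f n x - g x))\<^sup>2 + \<delta> * (norm (g x))\<^sup>2)"
      using that by (intro integral_mono) (auto simp: abs_diff_norm_sq_le)
    also have "\<dots> = (1 + 1 / \<delta>) * (LINT x|M. (norm (f n x - g x))\<^sup>2) + \<delta> * b"
      unfolding b_def by simp
    finally show ?thesis .
  qed
  show ?thesis
  proof (rule LIMSEQ_I)
    fix r :: real assume r: "0 < r"
    define \<delta> where "\<delta> = r / (2 * (b + 1))"
    have \<delta>: "\<delta> > 0" "\<delta> * b < r / 2" using r b by (auto simp: \<delta>_def field_simps)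
    have "(\<lambda>n. (1 + 1 / \<delta>) * (LINT x|M. (norm (f n x - g x))\<^sup>2)) \<longlonglongrightarrow> (1 + 1 / \<delta>) * 0"
      by (intro tendsto_intros lim)
    then have "\<forall>\<^sub>F n in sequentially. (1 + 1 / \<delta>) * (LINT x|M. (norm (f n x - g x))\<^sup>2) < r / 2"
      using r by (intro order_tendstoD(2)) auto
    then have "\<forall>\<^sub>F n in sequentially. norm ((LINT x|M. (norm (f n x))\<^sup>2) - b) < r"
    proof eventually_elim
      fix n assume "(1 + 1 / \<delta>) * (LINT x|M. (norm (f n x - g x))\<^sup>2) < r / 2"
      then show "norm ((LINT x|M. (norm (f n x))\<^sup>2) - b) < r"
        using bound[OF \<delta>(1), of n] \<delta>(2) unfolding real_norm_def by linarith
    qed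
    then show "\<exists>no. \<forall>n\<ge>no. norm ((LINT x|M. (norm (f n x))\<^sup>2) - (LINT x|M. (norm (g x))\<^sup>2)) < r"
      unfolding eventually_sequentially b_def[symmetric] .
  qed
qed

lemma sqint_tendsto_inner:
  fixes f :: "nat \<Rightarrow> 'a \<Rightarrow> real"
  assumes f: "\<And>n. sqint M (f n)" and g: "sqint M g" and h: "sqint M h"
    and lim: "(\<lambda>n. LINT x|M. (f n x - g x)\<^sup>2) \<longlonglongrightarrow> 0"
  shows "(\<lambda>n. LINT x|M. h x * f n x) \<longlonglongrightarrow> (LINT x|M. h x * g x)"
proof -
  have "(\<lambda>n. (LINT x|M. h x * (f n x - g x))\<^sup>2) \<longlonglongrightarrow> 0"
  proof (rule tendsto_sandwich[OF _ _ tendsto_const])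
    show "(\<lambda>n. (LINT x|M. (h x)\<^sup>2) * (LINT x|M. (f n x - g x)\<^sup>2)) \<longlonglongrightarrow> 0"
      using tendsto_mult_right_zero[OF lim] by simp
  qed (use sqint_Cauchy_Schwarz[OF h sqint_diff[OF f g]] in auto)
  then have "(\<lambda>n. LINT x|M. h x * (f n x - g x)) \<longlonglongrightarrow> 0" by simp
  moreover have "(LINT x|M. h x * (f n x - g x)) = (LINT x|M. h x * f n x) - (LINT x|M. h x * g x)" for n
    using sqint_mult_integrable[OF h f] sqint_mult_integrable[OF h g] by (simp add: right_diff_distrib)
  ultimately show ?thesis by (simp add: LIM_zero_iff)
qed

text \<open>Fatou's lemma is applied to nonnegative integrals, so that integrability of the limit
  comes out as a conclusion. This supplies square integrability of limits both in
  \<open>L\<^sup>2\<close> and in X.\<close>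

lemma integral_Fatou_bound:
  fixes f :: "nat \<Rightarrow> 'a \<Rightarrow> real"
  assumes f: "\<And>n. integrable M (f n)" and nonneg: "\<And>n x. 0 \<le> f n x"
    and g: "g \<in> borel_measurable M" and lim: "AE x in M. (\<lambda>n. f n x) \<longlonglongrightarrow> g x"
    and bound: "\<forall>\<^sub>F n in sequentially. (LINT x|M. f n x) \<le> B"
  shows "integrable M g" "(LINT x|M. g x) \<le> B"
proof -
  have [measurable]: "f n \<in> borel_measurable M" for n using f by auto
  note [measurable] = g
  have B: "B \<ge> 0"
    using eventually_happens'[OF sequentially_bot bound] nonneg
    by (meson order_trans Bochner_Integration.integral_nonneg)
  have g0: "AE x in M. 0 \<le> g x"
    using lim by eventually_elim (meson LIMSEQ_le_const nonneg)
  have "(\<integral>\<^sup>+x. ennreal (g x) \<partial>M) = (\<integral>\<^sup>+x. liminf (\<lambda>n. ennreal (f n x)) \<partial>M)"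
    using lim
  proof (intro nn_integral_cong_AE, eventually_elim)
    fix x assume "(\<lambda>n. f n x) \<longlonglongrightarrow> g x"
    then have "(\<lambda>n. ennreal (f n x)) \<longlonglongrightarrow> ennreal (g x)" by (rule tendsto_ennrealI)
    then show "ennreal (g x) = liminf (\<lambda>n. ennreal (f n x))"
      by (metis lim_imp_Liminf sequentially_bot)
  qed
  also have "\<dots> \<le> liminf (\<lambda>n. \<integral>\<^sup>+x. ennreal (f n x) \<partial>M)"
    by (intro nn_integral_liminf) measurable
  also have "\<dots> \<le> ennreal B"
  proof -
    have "liminf (\<lambda>n. \<integral>\<^sup>+x. ennreal (f n x) \<partial>M) \<le> liminf (\<lambda>n. ennreal B)"
    proof (rule Liminf_mono)
      show "\<forall>\<^sub>F n in sequentially. (\<integral>\<^sup>+x. ennreal (f n x) \<partial>M) \<le> ennreal B"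
        using bound
      proof eventually_elim
        fix n assume "(LINT x|M. f n x) \<le> B"
        then show "(\<integral>\<^sup>+x. ennreal (f n x) \<partial>M) \<le> ennreal B"
          by (subst nn_integral_eq_integral[OF f]) (auto simp: nonneg ennreal_leI)
      qed
    qed
    then show ?thesis by (simp add: Liminf_const)
  qed
  finally have *: "(\<integral>\<^sup>+x. ennreal (g x) \<partial>M) \<le> ennreal B" .
  then show "integrable M g"
    using g0 by (intro integrableI_nonneg) (auto simp: top_unique less_top[symmetric])
  then have "ennreal (LINT x|M. g x) \<le> ennreal B"
    using * by (subst nn_integral_eq_integral[symmetric]) (auto intro: g0)
  then show "(LINT x|M. g x) \<le> B" using B by (simp add: ennreal_le_iff)
qed

text \<open>If \<open>\<Sum>k. 2 ^ k * \<parallel>w (r (Suc k)) - w (r k)\<parallel>\<^sup>2\<close> converges, then almost everywhere the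
  increments are bounded by a multiple of \<open>sqrt (1 / 2) ^ k\<close>.\<close>

lemma sqint_complete:
  fixes w :: "nat \<Rightarrow> 'a \<Rightarrow> 'b::{banach, second_countable_topology}"
  assumes w: "\<And>n. sqint M (w n)"
    and Cau: "\<And>e. e > 0 \<Longrightarrow> \<exists>N. \<forall>m\<ge>N. \<forall>n\<ge>N. (LINT x|M. (norm (w m x - w n x))\<^sup>2) < e"
  obtains v r where "sqint M v" "strict_mono (r :: nat \<Rightarrow> nat)"
    "AE x in M. (\<lambda>k. w (r k) x) \<longlonglongrightarrow> v x"
    "(\<lambda>n. LINT x|M. (norm (w n x - v x))\<^sup>2) \<longlonglongrightarrow> 0"
proof -
  note [measurable] = w[THEN sqint_measurable]
  have "\<exists>N. \<forall>k. (\<forall>m\<ge>N k. \<forall>n\<ge>N k. (LINT x|M. (norm (w m x - w n x))\<^sup>2) < (1/4)^k)"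
    by (intro choice allI Cau) simp
  then obtain N where N: "\<And>k m n. m \<ge> N k \<Longrightarrow> n \<ge> N k \<Longrightarrow> (LINT x|M. (norm (w m x - w n x))\<^sup>2) < (1/4)^k"
    by blast
  \<comment> \<open>The sum makes \<open>r k\<close> at least \<open>N k\<close>, and the added
    \<open>k\<close> makes \<open>r\<close> strictly increasing.\<close>
  define r where "r k = (\<Sum>j\<le>k. N j) + k" for k
  have r: "strict_mono r" unfolding strict_mono_Suc_iff r_def by simp
  have rN: "r k \<ge> N k" for k
    unfolding r_def using member_le_sum[of k "{..k}" N] by simp
  define a where "a k x = (norm (w (r (Suc k)) x - w (r k) x))\<^sup>2" for k x
  have a_int: "integrable M (a k)" for k
    unfolding a_def by (intro sqint_integrable sqint_diff w)
  have a_le: "(LINT x|M. a k x) \<le> (1/4)^k" for k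
    unfolding a_def using N[of k "r (Suc k)" "r k"] rN[of k] r
    by (meson less_imp_le order_trans strict_mono_Suc_iff)
  have [measurable]: "a k \<in> borel_measurable M" for k unfolding a_def by measurable
  have "(\<integral>\<^sup>+x. (\<Sum>k. ennreal (2^k * a k x)) \<partial>M) = (\<Sum>k. \<integral>\<^sup>+x. ennreal (2^k * a k x) \<partial>M)"
    by (rule nn_integral_suminf) measurable
  also have "\<dots> = (\<Sum>k. ennreal (LINT x|M. 2^k * a k x))"
    by (intro suminf_cong nn_integral_eq_integral integrable_mult_right a_int AE_I2)
      (simp add: a_def)
  also have "\<dots> \<le> (\<Sum>k. ennreal ((1/2)^k))"
  proof (intro suminf_le ennreal_leI)
    fix k show "(LINT x|M. 2^k * a k x) \<le> (1/2)^k"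
      using mult_left_mono[OF a_le[of k], of "2^k"] by (simp add: power_mult_distrib[symmetric])
  qed auto
  also have "\<dots> < \<infinity>"
    by (simp add: suminf_ennreal_eq[OF _ geometric_sums[of "1/2::real"]])
  finally have "AE x in M. (\<Sum>k. ennreal (2^k * a k x)) \<noteq> \<infinity>"
    by (intro nn_integral_PInf_AE) auto
  then have conv: "AE x in M. convergent (\<lambda>k. w (r k) x)"
  proof eventually_elim
    fix x assume "(\<Sum>k. ennreal (2^k * a k x)) \<noteq> \<infinity>"
    then have "summable (\<lambda>k. 2^k * a k x)"
      by (intro summable_suminf_not_top) (auto simp: a_def)
    then have "Bseq (\<lambda>k. 2^k * a k x)" by (rule summable_imp_Bseq)
    then obtain C where C: "\<And>k. \<bar>2^k * a k x\<bar> \<le> C"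
      unfolding Bseq_def real_norm_def by blast
    have "norm (w (r (Suc k)) x - w (r k) x) \<le> sqrt C * (sqrt (1/2))^k" for k
    proof -
      have "2^k * a k x \<le> C" using C[of k] by linarith
      then have "a k x \<le> C * (1/2)^k" by (simp add: power_one_over divide_simps mult.commute)
      then have "sqrt (a k x) \<le> sqrt (C * (1/2)^k)" by simp
      then show ?thesis by (simp add: a_def real_sqrt_mult real_sqrt_power)
    qed
    then have "summable (\<lambda>k. w (r (Suc k)) x - w (r k) x)"
      by (intro summable_comparison_test[OF _ summable_mult[OF summable_geometric]])
        (auto simp: real_sqrt_divide)
    then have "convergent (\<lambda>n. \<Sum>k<n. w (r (Suc k)) x - w (r k) x)"
      by (simp add: summable_iff_convergent)
    then have "convergent (\<lambda>n. w (r n) x - w (r 0) x)"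
      by (simp add: sum_lessThan_telescope[of "\<lambda>k. w (r k) x"])
    then show "convergent (\<lambda>n. w (r n) x)"
      by (simp add: convergent_diff_const_right_iff)
  qed
  \<comment> \<open>The value 0 on the divergence set, which is measurable because it is described
    by the Cauchy condition, makes the limit measurable everywhere.\<close>
  define v where "v x = (if convergent (\<lambda>k. w (r k) x) then lim (\<lambda>k. w (r k) x) else 0)" for x
  have [measurable]: "Measurable.pred M (\<lambda>x. Cauchy (\<lambda>k. w (r k) x))"
    using sets_Collect_Cauchy[of "\<lambda>k. w (r k)" M] by (simp add: pred_def)
  have [measurable]: "(\<lambda>x. lim (\<lambda>k. w (r k) x)) \<in> borel_measurable M"
    by (rule borel_measurable_lim_metric) measurable
  have [measurable]: "v \<in> borel_measurable M"
    unfolding v_def Cauchy_convergent_iff[symmetric] by measurable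
  have ae: "AE x in M. (\<lambda>k. w (r k) x) \<longlonglongrightarrow> v x"
    using conv by eventually_elim (simp add: v_def convergent_LIMSEQ_iff)
  have close: "integrable M (\<lambda>x. (norm (w n x - v x))\<^sup>2) \<and> (LINT x|M. (norm (w n x - v x))\<^sup>2) \<le> (1/4)^k"
    if "n \<ge> N k" for n k
  proof -
    have "AE x in M. (\<lambda>j. (norm (w n x - w (r j) x))\<^sup>2) \<longlonglongrightarrow> (norm (w n x - v x))\<^sup>2"
      using ae by eventually_elim (intro tendsto_intros)
    moreover have "\<forall>\<^sub>F j in sequentially. (LINT x|M. (norm (w n x - w (r j) x))\<^sup>2) \<le> (1/4)^k"
    proof (rule eventually_sequentiallyI[of "N k"])
      fix j assume "N k \<le> j"
      then have "N k \<le> r j" using seq_suble[OF r, of j] by simp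
      then show "(LINT x|M. (norm (w n x - w (r j) x))\<^sup>2) \<le> (1/4)^k"
        using N[OF that] by (simp add: less_imp_le)
    qed
    ultimately show ?thesis
      using integral_Fatou_bound[of M "\<lambda>j x. (norm (w n x - w (r j) x))\<^sup>2" "\<lambda>x. (norm (w n x - v x))\<^sup>2" "(1/4)^k"]
        sqint_integrable[OF sqint_diff[OF w w]] by auto
  qed
  have "sqint M (\<lambda>x. w (N 0) x - v x)"
    using close[of 0 "N 0"] by (auto simp: sqint_def)
  from sqint_diff[OF w[of "N 0"] this] have v: "sqint M v" by simp
  have "(\<lambda>n. LINT x|M. (norm (w n x - v x))\<^sup>2) \<longlonglongrightarrow> 0"
  proof (rule LIMSEQ_I)
    fix e :: real assume "0 < e"
    then obtain k where "(1/4::real)^k < e" using real_arch_pow_inv[of e "1/4"] by auto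
    then show "\<exists>no. \<forall>n\<ge>no. norm ((LINT x|M. (norm (w n x - v x))\<^sup>2) - 0) < e"
      using close by (intro exI[of _ "N k"]) fastforce
  qed
  then show thesis using that v r ae by blast
qed

text \<open>The integrand is split according to whether \<open>\<bar>q k x - q\<^sub>0 x\<bar> \<le> N * \<bar>p x\<bar>\<close>: there dominated
  convergence applies, and elsewhere \<open>\<bar>(q k x - q\<^sub>0 x) * p x\<bar> \<le> (q k x - q\<^sub>0 x)\<^sup>2 / N\<close>.\<close>

lemma sqint_weak_convergence:
  fixes q :: "nat \<Rightarrow> 'a \<Rightarrow> real"
  assumes q: "\<And>k. sqint M (q k)" and q0: "sqint M q\<^sub>0" and p: "sqint M p"
    and ae: "AE x in M. (\<lambda>k. q k x) \<longlonglongrightarrow> q\<^sub>0 x"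
    and bound: "\<And>k. (LINT x|M. (q k x)\<^sup>2) \<le> B"
  shows "(\<lambda>k. LINT x|M. q k x * p x) \<longlonglongrightarrow> (LINT x|M. q\<^sub>0 x * p x)"
proof -
  note [measurable] = q[THEN sqint_measurable] q0[THEN sqint_measurable] p[THEN sqint_measurable]
  define d where "d k x = q k x - q\<^sub>0 x" for k x
  define B' where "B' = 2 * B + 2 * (LINT x|M. (q\<^sub>0 x)\<^sup>2)"
  have d: "sqint M (d k)" for k unfolding d_def by (intro sqint_diff q q0)
  note [measurable] = d[THEN sqint_measurable]
  have dB: "(LINT x|M. (d k x)\<^sup>2) \<le> B'" for k
  proof -
    have "(LINT x|M. (d k x)\<^sup>2) \<le> (LINT x|M. 2 * (q k x)\<^sup>2 + 2 * (q\<^sub>0 x)\<^sup>2)"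
      using sqint_integrable_real[OF q] sqint_integrable_real[OF q0] sqint_integrable_real[OF d]
        norm_diff_sq_le[of "q k _" "q\<^sub>0 _"]
      by (intro integral_mono) (auto simp: d_def)
    also have "\<dots> \<le> B'"
      using sqint_integrable_real[OF q] sqint_integrable_real[OF q0] bound[of k] by (simp add: B'_def)
    finally show ?thesis .
  qed
  have B'0: "B' \<ge> 0" using dB[of 0] by (meson Bochner_Integration.integral_nonneg order_trans zero_le_power2)
  have main: "(\<lambda>k. LINT x|M. \<bar>d k x * p x\<bar>) \<longlonglongrightarrow> 0"
  proof (rule LIMSEQ_I)
    fix e :: real assume e: "0 < e"
    \<comment> \<open>Chosen so that the region where \<open>\<bar>d k x\<bar>\<close> exceeds
      \<open>N * \<bar>p x\<bar>\<close> contributes at most \<open>B' / N < e / 2\<close>,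
      uniformly in k.\<close>
    define N where "N = 2 * (B' + 1) / e"
    have N: "N > 0" "B' / N < e / 2" using e B'0 by (auto simp: N_def field_simps)
    define g where "g k x = (if \<bar>d k x\<bar> \<le> N * \<bar>p x\<bar> then \<bar>d k x * p x\<bar> else 0)" for k x
    have [measurable]: "g k \<in> borel_measurable M" for k unfolding g_def by measurable
    have g_le: "\<bar>g k x\<bar> \<le> N * (p x)\<^sup>2" for k x
      unfolding g_def using N mult_right_mono[of "\<bar>d k x\<bar>" "N * \<bar>p x\<bar>" "\<bar>p x\<bar>"]
      by (auto simp: abs_mult power2_eq_square)
    have "(\<lambda>k. LINT x|M. g k x) \<longlonglongrightarrow> (LINT x|M. 0)"
    proof (rule integral_dominated_convergence[where w = "\<lambda>x. N * (p x)\<^sup>2"])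
      show "AE x in M. (\<lambda>k. g k x) \<longlonglongrightarrow> 0" using ae
      proof eventually_elim
        fix x assume "(\<lambda>k. q k x) \<longlonglongrightarrow> q\<^sub>0 x"
        then have "(\<lambda>k. d k x) \<longlonglongrightarrow> 0" unfolding d_def by (simp add: LIM_zero)
        then have "(\<lambda>k. \<bar>d k x * p x\<bar>) \<longlonglongrightarrow> 0"
          by (simp add: tendsto_mult_left_zero tendsto_rabs_zero)
        then show "(\<lambda>k. g k x) \<longlonglongrightarrow> 0"
          by (rule tendsto_sandwich[OF _ _ tendsto_const, rotated 2]) (auto simp: g_def)
      qed
    qed (use g_le sqint_integrable_real[OF p] in auto)
    then have ev: "\<forall>\<^sub>F k in sequentially. (LINT x|M. g k x) < e / 2"
      using e by (intro order_tendstoD(2)) auto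
    have le: "(LINT x|M. \<bar>d k x * p x\<bar>) \<le> (LINT x|M. g k x) + B' / N" for k
    proof -
      have gi: "integrable M (g k)"
        by (rule Bochner_Integration.integrable_bound[of _ "\<lambda>x. N * (p x)\<^sup>2"])
          (use g_le sqint_integrable_real[OF p] N in \<open>auto simp: abs_mult\<close>)
      have "(LINT x|M. \<bar>d k x * p x\<bar>) \<le> (LINT x|M. g k x + (d k x)\<^sup>2 / N)"
      proof (intro integral_mono)
        fix x
        show "\<bar>d k x * p x\<bar> \<le> g k x + (d k x)\<^sup>2 / N"
        proof (cases "\<bar>d k x\<bar> \<le> N * \<bar>p x\<bar>")
          case False
          then have "N * \<bar>p x\<bar> * \<bar>d k x\<bar> \<le> \<bar>d k x\<bar> * \<bar>d k x\<bar>" by (intro mult_right_mono) auto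
          then show ?thesis using False N by (simp add: g_def abs_mult power2_eq_square field_simps)
        qed (use N in \<open>auto simp: g_def\<close>)
      qed (use sqint_mult_integrable[OF d p] gi sqint_integrable_real[OF d] in auto)
      also have "\<dots> \<le> (LINT x|M. g k x) + B' / N"
        using gi sqint_integrable_real[OF d] dB[of k] N by (simp add: divide_right_mono)
      finally show ?thesis .
    qed
    from ev have "\<forall>\<^sub>F k in sequentially. (LINT x|M. \<bar>d k x * p x\<bar>) < e"
    proof eventually_elim
      fix k assume "(LINT x|M. g k x) < e / 2"
      then show "(LINT x|M. \<bar>d k x * p x\<bar>) < e" using le[of k] N(2) by linarith
    qed
    then show "\<exists>no. \<forall>n\<ge>no. norm ((LINT x|M. \<bar>d n x * p x\<bar>) - 0) < e"
      unfolding eventually_sequentially by simp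
  qed
  have "(\<lambda>k. LINT x|M. d k x * p x) \<longlonglongrightarrow> 0"
  proof (rule tendsto_rabs_zero_cancel, rule tendsto_sandwich[OF _ _ tendsto_const main])
    show "\<forall>\<^sub>F k in sequentially. \<bar>LINT x|M. d k x * p x\<bar> \<le> (LINT x|M. \<bar>d k x * p x\<bar>)"
      by (intro always_eventually allI integral_abs_bound)
  qed auto
  moreover have "(LINT x|M. d k x * p x) = (LINT x|M. q k x * p x) - (LINT x|M. q\<^sub>0 x * p x)" for k
    unfolding d_def using sqint_mult_integrable[OF q p] sqint_mult_integrable[OF q0 p]
    by (simp add: left_diff_distrib)
  ultimately show ?thesis by (simp add: LIM_zero_iff)
qed

subsection \<open>Plancherel's identity for compactly supported functions\<close>

definition ft :: "(real \<Rightarrow> complex) \<Rightarrow> real \<Rightarrow> complex" where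
  "ft u \<xi> = complex_of_real (1 / sqrt (2 * pi)) * (LINT x|lborel. cis (- (x * \<xi>)) * u x)"

lemma cis_measurable [measurable]: "cis \<in> borel_measurable borel"
  by (intro borel_measurable_continuous_onI continuous_intros)

lemma cnj_measurable [measurable]: "cnj \<in> borel_measurable borel"
  by (intro borel_measurable_continuous_onI continuous_intros)

lemma integrable_indicator_Icc [simp]: "integrable lborel (indicator {a..b} :: real \<Rightarrow> real)"
  by (rule integrable_real_indicator) (auto simp: emeasure_lborel_Icc_eq)

lemma truncated_fourier_eq_ft: "truncated_fourier R u = ft (\<lambda>x. indicator {-R..R} x *\<^sub>R u x)"
  by (auto simp: truncated_fourier_def ft_def set_lebesgue_integral_def fun_eq_iff
      intro!: Bochner_Integration.integral_cong)

lemma ft_measurable [measurable]: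
  assumes [measurable]: "u \<in> borel_measurable borel"
  shows "ft u \<in> borel_measurable borel"
  unfolding ft_def by measurable

lemma integrable_cis_mult:
  fixes u :: "real \<Rightarrow> complex"
  assumes "integrable lborel u" shows "integrable lborel (\<lambda>x. cis (- (x * \<xi>)) * u x)"
proof (rule Bochner_Integration.integrable_bound[OF assms])
  have [measurable]: "u \<in> borel_measurable borel" using assms by auto
  show "(\<lambda>x. cis (- (x * \<xi>)) * u x) \<in> borel_measurable lborel" by measurable
qed (simp add: norm_mult)

lemma norm_ft_le:
  assumes "integrable lborel u"
  shows "norm (ft u \<xi>) \<le> (1 / sqrt (2 * pi)) * (LINT x|lborel. norm (u x))"
proof -
  have "norm (LINT x|lborel. cis (- (x * \<xi>)) * u x) \<le> (LINT x|lborel. norm (cis (- (x * \<xi>)) * u x))"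
    by (rule integral_norm_bound)
  from divide_right_mono[OF this, of "sqrt (2 * pi)"] show ?thesis by (simp add: ft_def norm_divide norm_mult)
qed

lemma ft_add:
  assumes "integrable lborel u" "integrable lborel v"
  shows "ft (\<lambda>x. u x + v x) \<xi> = ft u \<xi> + ft v \<xi>"
  using integrable_cis_mult[OF assms(1)] integrable_cis_mult[OF assms(2)]
  by (simp add: ft_def distrib_left)

lemma ft_diff:
  assumes "integrable lborel u" "integrable lborel v"
  shows "ft (\<lambda>x. u x - v x) \<xi> = ft u \<xi> - ft v \<xi>"
  using integrable_cis_mult[OF assms(1)] integrable_cis_mult[OF assms(2)]
  by (simp add: ft_def right_diff_distrib)

lemma ft_translate: "ft (\<lambda>x. u (x + t)) \<xi> = cis (t * \<xi>) * ft u \<xi>"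
proof -
  have "(LINT x|lborel. cis (- (x * \<xi>)) * u (x + t))
      = (LINT x|lborel. cis (- ((-t + 1 * x) * \<xi>)) * u ((-t + 1 * x) + t))"
    using lborel_integral_real_affine[of 1 "\<lambda>x. cis (- (x * \<xi>)) * u (x + t)" "-t"] by simp
  also have "\<dots> = (LINT x|lborel. cis (t * \<xi>) * (cis (- (x * \<xi>)) * u x))"
  proof (intro Bochner_Integration.integral_cong refl)
    fix x
    have "cis (- ((- t + 1 * x) * \<xi>)) = cis (t * \<xi>) * cis (- (x * \<xi>))"
      by (simp add: cis_mult algebra_simps)
    then show "cis (- ((- t + 1 * x) * \<xi>)) * u ((- t + 1 * x) + t) = cis (t * \<xi>) * (cis (- (x * \<xi>)) * u x)"
      by simp
  qed
  finally show ?thesis by (simp add: ft_def)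
qed

text \<open>On the support \<open>norm (u x) \<le> 1 + (norm (u x))\<^sup>2\<close>, and the
  constant is integrable over the bounded interval.\<close>

lemma sqint_compact_support_integrable:
  fixes u :: "real \<Rightarrow> 'b::{banach, second_countable_topology}"
  assumes u: "sqint lborel u" and R: "\<And>x. R < \<bar>x\<bar> \<Longrightarrow> u x = 0"
  shows "integrable lborel u"
proof (rule Bochner_Integration.integrable_bound)
  show "integrable lborel (\<lambda>x. indicator {-R..R} x + (norm (u x))\<^sup>2 :: real)"
    by (intro Bochner_Integration.integrable_add sqint_integrable[OF u]) simp
  show "u \<in> borel_measurable lborel" by (rule sqint_measurable[OF u])
  have "norm (u x) \<le> indicator {-R..R} x + (norm (u x))\<^sup>2" for x
  proof (cases "R < \<bar>x\<bar>")
    case False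
    have "norm (u x) \<le> 1 + (norm (u x))\<^sup>2"
      using sum_squares_ge_zero[of "norm (u x) - 1/2" 0] by (simp add: power2_eq_square algebra_simps)
    then show ?thesis using False by (auto simp: indicator_def abs_le_iff)
  qed (simp add: R)
  then show "AE x in lborel. norm (u x) \<le> norm (indicator {-R..R} x + (norm (u x))\<^sup>2)"
    by (auto intro!: AE_I2 order_trans[OF _ abs_ge_self])
qed

lemma Gaussian_fourier:
  "(LINT s|lborel. std_normal_density s *\<^sub>R cis (t * s)) = complex_of_real (exp (- t\<^sup>2 / 2))"
proof -
  have "complex_of_real (exp (- t\<^sup>2 / 2)) = char std_normal_distribution t"
    by (simp add: char_std_normal_distribution)
  also have "\<dots> = (LINT s|lborel. std_normal_density s *\<^sub>R iexp (t * s))"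
    unfolding char_def by (subst integral_density) auto
  finally show ?thesis by (simp add: cis_conv_exp)
qed

lemma integrable_pair_mult:
  fixes f g :: "real \<Rightarrow> complex"
  assumes f: "integrable lborel f" and g: "integrable lborel g"
  shows "integrable (lborel \<Otimes>\<^sub>M lborel) (\<lambda>z. f (fst z) * g (snd z))"
proof (rule lborel_pair.Fubini_integrable)
  have [measurable]: "f \<in> borel_measurable borel" "g \<in> borel_measurable borel" using f g by auto
  show "(\<lambda>z. f (fst z) * g (snd z)) \<in> borel_measurable (lborel \<Otimes>\<^sub>M lborel)" by measurable
  show "integrable lborel (\<lambda>x. LINT y|lborel. norm (f (fst (x, y)) * g (snd (x, y))))"
    using f g by (simp add: norm_mult)
  show "AE x in lborel. integrable lborel (\<lambda>y. f (fst (x, y)) * g (snd (x, y)))"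
    using g by simp
qed

text \<open>By translation invariance and
  \<open>norm (a * b) \<le> ((norm a)\<^sup>2 + (norm b)\<^sup>2) / 2\<close> the bounds do not
  depend on the shift t; they serve as dominating functions when the autocorrelation is averaged
  against a Gaussian.\<close>

lemma integrable_autocorrelation:
  fixes u :: "real \<Rightarrow> complex"
  assumes u: "sqint lborel u"
  shows "integrable lborel (\<lambda>x. u x * cnj (u (x + t)))"
    and "norm (LINT x|lborel. u x * cnj (u (x + t))) \<le> (LINT x|lborel. (norm (u x))\<^sup>2)"
    and "(LINT x|lborel. norm (u x * cnj (u (x + t)))) \<le> (LINT x|lborel. (norm (u x))\<^sup>2)"
proof -
  have shift: "(LINT x|lborel. (norm (u (x + t)))\<^sup>2) = (LINT x|lborel. (norm (u x))\<^sup>2)"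
    using lborel_integral_real_affine[of 1 "\<lambda>x. (norm (u x))\<^sup>2" t] by (simp add: add.commute)
  have ut: "sqint lborel (\<lambda>x. cnj (u (x + t)))"
    using u lborel_integrable_real_affine[of "\<lambda>x. (norm (u x))\<^sup>2" 1 t]
    by (auto simp: sqint_def add.commute)
  show i: "integrable lborel (\<lambda>x. u x * cnj (u (x + t)))"
    by (rule sqint_mult_integrable[OF u ut])
  have "(LINT x|lborel. norm (u x * cnj (u (x + t))))
      \<le> (LINT x|lborel. ((norm (u x))\<^sup>2 + (norm (cnj (u (x + t))))\<^sup>2) / 2)"
    using i sqint_integrable[OF u] sqint_integrable[OF ut]
    by (intro integral_mono norm_mult_le_half) auto
  also have "\<dots> = (LINT x|lborel. (norm (u x))\<^sup>2)"
    using sqint_integrable[OF u] sqint_integrable[OF ut] shift by simp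
  finally show le: "(LINT x|lborel. norm (u x * cnj (u (x + t)))) \<le> (LINT x|lborel. (norm (u x))\<^sup>2)" .
  show "norm (LINT x|lborel. u x * cnj (u (x + t))) \<le> (LINT x|lborel. (norm (u x))\<^sup>2)"
    using integral_norm_bound[of lborel "\<lambda>x. u x * cnj (u (x + t))"] le by linarith
qed

text \<open>Writing the squared modulus of \<open>ft u\<close> as a double integral and integrating
  over the frequency first turns the Gaussian weight into a Gaussian in \<open>k * (y - x)\<close>.
  The weight makes every use of Fubini legitimate; Plancherel's identity is the limit of large
  k.\<close>

lemma Gaussian_Plancherel:
  fixes u :: "real \<Rightarrow> complex"
  assumes u: "integrable lborel u" and u2: "sqint lborel u" and k: "k > 0"
  shows "(LINT \<xi>|lborel. exp (- (\<xi> / k)\<^sup>2 / 2) *\<^sub>R complex_of_real ((norm (ft u \<xi>))\<^sup>2))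
    = (LINT r|lborel. std_normal_density r *\<^sub>R (LINT x|lborel. u x * cnj (u (x + r / k))))"
proof -
  have [measurable]: "u \<in> borel_measurable borel" using u by auto
  \<comment> \<open>The integrand after the substitution \<xi> = k s, in which the weight becomes
    the standard normal density up to a constant.\<close>
  define H :: "real \<Rightarrow> real \<times> real \<Rightarrow> complex" where
    "H s z = std_normal_density s *\<^sub>R ((cis (- (fst z * (k * s))) * u (fst z)) * cnj (cis (- (snd z * (k * s))) * u (snd z)))" for s z
  have [measurable]: "case_prod H \<in> borel_measurable (lborel \<Otimes>\<^sub>M (lborel \<Otimes>\<^sub>M lborel))"
    unfolding H_def by measurable
  interpret P: pair_sigma_finite "lborel :: real measure" "lborel \<Otimes>\<^sub>M lborel :: (real \<times> real) measure"
    unfolding lborel_prod by unfold_locales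
  have uu: "integrable (lborel \<Otimes>\<^sub>M lborel) (\<lambda>z. u (fst z) * cnj (u (snd z)))"
    by (intro integrable_pair_mult[where g = "\<lambda>x. cnj (u x)"] u) (use u in simp)
  have norm_H: "norm (H s z) = std_normal_density s * norm (u (fst z) * cnj (u (snd z)))" for s z
    by (simp add: H_def norm_mult)
  have iH: "integrable (lborel \<Otimes>\<^sub>M (lborel \<Otimes>\<^sub>M lborel)) (case_prod H)"
  proof (rule P.Fubini_integrable)
    show "integrable lborel (\<lambda>s. LINT z|(lborel \<Otimes>\<^sub>M lborel). norm (case_prod H (s, z)))"
      unfolding split norm_H by simp
    have "integrable (lborel \<Otimes>\<^sub>M lborel) (H s)" for s
    proof (rule Bochner_Integration.integrable_bound[OF integrable_scaleR_right[OF uu, of "std_normal_density s"]])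
      show "H s \<in> borel_measurable (lborel \<Otimes>\<^sub>M lborel)" unfolding H_def by measurable
    qed (simp add: norm_H)
    then show "AE s in lborel. integrable (lborel \<Otimes>\<^sub>M lborel) (\<lambda>z. case_prod H (s, z))" by simp
  qed measurable
  have ft_sq: "std_normal_density s *\<^sub>R complex_of_real ((norm (ft u (k * s)))\<^sup>2)
      = (1 / (2 * pi)) *\<^sub>R (LINT z|(lborel \<Otimes>\<^sub>M lborel). H s z)" for s
  proof -
    define a where "a x = cis (- (x * (k * s))) * u x" for x
    have a: "integrable lborel a" unfolding a_def by (rule integrable_cis_mult[OF u])
    have "integrable (lborel \<Otimes>\<^sub>M lborel) (\<lambda>z. a (fst z) * cnj (a (snd z)))"
      by (intro integrable_pair_mult[where g = "\<lambda>x. cnj (a x)"] a) (use a in simp)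
    from lborel_pair.integral_fst'[OF this]
    have "(LINT z|(lborel \<Otimes>\<^sub>M lborel). a (fst z) * cnj (a (snd z))) = (LINT x|lborel. a x) * cnj (LINT x|lborel. a x)"
      by (simp add: integral_cnj)
    then have 1: "(LINT z|(lborel \<Otimes>\<^sub>M lborel). H s z) = std_normal_density s *\<^sub>R ((LINT x|lborel. a x) * cnj (LINT x|lborel. a x))"
      unfolding H_def a_def by simp
    have "complex_of_real ((norm (ft u (k * s)))\<^sup>2) = ft u (k * s) * cnj (ft u (k * s))"
      by (rule complex_norm_square)
    also have "\<dots> = (1 / (2 * pi)) *\<^sub>R ((LINT x|lborel. a x) * cnj (LINT x|lborel. a x))"
    proof -
      have "complex_of_real (1 / sqrt (2 * pi)) * complex_of_real (1 / sqrt (2 * pi)) = complex_of_real (1 / (2 * pi))"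
        by (simp only: of_real_mult[symmetric]) (simp add: real_sqrt_mult[symmetric])
      then show ?thesis unfolding ft_def a_def
        by (simp add: scaleR_conv_of_real mult_ac)
    qed
    finally show ?thesis using 1 by (simp add: scaleR_conv_of_real mult_ac)
  qed
  have H_int: "(LINT s|lborel. H s z) = (u (fst z) * cnj (u (snd z))) * complex_of_real (exp (- (k * (snd z - fst z))\<^sup>2 / 2))" for z
  proof -
    have "H s z = (u (fst z) * cnj (u (snd z))) * (std_normal_density s *\<^sub>R cis (k * (snd z - fst z) * s))" for s
    proof -
      have "cis (- (fst z * (k * s))) * cnj (cis (- (snd z * (k * s)))) = cis (k * (snd z - fst z) * s)"
        by (simp add: cis_cnj cis_mult algebra_simps)
      then show ?thesis unfolding H_def
        by (simp only: complex_cnj_mult scaleR_conv_of_real flip: \<open>_ = cis (k * (snd z - fst z) * s)\<close>) (simp only: mult_ac)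
    qed
    then show ?thesis by (simp only: integral_mult_right_zero Gaussian_fourier)
  qed
  define G where "G z = (u (fst z) * cnj (u (snd z))) * complex_of_real (exp (- (k * (snd z - fst z))\<^sup>2 / 2))" for z
  have [measurable]: "G \<in> borel_measurable (lborel \<Otimes>\<^sub>M lborel)" unfolding G_def by measurable
  have iG: "integrable (lborel \<Otimes>\<^sub>M lborel) G"
    by (rule Bochner_Integration.integrable_bound[OF uu])
      (auto simp: G_def norm_mult intro!: AE_I2 mult_left_le)
  have "(LINT s|lborel. std_normal_density s *\<^sub>R complex_of_real ((norm (ft u (k * s)))\<^sup>2))
      = (1 / (2 * pi)) *\<^sub>R (LINT s|lborel. LINT z|(lborel \<Otimes>\<^sub>M lborel). H s z)"
    unfolding ft_sq by simp
  also have "(LINT s|lborel. LINT z|(lborel \<Otimes>\<^sub>M lborel). H s z) = (LINT z|(lborel \<Otimes>\<^sub>M lborel). G z)"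
    using P.Fubini_integral[OF iH] by (simp add: H_int G_def)
  also have "\<dots> = (LINT x|lborel. LINT y|lborel. G (x, y))"
    using lborel_pair.integral_fst'[OF iG] by simp
  \<comment> \<open>The substitution y = x + r / k contributes 1 / k, and rewriting the Gaussian
    through the normal density contributes \<open>sqrt (2 * pi)\<close>; both constants cancel at
    the end against those of \<xi> = k s.\<close>
  also have "\<dots> = (LINT x|lborel. LINT r|lborel. (sqrt (2 * pi) / k) *\<^sub>R (std_normal_density r *\<^sub>R (u x * cnj (u (x + r / k)))))"
  proof (rule Bochner_Integration.integral_cong[OF refl])
    fix x
    have "(LINT y|lborel. G (x, y)) = (1 / k) *\<^sub>R (LINT r|lborel. G (x, x + (1 / k) * r))"
      using k by (subst lborel_integral_real_affine[of "1 / k" _ x]) simp_all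
    also have "\<dots> = (LINT r|lborel. (1 / k) *\<^sub>R G (x, x + (1 / k) * r))" by simp
    also have "\<dots> = (LINT r|lborel. (sqrt (2 * pi) / k) *\<^sub>R (std_normal_density r *\<^sub>R (u x * cnj (u (x + r / k)))))"
      using k by (intro Bochner_Integration.integral_cong refl)
        (simp add: G_def std_normal_density_def scaleR_conv_of_real mult_ac)
    finally show "(LINT y|lborel. G (x, y)) = (LINT r|lborel. (sqrt (2 * pi) / k) *\<^sub>R (std_normal_density r *\<^sub>R (u x * cnj (u (x + r / k)))))" .
  qed
  also have "\<dots> = (sqrt (2 * pi) / k) *\<^sub>R (LINT x|lborel. LINT r|lborel. std_normal_density r *\<^sub>R (u x * cnj (u (x + r / k))))"
    by (simp only: integral_scaleR_right)
  also have "(LINT x|lborel. LINT r|lborel. std_normal_density r *\<^sub>R (u x * cnj (u (x + r / k))))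
      = (LINT r|lborel. LINT x|lborel. std_normal_density r *\<^sub>R (u x * cnj (u (x + r / k))))"
  proof (rule lborel_pair.Fubini_integral[where f = "\<lambda>r x. std_normal_density r *\<^sub>R (u x * cnj (u (x + r / k)))"])
    show "integrable (lborel \<Otimes>\<^sub>M lborel) (\<lambda>(r, x). std_normal_density r *\<^sub>R (u x * cnj (u (x + r / k))))"
    proof (rule lborel_pair.Fubini_integrable)
      show "integrable lborel (\<lambda>r. LINT x|lborel. norm (case (r, x) of (r, x) \<Rightarrow> std_normal_density r *\<^sub>R (u x * cnj (u (x + r / k)))))"
      proof (rule Bochner_Integration.integrable_bound)
        show "integrable lborel (\<lambda>r. std_normal_density r * (LINT x|lborel. (norm (u x))\<^sup>2))" by simp
        show "AE r in lborel. norm (LINT x|lborel. norm (case (r, x) of (r, x) \<Rightarrow> std_normal_density r *\<^sub>R (u x * cnj (u (x + r / k)))))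
            \<le> norm (std_normal_density r * (LINT x|lborel. (norm (u x))\<^sup>2))"
          using integrable_autocorrelation(3)[OF u2]
          by (intro AE_I2) (simp add: abs_mult mult_left_mono)
      qed measurable
      show "AE r in lborel. integrable lborel (\<lambda>x. case (r, x) of (r, x) \<Rightarrow> std_normal_density r *\<^sub>R (u x * cnj (u (x + r / k))))"
        using integrable_autocorrelation(1)[OF u2] by simp
    qed measurable
  qed
  also have "\<dots> = (LINT r|lborel. std_normal_density r *\<^sub>R (LINT x|lborel. u x * cnj (u (x + r / k))))" by simp
  finally have **: "(LINT s|lborel. std_normal_density s *\<^sub>R complex_of_real ((norm (ft u (k * s)))\<^sup>2))
     = (1 / (2 * pi)) *\<^sub>R (sqrt (2 * pi) / k) *\<^sub>R (LINT r|lborel. std_normal_density r *\<^sub>R (LINT x|lborel. u x * cnj (u (x + r / k))))" .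
  have *: "(LINT s|lborel. std_normal_density s *\<^sub>R complex_of_real ((norm (ft u (k * s)))\<^sup>2))
     = (1 / (sqrt (2 * pi) * k)) *\<^sub>R (LINT r|lborel. std_normal_density r *\<^sub>R (LINT x|lborel. u x * cnj (u (x + r / k))))"
  proof -
    define q where "q = sqrt (2 * pi)"
    have q: "2 * pi = q * q" "q > 0" by (auto simp: q_def)
    have c: "(1 / (2 * pi)) * (q / k) = 1 / (q * k)" unfolding q(1) using q(2) k by simp
    show ?thesis using ** unfolding scaleR_scaleR q_def[symmetric] c .
  qed
  have "(LINT \<xi>|lborel. exp (- (\<xi> / k)\<^sup>2 / 2) *\<^sub>R complex_of_real ((norm (ft u \<xi>))\<^sup>2))
      = k *\<^sub>R (LINT s|lborel. exp (- ((0 + k * s) / k)\<^sup>2 / 2) *\<^sub>R complex_of_real ((norm (ft u (0 + k * s)))\<^sup>2))"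
    using k by (subst lborel_integral_real_affine[of k _ 0]) simp_all
  also have "\<dots> = k *\<^sub>R (LINT s|lborel. sqrt (2 * pi) *\<^sub>R (std_normal_density s *\<^sub>R complex_of_real ((norm (ft u (k * s)))\<^sup>2)))"
  proof -
    have "exp (- ((0 + k * s) / k)\<^sup>2 / 2) *\<^sub>R complex_of_real ((norm (ft u (0 + k * s)))\<^sup>2)
        = sqrt (2 * pi) *\<^sub>R (std_normal_density s *\<^sub>R complex_of_real ((norm (ft u (k * s)))\<^sup>2))" for s
      using k by (simp add: std_normal_density_def)
    then show ?thesis by (simp only:)
  qed
  also have "\<dots> = (k * sqrt (2 * pi)) *\<^sub>R (LINT s|lborel. std_normal_density s *\<^sub>R complex_of_real ((norm (ft u (k * s)))\<^sup>2))"
    unfolding integral_scaleR_right by (simp only: scaleR_scaleR)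
  finally show ?thesis unfolding * using k by simp
qed

text \<open>After cutting off large values, measurability provides continuous functions converging
  almost everywhere. They are bounded in height and support before the limit is taken, so that
  dominated convergence turns this into convergence in mean square.\<close>

lemma sqint_continuous_approximation:
  fixes u :: "real \<Rightarrow> complex"
  assumes u: "sqint lborel u" and R: "\<And>x. R < \<bar>x\<bar> \<Longrightarrow> u x = 0" and e: "e > 0"
  obtains g where "continuous_on UNIV g" "\<And>x. R + 1 < \<bar>x\<bar> \<Longrightarrow> g x = 0" "sqint lborel g"
    "(LINT x|lborel. (norm (u x - g x))\<^sup>2) < e"
proof -
  note [measurable] = sqint_measurable[OF u, simplified]
  define v where "v n x = (if norm (u x) \<le> real n then u x else 0)" for n x
  have [measurable]: "v n \<in> borel_measurable borel" for n unfolding v_def by measurable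
  have "(\<lambda>n. LINT x|lborel. (norm (u x - v n x))\<^sup>2) \<longlonglongrightarrow> integral\<^sup>L (lborel :: real measure) (\<lambda>_. 0)"
  proof (rule integral_dominated_convergence[where w = "\<lambda>x. (norm (u x))\<^sup>2"])
    show "AE x in lborel. (\<lambda>n. (norm (u x - v n x))\<^sup>2) \<longlonglongrightarrow> 0"
    proof (intro AE_I2 tendsto_eventually)
      fix x
      show "\<forall>\<^sub>F n in sequentially. (norm (u x - v n x))\<^sup>2 = 0"
        using eventually_ge_at_top[of "nat \<lceil>norm (u x)\<rceil>"]
        by eventually_elim (simp add: v_def nat_le_iff ceiling_le_iff)
    qed
  qed (use sqint_integrable[OF u] in \<open>auto simp: v_def\<close>)
  then have "\<forall>\<^sub>F n in sequentially. (LINT x|lborel. (norm (u x - v n x))\<^sup>2) < e / 4"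
    using e by (intro order_tendstoD(2)) auto
  then obtain n where n: "(LINT x|lborel. (norm (u x - v n x))\<^sup>2) < e / 4"
    by (auto simp: eventually_sequentially)
  define M where "M = real n + 1"
  have M: "M > 0" "norm (v n x) \<le> M" for x by (auto simp: M_def v_def)
  have v: "sqint lborel (v n)"
    by (rule sqint_dominated[OF u]) (auto simp: v_def)
  have "v n measurable_on UNIV"
    by (intro lebesgue_measurable_imp_measurable_on) (auto intro: measurable_completion)
  then obtain N g where N: "negligible N" and g: "\<And>j. continuous_on UNIV (g j)"
    and lim: "\<And>x. x \<notin> N \<Longrightarrow> (\<lambda>j. g j x) \<longlonglongrightarrow> v n x"
    unfolding measurable_on_def by auto
  have ae: "AE x in lborel. (\<lambda>j. g j x) \<longlonglongrightarrow> v n x"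
  proof -
    have "AE x in lebesgue. x \<notin> N"
      using N by (simp add: negligible_iff_null_sets AE_not_in)
    then have "AE x in lborel. x \<notin> N" by (simp add: AE_completion_iff)
    then show ?thesis by eventually_elim (rule lim)
  qed
  \<comment> \<open>The first factor is 1 for arguments of modulus at most R and 0 beyond R + 1; the
    second is the radial projection onto the ball of radius M. Neither changes the limit
    \<open>v n x\<close>, which is bounded by M and vanishes beyond R.\<close>
  define h where "h j x = max 0 (min 1 (R + 1 - \<bar>x\<bar>)) *\<^sub>R ((M / max M (norm (g j x))) *\<^sub>R g j x)" for j x
  have h_cont: "continuous_on UNIV (h j)" for j
    unfolding h_def using g[of j] M by (intro continuous_intros) (auto simp: max_def)
  then have [measurable]: "h j \<in> borel_measurable borel" for j
    by (rule borel_measurable_continuous_onI)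
  have h0: "h j x = 0" if "R + 1 < \<bar>x\<bar>" for j x using that by (simp add: h_def)
  have h_le: "norm (h j x) \<le> M * indicator {-(R+1)..R+1} x" for j x
  proof (cases "R + 1 < \<bar>x\<bar>")
    case False
    have "norm (h j x) \<le> 1 * (M / max M (norm (g j x)) * norm (g j x))"
      unfolding h_def norm_scaleR using M by (intro mult_mono) auto
    also have "\<dots> \<le> M" using M by (auto simp: max_def field_simps)
    finally show ?thesis using False by (auto simp: indicator_def abs_le_iff)
  qed (use M in \<open>simp add: h0\<close>)
  have h: "sqint lborel (h j)" for j
    unfolding sqint_def
  proof
    show "integrable lborel (\<lambda>x. (norm (h j x))\<^sup>2)"
    proof (rule Bochner_Integration.integrable_bound)
      show "integrable lborel (\<lambda>x. M\<^sup>2 * indicator {-(R+1)..R+1} x)" by simp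
      show "AE x in lborel. norm ((norm (h j x))\<^sup>2) \<le> norm (M\<^sup>2 * indicator {- (R + 1)..R + 1} x)"
      proof (intro AE_I2)
        fix x show "norm ((norm (h j x))\<^sup>2) \<le> norm (M\<^sup>2 * indicator {- (R + 1)..R + 1} x)"
        proof (cases "x \<in> {-(R+1)..R+1}")
          case True
          then show ?thesis using power_mono[OF h_le[of j x], of 2] by simp
        next
          case False
          then have "h j x = 0" by (intro h0) auto
          then show ?thesis by simp
        qed
      qed
    qed measurable
  qed measurable
  have "(\<lambda>j. LINT x|lborel. (norm (v n x - h j x))\<^sup>2) \<longlonglongrightarrow> integral\<^sup>L (lborel :: real measure) (\<lambda>_. 0)"
  proof (rule integral_dominated_convergence[where w = "\<lambda>x. 4 * M\<^sup>2 * indicator {-(R+1)..R+1} x"])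
    show "AE x in lborel. (\<lambda>j. (norm (v n x - h j x))\<^sup>2) \<longlonglongrightarrow> 0" using ae
    proof eventually_elim
      fix x assume *: "(\<lambda>j. g j x) \<longlonglongrightarrow> v n x"
      have "(\<lambda>j. h j x) \<longlonglongrightarrow> max 0 (min 1 (R + 1 - \<bar>x\<bar>)) *\<^sub>R ((M / max M (norm (v n x))) *\<^sub>R v n x)"
        unfolding h_def using * M by (intro tendsto_intros) (auto simp: max_def)
      also have "max 0 (min 1 (R + 1 - \<bar>x\<bar>)) *\<^sub>R ((M / max M (norm (v n x))) *\<^sub>R v n x) = v n x"
      proof (cases "R < \<bar>x\<bar>")
        case True then show ?thesis by (simp add: v_def R)
      next
        case False
        then show ?thesis using M(1) M(2)[of x] by (simp add: max_def min_def)
      qed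
      finally have "(\<lambda>j. norm (v n x - h j x)) \<longlonglongrightarrow> norm (v n x - v n x)"
        by (intro tendsto_intros)
      from tendsto_power[OF this, of 2] show "(\<lambda>j. (norm (v n x - h j x))\<^sup>2) \<longlonglongrightarrow> 0" by simp
    qed
    fix j
    show "AE x in lborel. norm ((norm (v n x - h j x))\<^sup>2) \<le> 4 * M\<^sup>2 * indicator {- (R + 1)..R + 1} x"
    proof (intro AE_I2)
      fix x
      have "norm (v n x) \<le> M * indicator {-(R+1)..R+1} x"
        using M(2)[of x] R[of x] by (auto simp: v_def indicator_def abs_le_iff)
      then have "norm (v n x - h j x) \<le> 2 * M * indicator {-(R+1)..R+1} x"
        using h_le[of j x] norm_triangle_ineq4[of "v n x" "h j x"] by linarith
      from power_mono[OF this, of 2]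
      show "norm ((norm (v n x - h j x))\<^sup>2) \<le> 4 * M\<^sup>2 * indicator {- (R + 1)..R + 1} x"
        by (cases "x \<in> {-(R+1)..R+1}") (simp_all add: power_mult_distrib)
    qed
  qed auto
  then have "\<forall>\<^sub>F j in sequentially. (LINT x|lborel. (norm (v n x - h j x))\<^sup>2) < e / 4"
    using e by (intro order_tendstoD(2)) auto
  then obtain j where j: "(LINT x|lborel. (norm (v n x - h j x))\<^sup>2) < e / 4"
    by (auto simp: eventually_sequentially)
  have "(LINT x|lborel. (norm (u x - h j x))\<^sup>2)
      \<le> (LINT x|lborel. 2 * (norm (u x - v n x))\<^sup>2 + 2 * (norm (v n x - h j x))\<^sup>2)"
  proof (intro integral_mono Bochner_Integration.integrable_add integrable_mult_right sqint_integrable sqint_diff u v h)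
    fix x show "(norm (u x - h j x))\<^sup>2 \<le> 2 * (norm (u x - v n x))\<^sup>2 + 2 * (norm (v n x - h j x))\<^sup>2"
      using norm_add_sq_le[of "u x - v n x" "v n x - h j x"] by simp
  qed
  also have "\<dots> = 2 * (LINT x|lborel. (norm (u x - v n x))\<^sup>2) + 2 * (LINT x|lborel. (norm (v n x - h j x))\<^sup>2)"
    using sqint_integrable[OF sqint_diff[OF u v]] sqint_integrable[OF sqint_diff[OF v h]] by simp
  also have "\<dots> < e" using n j by linarith
  finally show thesis using that[OF h_cont h0 h] by blast
qed

section \<open>Continuity of translations in mean square\<close>

lemma sqint_shift:
  fixes u :: "real \<Rightarrow> 'b::{banach, second_countable_topology}"
  assumes "sqint lborel u"
  shows "sqint lborel (\<lambda>x. u (x + t))"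
    and "(LINT x|lborel. (norm (u (x + t)))\<^sup>2) = (LINT x|lborel. (norm (u x))\<^sup>2)"
  using assms lborel_integrable_real_affine[of "\<lambda>x. (norm (u x))\<^sup>2" 1 t]
    lborel_integral_real_affine[of 1 "\<lambda>x. (norm (u x))\<^sup>2" t]
  by (auto simp: sqint_def add.commute)

text \<open>For a continuous compactly supported g this is dominated convergence. The general case
  follows by writing the increment of u as the translate of u - g, plus the increment of g, minus u
  - g; the translate has the same norm as u - g.\<close>

lemma sqint_translation_continuous:
  fixes u :: "real \<Rightarrow> complex"
  assumes u: "sqint lborel u" and R: "\<And>x. R < \<bar>x\<bar> \<Longrightarrow> u x = 0" and t: "t \<longlonglongrightarrow> (0::real)"
  shows "(\<lambda>n. LINT x|lborel. (norm (u (x + t n) - u x))\<^sup>2) \<longlonglongrightarrow> 0"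
proof (rule LIMSEQ_I)
  fix e :: real assume e: "0 < e"
  \<comment> \<open>The final estimate has coefficients 4, 4 and 2, so that the total is below 10 e
    / 12.\<close>
  then have "e / 12 > 0" by simp
  from sqint_continuous_approximation[OF u R this] obtain g where
    g: "continuous_on UNIV g" "\<And>x. R + 1 < \<bar>x\<bar> \<Longrightarrow> g x = 0" "sqint lborel g"
    and gu: "(LINT x|lborel. (norm (u x - g x))\<^sup>2) < e / 12" by blast
  have [measurable]: "g \<in> borel_measurable borel" using g(1) by (rule borel_measurable_continuous_onI)
  define B where "B = {-(R+2)..R+2}"
  have "bounded (g ` {-(R+2)..R+2})"
    by (intro compact_imp_bounded compact_continuous_image continuous_on_subset[OF g(1)]) auto
  then obtain C where C: "C > 0" "\<forall>y\<in>g ` {-(R+2)..R+2}. norm y \<le> C"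
    unfolding bounded_pos by blast
  have C': "norm (g x) \<le> C" for x
    using C g(2)[of x] by (cases "x \<in> B") (auto simp: B_def)
  from t have "\<forall>\<^sub>F n in sequentially. dist (t n) 0 < 1" by (rule tendstoD) simp
  \<comment> \<open>Shifts below 1 keep the support of the translated g inside \<open>B\<close>,
    where the dominating constant lives.\<close>
  then obtain n0 where n0: "\<And>n. n \<ge> n0 \<Longrightarrow> \<bar>t n\<bar> < 1" by (auto simp: eventually_sequentially)
  have "(\<lambda>n. LINT x|lborel. (norm (g (x + t (n + n0)) - g x))\<^sup>2) \<longlonglongrightarrow> integral\<^sup>L (lborel :: real measure) (\<lambda>_. 0)"
  proof (rule integral_dominated_convergence[where w = "\<lambda>x. 4 * C\<^sup>2 * indicator B x"])
    show "AE x in lborel. (\<lambda>n. (norm (g (x + t (n + n0)) - g x))\<^sup>2) \<longlonglongrightarrow> 0"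
    proof (intro AE_I2)
      fix x
      have "(\<lambda>n. x + t (n + n0)) \<longlonglongrightarrow> x + 0"
        by (intro tendsto_intros LIMSEQ_ignore_initial_segment t)
      then have "(\<lambda>n. g (x + t (n + n0))) \<longlonglongrightarrow> g x"
        using g(1) by (intro continuous_on_tendsto_compose[OF g(1)]) auto
      then have "(\<lambda>n. (norm (g (x + t (n + n0)) - g x))\<^sup>2) \<longlonglongrightarrow> (norm (g x - g x))\<^sup>2"
        by (intro tendsto_intros)
      then show "(\<lambda>n. (norm (g (x + t (n + n0)) - g x))\<^sup>2) \<longlonglongrightarrow> 0" by simp
    qed
    fix n
    show "AE x in lborel. norm ((norm (g (x + t (n + n0)) - g x))\<^sup>2) \<le> 4 * C\<^sup>2 * indicator B x"
    proof (intro AE_I2)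
      fix x
      show "norm ((norm (g (x + t (n + n0)) - g x))\<^sup>2) \<le> 4 * C\<^sup>2 * indicator B x"
      proof (cases "x \<in> B")
        case True
        have "norm (g (x + t (n + n0)) - g x) \<le> 2 * C"
          using C'[of x] C'[of "x + t (n + n0)"] norm_triangle_ineq4[of "g (x + t (n + n0))" "g x"] by linarith
        from power_mono[OF this, of 2] show ?thesis using True by (simp add: power_mult_distrib)
      next
        case False
        then have "R + 1 < \<bar>x\<bar>" "R + 1 < \<bar>x + t (n + n0)\<bar>"
          using n0[of "n + n0"] by (auto simp: B_def)
        then show ?thesis by (simp add: g(2))
      qed
    qed
    show "integrable lborel (\<lambda>x. 4 * C\<^sup>2 * indicator B x)" unfolding B_def by simp
  qed (auto intro: measurable_compose)
  then have "\<forall>\<^sub>F n in sequentially. (LINT x|lborel. (norm (g (x + t (n + n0)) - g x))\<^sup>2) < e / 12"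
    using e by (intro order_tendstoD(2)) auto
  then have "\<forall>\<^sub>F n in sequentially. (LINT x|lborel. (norm (g (x + t n) - g x))\<^sup>2) < e / 12"
    by (rule eventually_sequentially_seg[THEN iffD1])
  moreover have "(LINT x|lborel. (norm (u (x + t n) - u x))\<^sup>2)
      \<le> 4 * (LINT x|lborel. (norm (u x - g x))\<^sup>2) + 4 * (LINT x|lborel. (norm (g (x + t n) - g x))\<^sup>2)
        + 2 * (LINT x|lborel. (norm (u x - g x))\<^sup>2)" for n
  proof -
    define a b c where "a x = u (x + t n) - g (x + t n)" and "b x = g (x + t n) - g x"
      and "c x = u x - g x" for x
    have a: "sqint lborel a" and b: "sqint lborel b" and c: "sqint lborel c"
      unfolding a_def b_def c_def by (intro sqint_diff u g(3) sqint_shift)+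
    have "(LINT x|lborel. (norm (u (x + t n) - u x))\<^sup>2)
      \<le> (LINT x|lborel. 4 * (norm (a x))\<^sup>2 + 4 * (norm (b x))\<^sup>2 + 2 * (norm (c x))\<^sup>2)"
    proof (intro integral_mono Bochner_Integration.integrable_add integrable_mult_right sqint_integrable a b c sqint_diff u sqint_shift)
      fix x
      have "u (x + t n) - u x = (a x + b x) - c x" by (simp add: a_def b_def c_def)
      then show "(norm (u (x + t n) - u x))\<^sup>2 \<le> 4 * (norm (a x))\<^sup>2 + 4 * (norm (b x))\<^sup>2 + 2 * (norm (c x))\<^sup>2"
        using norm_diff_sq_le[of "a x + b x" "c x"] norm_add_sq_le[of "a x" "b x"] by simp
    qed
    also have "\<dots> = 4 * (LINT x|lborel. (norm (a x))\<^sup>2) + 4 * (LINT x|lborel. (norm (b x))\<^sup>2) + 2 * (LINT x|lborel. (norm (c x))\<^sup>2)"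
      using sqint_integrable[OF a] sqint_integrable[OF b] sqint_integrable[OF c] by simp
    also have "(LINT x|lborel. (norm (a x))\<^sup>2) = (LINT x|lborel. (norm (c x))\<^sup>2)"
      using sqint_shift(2)[OF c, of "t n"] by (simp add: a_def c_def)
    finally show ?thesis by (simp add: b_def c_def)
  qed
  ultimately have "\<forall>\<^sub>F n in sequentially. (LINT x|lborel. (norm (u (x + t n) - u x))\<^sup>2) < e"
  proof (elim eventually_mono)
    fix n assume "(LINT x|lborel. (norm (g (x + t n) - g x))\<^sup>2) < e / 12"
    and "\<And>n. (LINT x|lborel. (norm (u (x + t n) - u x))\<^sup>2)
      \<le> 4 * (LINT x|lborel. (norm (u x - g x))\<^sup>2) + 4 * (LINT x|lborel. (norm (g (x + t n) - g x))\<^sup>2)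
        + 2 * (LINT x|lborel. (norm (u x - g x))\<^sup>2)"
    from this(1) this(2)[of n] gu e show "(LINT x|lborel. (norm (u (x + t n) - u x))\<^sup>2) < e" by linarith
  qed
  then show "\<exists>no. \<forall>n\<ge>no. norm ((LINT x|lborel. (norm (u (x + t n) - u x))\<^sup>2) - 0) < e"
    by (simp add: eventually_sequentially)
qed

text \<open>In \<open>Gaussian_Plancherel\<close> the frequency weights increase to 1, so monotone
  convergence gives both integrability and the limit on the left. On the right the autocorrelation
  is averaged over shifts shrinking to 0, where it is continuous and equals the squared norm of
  u.\<close>

theorem Plancherel_compact_support:
  fixes u :: "real \<Rightarrow> complex"
  assumes u: "sqint lborel u" and R: "\<And>x. R < \<bar>x\<bar> \<Longrightarrow> u x = 0"
  shows "sqint lborel (ft u)" "(LINT \<xi>|lborel. (norm (ft u \<xi>))\<^sup>2) = (LINT x|lborel. (norm (u x))\<^sup>2)"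
proof -
  note [measurable] = sqint_measurable[OF u, simplified]
  have ui: "integrable lborel u" by (rule sqint_compact_support_integrable[OF u R])
  define A where "A t = (LINT x|lborel. u x * cnj (u (x + t)))" for t
  have [measurable]: "A \<in> borel_measurable borel" unfolding A_def by measurable
  define E where "E = (LINT x|lborel. (norm (u x))\<^sup>2)"
  have A0: "A 0 = complex_of_real E"
    unfolding A_def E_def by (simp add: complex_norm_square[symmetric] flip: integral_complex_of_real)
  have A_tendsto: "(\<lambda>n. A (t n)) \<longlonglongrightarrow> A 0" if t: "t \<longlonglongrightarrow> 0" for t
  proof -
    define D where "D n = (LINT x|lborel. (norm (u (x + t n) - u x))\<^sup>2)" for n
    have D: "D \<longlonglongrightarrow> 0" unfolding D_def by (rule sqint_translation_continuous[OF u R t])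
    have "(norm (A (t n) - A 0))\<^sup>2 \<le> E * D n" for n
    proof -
      have d: "sqint lborel (\<lambda>x. u (x + t n) - u x)" by (intro sqint_diff u sqint_shift)
      have i: "sqint lborel (\<lambda>x. norm (u x))" "sqint lborel (\<lambda>x. norm (u (x + t n) - u x))"
        using u d by (auto simp: sqint_def)
      have "A (t n) - A 0 = (LINT x|lborel. u x * cnj (u (x + t n)) - u x * cnj (u x))"
        unfolding A_def using integrable_autocorrelation(1)[OF u, of "t n"] integrable_autocorrelation(1)[OF u, of 0]
        by simp
      also have "norm \<dots> \<le> (LINT x|lborel. norm (u x * cnj (u (x + t n)) - u x * cnj (u x)))"
        by (rule integral_norm_bound)
      also have "\<dots> = (LINT x|lborel. norm (u x) * norm (u (x + t n) - u x))"
      proof (rule Bochner_Integration.integral_cong[OF refl])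
        fix x
        have "u x * cnj (u (x + t n)) - u x * cnj (u x) = u x * cnj (u (x + t n) - u x)"
          by (simp add: algebra_simps)
        then show "norm (u x * cnj (u (x + t n)) - u x * cnj (u x)) = norm (u x) * norm (u (x + t n) - u x)"
          by (simp only: norm_mult complex_mod_cnj)
      qed
      finally have "(norm (A (t n) - A 0))\<^sup>2 \<le> (LINT x|lborel. norm (u x) * norm (u (x + t n) - u x))\<^sup>2"
        by (simp add: power_mono)
      also have "\<dots> \<le> E * D n" unfolding E_def D_def by (rule sqint_Cauchy_Schwarz[OF i])
      finally show ?thesis .
    qed
    then have "\<forall>\<^sub>F n in sequentially. (norm (A (t n) - A 0))\<^sup>2 \<le> E * D n" by simp
    from tendsto_sandwich[OF always_eventually this tendsto_const tendsto_mult_right_zero[OF D]]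
    have "(\<lambda>n. (norm (A (t n) - A 0))\<^sup>2) \<longlonglongrightarrow> 0" by simp
    then have "(\<lambda>n. norm (A (t n) - A 0)) \<longlonglongrightarrow> 0" by simp
    then show ?thesis by (simp add: tendsto_norm_zero_iff LIM_zero_iff)
  qed
  define W where "W n \<xi> = exp (- (\<xi> / real (Suc n))\<^sup>2 / 2) * (norm (ft u \<xi>))\<^sup>2" for n \<xi>
  have W_int: "integrable lborel (W n)" for n
  proof (rule Bochner_Integration.integrable_bound)
    have "integrable lborel (\<lambda>x. std_normal_density (0 + (1 / real (Suc n)) * x))"
      by (rule lborel_integrable_real_affine) auto
    then show "integrable lborel (\<lambda>x. (sqrt (2 * pi) * ((1 / sqrt (2 * pi)) * (LINT x|lborel. norm (u x)))\<^sup>2) *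
        std_normal_density (0 + (1 / real (Suc n)) * x))" by (rule integrable_mult_right)
    show "W n \<in> borel_measurable lborel" unfolding W_def by measurable
    show "AE x in lborel. norm (W n x) \<le> norm ((sqrt (2 * pi) * ((1 / sqrt (2 * pi)) * (LINT x|lborel. norm (u x)))\<^sup>2) *
        std_normal_density (0 + (1 / real (Suc n)) * x))"
    proof (intro AE_I2)
      fix x
      have "norm (W n x) \<le> exp (- (x / real (Suc n))\<^sup>2 / 2) * ((1 / sqrt (2 * pi)) * (LINT x|lborel. norm (u x)))\<^sup>2"
        unfolding W_def using norm_ft_le[OF ui, of x] by (simp add: abs_mult power_mono)
      also have "\<dots> = (sqrt (2 * pi) * ((1 / sqrt (2 * pi)) * (LINT x|lborel. norm (u x)))\<^sup>2) *
        std_normal_density (0 + (1 / real (Suc n)) * x)"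
        by (simp add: std_normal_density_def)
      finally show "norm (W n x) \<le> norm ((sqrt (2 * pi) * ((1 / sqrt (2 * pi)) * (LINT x|lborel. norm (u x)))\<^sup>2) *
        std_normal_density (0 + (1 / real (Suc n)) * x))" by simp
    qed
  qed
  have W_eq: "complex_of_real (LINT \<xi>|lborel. W n \<xi>) = (LINT r|lborel. std_normal_density r *\<^sub>R A (r / real (Suc n)))" for n
    using Gaussian_Plancherel[OF ui u, of "real (Suc n)"]
    by (simp add: W_def A_def scaleR_conv_of_real flip: integral_complex_of_real)
  have "(\<lambda>n. LINT r|lborel. std_normal_density r *\<^sub>R A (r / real (Suc n))) \<longlonglongrightarrow> (LINT r|lborel. std_normal_density r *\<^sub>R A 0)"
  proof (rule integral_dominated_convergence[where w = "\<lambda>r. std_normal_density r * E"])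
    show "AE r in lborel. (\<lambda>n. std_normal_density r *\<^sub>R A (r / real (Suc n))) \<longlonglongrightarrow> std_normal_density r *\<^sub>R A 0"
    proof (intro AE_I2 tendsto_intros A_tendsto)
      show "(\<lambda>n. r / real (Suc n)) \<longlonglongrightarrow> 0" for r
        using LIMSEQ_Suc[OF lim_const_over_n[of r]] by simp
    qed
    show "AE r in lborel. norm (std_normal_density r *\<^sub>R A (r / real (Suc n))) \<le> std_normal_density r * E" for n
      using integrable_autocorrelation(2)[OF u] by (intro AE_I2) (simp add: A_def E_def mult_left_mono)
  qed auto
  then have "(\<lambda>n. complex_of_real (LINT \<xi>|lborel. W n \<xi>)) \<longlonglongrightarrow> complex_of_real E"
    unfolding W_eq A0 by (simp add: scaleR_conv_of_real)
  then have W_lim: "(\<lambda>n. LINT \<xi>|lborel. W n \<xi>) \<longlonglongrightarrow> E"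
    by (simp add: tendsto_of_real_iff)
  have W_mono: "W m \<xi> \<le> W n \<xi>" if "m \<le> n" for m n \<xi>
  proof -
    have "\<bar>\<xi> / real (Suc n)\<bar> \<le> \<bar>\<xi> / real (Suc m)\<bar>"
      using that by (simp add: frac_le)
    then have "(\<xi> / real (Suc n))\<^sup>2 \<le> (\<xi> / real (Suc m))\<^sup>2" by (simp only: abs_le_square_iff)
    then show ?thesis unfolding W_def by (intro mult_right_mono) auto
  qed
  have W_pt: "(\<lambda>n. W n \<xi>) \<longlonglongrightarrow> (norm (ft u \<xi>))\<^sup>2" for \<xi>
  proof -
    have "(\<lambda>n. \<xi> / real (Suc n)) \<longlonglongrightarrow> 0" using LIMSEQ_Suc[OF lim_const_over_n[of \<xi>]] by simp
    then have "(\<lambda>n. W n \<xi>) \<longlonglongrightarrow> exp (- 0\<^sup>2 / 2) * (norm (ft u \<xi>))\<^sup>2"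
      unfolding W_def by (intro tendsto_intros) auto
    then show ?thesis by simp
  qed
  have 1: "AE x in lborel. mono (\<lambda>n. W n x)" using W_mono by (auto simp: mono_def)
  have 2: "AE x in lborel. (\<lambda>n. W n x) \<longlonglongrightarrow> (norm (ft u x))\<^sup>2" using W_pt by simp
  have 3: "(\<lambda>x. (norm (ft u x))\<^sup>2) \<in> borel_measurable lborel" by measurable
  from integrable_monotone_convergence[OF W_int 1 2 W_lim 3] show "sqint lborel (ft u)"
    unfolding sqint_def by simp
  from integral_monotone_convergence[OF W_int 1 2 W_lim 3]
  show "(LINT \<xi>|lborel. (norm (ft u \<xi>))\<^sup>2) = (LINT x|lborel. (norm (u x))\<^sup>2)"
    unfolding E_def .
qed

subsection \<open>The Fourier transform on square integrable functions\<close>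

lemma sqint_nn_integral_tendsto_0_iff:
  fixes a :: "nat \<Rightarrow> 'a \<Rightarrow> 'b::{banach, second_countable_topology}"
  assumes "\<And>n. sqint M (a n)"
  shows "(\<lambda>n. \<integral>\<^sup>+x. ennreal ((norm (a n x))\<^sup>2) \<partial>M) \<longlonglongrightarrow> 0 \<longleftrightarrow> (\<lambda>n. LINT x|M. (norm (a n x))\<^sup>2) \<longlonglongrightarrow> 0"
proof -
  have "(\<integral>\<^sup>+x. ennreal ((norm (a n x))\<^sup>2) \<partial>M) = ennreal (LINT x|M. (norm (a n x))\<^sup>2)" for n
    by (intro nn_integral_eq_integral sqint_integrable assms) simp
  then show ?thesis by (simp add: ennreal_tendsto_0_iff)
qed

lemma sqint_truncation:
  fixes u :: "real \<Rightarrow> 'b::{banach, second_countable_topology}"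
  assumes "sqint lborel u" "A \<in> sets borel"
  shows "sqint lborel (\<lambda>x. indicator A x *\<^sub>R u x)"
proof (rule sqint_dominated[OF assms(1)])
  note [measurable] = sqint_measurable[OF assms(1)] assms(2)
  show "(\<lambda>x. indicator A x *\<^sub>R u x) \<in> borel_measurable lborel" by measurable
qed (auto simp: indicator_def)

lemma truncated_fourier_Plancherel:
  assumes "sqint lborel u"
  shows "sqint lborel (truncated_fourier R u)"
    and "(LINT \<xi>|lborel. (norm (truncated_fourier R u \<xi>))\<^sup>2) = (LINT x|lborel. indicator {-R..R} x * (norm (u x))\<^sup>2)"
proof -
  have s: "sqint lborel (\<lambda>x. indicator {-R..R} x *\<^sub>R u x)"
    by (rule sqint_truncation[OF assms]) auto
  have z: "indicator {-R..R} x *\<^sub>R u x = 0" if "R < \<bar>x\<bar>" for x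
    using that by (auto simp: indicator_def)
  show "sqint lborel (truncated_fourier R u)"
    unfolding truncated_fourier_eq_ft by (rule Plancherel_compact_support(1)[OF s z])
  have "(norm (indicator {-R..R} x *\<^sub>R u x))\<^sup>2 = indicator {-R..R} x * (norm (u x))\<^sup>2" for x
    by (simp add: indicator_def)
  then show "(LINT \<xi>|lborel. (norm (truncated_fourier R u \<xi>))\<^sup>2) = (LINT x|lborel. indicator {-R..R} x * (norm (u x))\<^sup>2)"
    unfolding truncated_fourier_eq_ft using Plancherel_compact_support(2)[OF s z] by simp
qed

lemma integral_exhaustion_at_top:
  fixes f :: "real \<Rightarrow> real"
  assumes "integrable lborel f"
  shows "((\<lambda>R. LINT x|lborel. indicator {-R..R} x * f x) \<longlongrightarrow> (LINT x|lborel. f x)) at_top"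
proof (rule integral_dominated_convergence_at_top[where w = "\<lambda>x. norm (f x)"])
  have [measurable]: "f \<in> borel_measurable borel" using assms by simp
  show "(\<lambda>x. indicator {-R..R} x * f x) \<in> borel_measurable lborel" for R by measurable
  show "f \<in> borel_measurable lborel" by simp
  show "AE x in lborel. ((\<lambda>R. indicator {-R..R} x * f x) \<longlongrightarrow> f x) at_top"
  proof (intro AE_I2 tendsto_eventually)
    fix x show "\<forall>\<^sub>F R in at_top. indicator {-R..R} x * f x = f x"
      using eventually_ge_at_top[of "\<bar>x\<bar>"] by eventually_elim (auto simp: indicator_def)
  qed
  show "\<forall>\<^sub>F R in at_top. AE x in lborel. norm (indicator {-R..R} x * f x) \<le> norm (f x)"
    by (intro always_eventually allI AE_I2) (auto simp: indicator_def)
qed (use assms in auto)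

text \<open>The squared norms of the truncated transforms have two limits: that of g by convergence
  in mean square, and that of u because the truncations exhaust the line.\<close>

lemma has_L2_fourier_isometry:
  assumes "has_L2_fourier u g"
  shows "(LINT \<xi>|lborel. (norm (g \<xi>))\<^sup>2) = (LINT x|lborel. (norm (u x))\<^sup>2)"
proof -
  have u: "sqint lborel u" and g: "sqint lborel g"
    and lim: "((\<lambda>R. \<integral>\<^sup>+ \<xi>. ennreal ((norm (truncated_fourier R u \<xi> - g \<xi>))\<^sup>2) \<partial>lborel) \<longlongrightarrow> 0) at_top"
    using assms by (auto simp: has_L2_fourier_def L2_fun_iff_sqint)
  note a = truncated_fourier_Plancherel(1)[OF u]
  have "(\<lambda>n. \<integral>\<^sup>+ \<xi>. ennreal ((norm (truncated_fourier (real n) u \<xi> - g \<xi>))\<^sup>2) \<partial>lborel) \<longlonglongrightarrow> 0"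
    by (rule filterlim_compose[OF lim filterlim_real_sequentially])
  then have "(\<lambda>n. LINT \<xi>|lborel. (norm (truncated_fourier (real n) u \<xi> - g \<xi>))\<^sup>2) \<longlonglongrightarrow> 0"
    by (subst (asm) sqint_nn_integral_tendsto_0_iff) (intro sqint_diff a g)
  from sqint_tendsto_integral_norm[OF a g this]
  have 1: "(\<lambda>n. LINT x|lborel. indicator {-real n..real n} x * (norm (u x))\<^sup>2) \<longlonglongrightarrow> (LINT \<xi>|lborel. (norm (g \<xi>))\<^sup>2)"
    by (simp only: truncated_fourier_Plancherel(2)[OF u])
  have 2: "(\<lambda>n. LINT x|lborel. indicator {-real n..real n} x * (norm (u x))\<^sup>2) \<longlonglongrightarrow> (LINT x|lborel. (norm (u x))\<^sup>2)"
    by (rule filterlim_compose[OF integral_exhaustion_at_top[OF sqint_integrable[OF u]] filterlim_real_sequentially])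
  show ?thesis by (rule LIMSEQ_unique[OF 1 2])
qed

lemma integrable_truncated_fourier_integrand:
  fixes R :: real
  assumes "sqint lborel u"
  shows "integrable lborel (\<lambda>x. indicator {-R..R} x *\<^sub>R u x :: complex)"
  by (rule sqint_compact_support_integrable[of _ R], rule sqint_truncation[OF assms]) (auto simp: indicator_def)

lemma has_L2_fourier_add_diff:
  assumes "has_L2_fourier u g" "has_L2_fourier v h"
  shows "has_L2_fourier (\<lambda>x. u x + v x) (\<lambda>\<xi>. g \<xi> + h \<xi>)"
    and "has_L2_fourier (\<lambda>x. u x - v x) (\<lambda>\<xi>. g \<xi> - h \<xi>)"
proof -
  have u: "sqint lborel u" and g: "sqint lborel g" and v: "sqint lborel v" and h: "sqint lborel h"
    and limu: "((\<lambda>R. \<integral>\<^sup>+ \<xi>. ennreal ((norm (truncated_fourier R u \<xi> - g \<xi>))\<^sup>2) \<partial>lborel) \<longlongrightarrow> 0) at_top"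
    and limv: "((\<lambda>R. \<integral>\<^sup>+ \<xi>. ennreal ((norm (truncated_fourier R v \<xi> - h \<xi>))\<^sup>2) \<partial>lborel) \<longlongrightarrow> 0) at_top"
    using assms by (auto simp: has_L2_fourier_def L2_fun_iff_sqint)
  let ?B = "\<lambda>R. 2 * (\<integral>\<^sup>+ \<xi>. ennreal ((norm (truncated_fourier R u \<xi> - g \<xi>))\<^sup>2) \<partial>lborel)
    + 2 * (\<integral>\<^sup>+ \<xi>. ennreal ((norm (truncated_fourier R v \<xi> - h \<xi>))\<^sup>2) \<partial>lborel)"
  have "(?B \<longlongrightarrow> 2 * 0 + 2 * 0) at_top"
    by (intro tendsto_add ennreal_tendsto_cmult limu limv) auto
  then have B: "(?B \<longlongrightarrow> 0) at_top" by simp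
  note [measurable] = sqint_measurable[OF truncated_fourier_Plancherel(1)[OF u]]
    sqint_measurable[OF truncated_fourier_Plancherel(1)[OF v]] sqint_measurable[OF g] sqint_measurable[OF h]
  have bound: "(\<integral>\<^sup>+ \<xi>. ennreal ((norm (F \<xi>))\<^sup>2) \<partial>lborel) \<le> ?B R"
    if "\<And>\<xi>. (norm (F \<xi>))\<^sup>2 \<le> 2 * (norm (truncated_fourier R u \<xi> - g \<xi>))\<^sup>2 + 2 * (norm (truncated_fourier R v \<xi> - h \<xi>))\<^sup>2"
    for F :: "real \<Rightarrow> complex" and R
  proof -
    have "(\<integral>\<^sup>+ \<xi>. ennreal ((norm (F \<xi>))\<^sup>2) \<partial>lborel)
      \<le> (\<integral>\<^sup>+ \<xi>. 2 * ennreal ((norm (truncated_fourier R u \<xi> - g \<xi>))\<^sup>2) + 2 * ennreal ((norm (truncated_fourier R v \<xi> - h \<xi>))\<^sup>2) \<partial>lborel)"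
    proof (intro nn_integral_mono)
      fix \<xi>
      have "ennreal ((norm (F \<xi>))\<^sup>2) \<le> ennreal (2 * (norm (truncated_fourier R u \<xi> - g \<xi>))\<^sup>2 + 2 * (norm (truncated_fourier R v \<xi> - h \<xi>))\<^sup>2)"
        by (intro ennreal_leI that)
      then show "ennreal ((norm (F \<xi>))\<^sup>2) \<le> 2 * ennreal ((norm (truncated_fourier R u \<xi> - g \<xi>))\<^sup>2) + 2 * ennreal ((norm (truncated_fourier R v \<xi> - h \<xi>))\<^sup>2)"
        by (simp add: ennreal_plus ennreal_mult)
    qed
    also have "\<dots> = ?B R" by (subst nn_integral_add) (auto simp: nn_integral_cmult)
    finally show ?thesis .
  qed
  note i = integrable_truncated_fourier_integrand[OF u] integrable_truncated_fourier_integrand[OF v]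
  have add: "truncated_fourier R (\<lambda>x. u x + v x) \<xi> = truncated_fourier R u \<xi> + truncated_fourier R v \<xi>" for R \<xi>
    unfolding truncated_fourier_eq_ft scaleR_add_right by (rule ft_add[OF i])
  have diff: "truncated_fourier R (\<lambda>x. u x - v x) \<xi> = truncated_fourier R u \<xi> - truncated_fourier R v \<xi>" for R \<xi>
    unfolding truncated_fourier_eq_ft scaleR_diff_right by (rule ft_diff[OF i])
  have "((\<lambda>R. \<integral>\<^sup>+ \<xi>. ennreal ((norm (truncated_fourier R (\<lambda>x. u x + v x) \<xi> - (g \<xi> + h \<xi>)))\<^sup>2) \<partial>lborel) \<longlongrightarrow> 0) at_top"
  proof (rule tendsto_sandwich[OF _ _ tendsto_const B], simp, intro always_eventually allI bound)
    fix R \<xi>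
    show "(norm (truncated_fourier R (\<lambda>x. u x + v x) \<xi> - (g \<xi> + h \<xi>)))\<^sup>2
      \<le> 2 * (norm (truncated_fourier R u \<xi> - g \<xi>))\<^sup>2 + 2 * (norm (truncated_fourier R v \<xi> - h \<xi>))\<^sup>2"
      using norm_add_sq_le[of "truncated_fourier R u \<xi> - g \<xi>" "truncated_fourier R v \<xi> - h \<xi>"]
      by (simp add: add algebra_simps)
  qed
  then show "has_L2_fourier (\<lambda>x. u x + v x) (\<lambda>\<xi>. g \<xi> + h \<xi>)"
    using sqint_add[OF u v] sqint_add[OF g h] by (simp add: has_L2_fourier_def L2_fun_iff_sqint)
  have "((\<lambda>R. \<integral>\<^sup>+ \<xi>. ennreal ((norm (truncated_fourier R (\<lambda>x. u x - v x) \<xi> - (g \<xi> - h \<xi>)))\<^sup>2) \<partial>lborel) \<longlongrightarrow> 0) at_top"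
  proof (rule tendsto_sandwich[OF _ _ tendsto_const B], simp, intro always_eventually allI bound)
    fix R \<xi>
    have "truncated_fourier R (\<lambda>x. u x - v x) \<xi> - (g \<xi> - h \<xi>) = (truncated_fourier R u \<xi> - g \<xi>) - (truncated_fourier R v \<xi> - h \<xi>)"
      by (simp add: diff algebra_simps)
    then show "(norm (truncated_fourier R (\<lambda>x. u x - v x) \<xi> - (g \<xi> - h \<xi>)))\<^sup>2
      \<le> 2 * (norm (truncated_fourier R u \<xi> - g \<xi>))\<^sup>2 + 2 * (norm (truncated_fourier R v \<xi> - h \<xi>))\<^sup>2"
      by (simp only: norm_diff_sq_le)
  qed
  then show "has_L2_fourier (\<lambda>x. u x - v x) (\<lambda>\<xi>. g \<xi> - h \<xi>)"
    using sqint_diff[OF u v] sqint_diff[OF g h] by (simp add: has_L2_fourier_def L2_fun_iff_sqint)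
qed

lemma sqint_integral_zero_AE:
  assumes "sqint M f" "(LINT x|M. (norm (f x))\<^sup>2) = 0"
  shows "AE x in M. f x = 0"
  using assms integral_nonneg_eq_0_iff_AE[OF sqint_integrable[OF assms(1)]] by auto

text \<open>The difference of the two transforms is a transform of the zero function, hence has norm
  zero by the isometry.\<close>

lemma has_L2_fourier_unique:
  assumes "has_L2_fourier u g" "has_L2_fourier u h"
  shows "AE \<xi> in lborel. g \<xi> = h \<xi>"
proof -
  note d = has_L2_fourier_add_diff(2)[OF assms]
  then have "(LINT \<xi>|lborel. (norm (g \<xi> - h \<xi>))\<^sup>2) = 0"
    using has_L2_fourier_isometry[OF d] by simp
  with d have "AE \<xi> in lborel. g \<xi> - h \<xi> = 0"
    by (intro sqint_integral_zero_AE) (auto simp: has_L2_fourier_def L2_fun_iff_sqint)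
  then show ?thesis by simp
qed

text \<open>Needed to pass from an element of X, which vanishes outside the interval only almost
  everywhere, to a representative with genuinely compact support.\<close>

lemma has_L2_fourier_cong_AE:
  assumes "has_L2_fourier u g" "v \<in> borel_measurable lborel" "AE x in lborel. u x = v x"
  shows "has_L2_fourier v g"
proof -
  have u: "sqint lborel u" using assms(1) by (auto simp: has_L2_fourier_def L2_fun_iff_sqint)
  note [measurable] = sqint_measurable[OF u] assms(2)
  have v: "sqint lborel v"
    by (rule sqint_dominated[OF u]) (use assms(3) in auto)
  have "truncated_fourier R u \<xi> = truncated_fourier R v \<xi>" for R \<xi>
    unfolding truncated_fourier_eq_ft ft_def using assms(3)
    by (intro arg_cong2[where f = times] refl integral_cong_AE) auto
  then show ?thesis using assms(1) v by (simp add: has_L2_fourier_def L2_fun_iff_sqint)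
qed

lemma has_L2_fourier_compact_support:
  assumes u: "sqint lborel u" and R: "\<And>x. R < \<bar>x\<bar> \<Longrightarrow> u x = 0"
  shows "has_L2_fourier u (ft u)"
proof -
  have "truncated_fourier r u = ft u" if "r \<ge> R" for r
  proof -
    have "(\<lambda>x. indicator {-r..r} x *\<^sub>R u x) = u"
      using that R by (force simp: indicator_def fun_eq_iff)
    then show ?thesis by (simp add: truncated_fourier_eq_ft)
  qed
  then have "\<forall>\<^sub>F r in at_top. (\<integral>\<^sup>+ \<xi>. ennreal ((norm (truncated_fourier r u \<xi> - ft u \<xi>))\<^sup>2) \<partial>lborel) = 0"
    by (intro eventually_mono[OF eventually_ge_at_top[of R]]) simp
  then show ?thesis
    using u Plancherel_compact_support(1)[OF u R]
    by (auto simp: has_L2_fourier_def L2_fun_iff_sqint intro: tendsto_eventually)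
qed

text \<open>Fubini's theorem. The reflected transform \<open>ft h (- x)\<close> is the inverse
  Fourier integral of h, so this identifies inverse and adjoint.\<close>

lemma ft_adjoint:
  fixes u h :: "real \<Rightarrow> complex"
  assumes u: "integrable lborel u" and h: "integrable lborel h"
  shows "(LINT \<xi>|lborel. ft u \<xi> * cnj (h \<xi>)) = (LINT x|lborel. u x * cnj (ft h (- x)))"
proof -
  have [measurable]: "u \<in> borel_measurable borel" "h \<in> borel_measurable borel" using u h by auto
  define c where "c = complex_of_real (1 / sqrt (2 * pi))"
  define K where "K z = cis (- (snd z * fst z)) * (cnj (h (fst z)) * u (snd z))" for z
  have "integrable (lborel \<Otimes>\<^sub>M lborel) (\<lambda>z. cnj (h (fst z)) * u (snd z))"
    by (intro integrable_pair_mult[where f = "\<lambda>x. cnj (h x)"] u) (use h in simp)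
  then have K: "integrable (lborel \<Otimes>\<^sub>M lborel) K"
  proof (rule Bochner_Integration.integrable_bound)
    show "K \<in> borel_measurable (lborel \<Otimes>\<^sub>M lborel)" unfolding K_def by measurable
  qed (simp add: K_def norm_mult)
  have "(LINT \<xi>|lborel. ft u \<xi> * cnj (h \<xi>)) = (LINT \<xi>|lborel. c * (LINT x|lborel. K (\<xi>, x)))"
  proof (rule Bochner_Integration.integral_cong[OF refl])
    fix \<xi>
    have "(LINT x|lborel. K (\<xi>, x)) = (LINT x|lborel. cnj (h \<xi>) * (cis (- (x * \<xi>)) * u x))"
      unfolding K_def by (rule Bochner_Integration.integral_cong[OF refl]) simp
    then show "ft u \<xi> * cnj (h \<xi>) = c * (LINT x|lborel. K (\<xi>, x))"
      by (simp add: ft_def c_def)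
  qed
  also have "\<dots> = c * (LINT \<xi>|lborel. LINT x|lborel. K (\<xi>, x))" by (rule integral_mult_right_zero)
  also have "(LINT \<xi>|lborel. LINT x|lborel. K (\<xi>, x)) = (LINT x|lborel. LINT \<xi>|lborel. K (\<xi>, x))"
    using lborel_pair.Fubini_integral[of "\<lambda>\<xi> x. K (\<xi>, x)"] K by simp
  also have "c * \<dots> = (LINT x|lborel. c * (LINT \<xi>|lborel. K (\<xi>, x)))" by (rule integral_mult_right_zero[symmetric])
  also have "\<dots> = (LINT x|lborel. u x * cnj (ft h (- x)))"
  proof (rule Bochner_Integration.integral_cong[OF refl])
    fix x
    have "cnj (cis (- (\<xi> * - x)) * h \<xi>) = cis (- (x * \<xi>)) * cnj (h \<xi>)" for \<xi>
      by (simp add: cis_cnj mult.commute)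
    then have "cnj (ft h (- x)) = c * (LINT \<xi>|lborel. cis (- (x * \<xi>)) * cnj (h \<xi>))"
      unfolding ft_def c_def complex_cnj_mult[of "complex_of_real _"] complex_cnj_complex_of_real Bochner_Integration.integral_cnj[symmetric]
      by (simp only:)
    moreover have "(LINT \<xi>|lborel. K (\<xi>, x)) = (LINT \<xi>|lborel. u x * (cis (- (x * \<xi>)) * cnj (h \<xi>)))"
      unfolding K_def by (rule Bochner_Integration.integral_cong[OF refl]) simp
    ultimately show "c * (LINT \<xi>|lborel. K (\<xi>, x)) = u x * cnj (ft h (- x))" by simp
  qed
  finally show ?thesis .
qed

text \<open>The reflection \<xi> -> -\<xi> undoes complex conjugation. The transform of a Hermitian
  function is therefore real, which lets the inverse transform be represented by a real-valued
  function.\<close>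

lemma ft_reflect_Hermitian:
  assumes herm: "\<And>\<xi>. h (- \<xi>) = cnj (h \<xi>)"
  shows "cnj (ft h x) = ft h x"
proof -
  have "cnj (ft h x) = complex_of_real (1 / sqrt (2 * pi)) * (LINT \<xi>|lborel. cnj (cis (- (\<xi> * x)) * h \<xi>))"
    unfolding ft_def by (simp only: complex_cnj_mult[of "complex_of_real _"] Bochner_Integration.integral_cnj complex_cnj_complex_of_real)
  also have "(LINT \<xi>|lborel. cnj (cis (- (\<xi> * x)) * h \<xi>)) = (LINT \<xi>|lborel. cnj (cis (- ((0 + - 1 * \<xi>) * x)) * h (0 + - 1 * \<xi>)))"
    using lborel_integral_real_affine[of "-1" "\<lambda>\<xi>. cnj (cis (- (\<xi> * x)) * h \<xi>)" 0] by simp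
  also have "\<dots> = (LINT \<xi>|lborel. cis (- (\<xi> * x)) * h \<xi>)"
    by (intro Bochner_Integration.integral_cong refl) (simp add: herm cis_cnj)
  finally show ?thesis by (simp add: ft_def)
qed

lemma lborel_integral_reflect:
  fixes f :: "real \<Rightarrow> 'b::{banach, second_countable_topology}"
  shows "(LINT x|lborel. f (- x)) = (LINT x|lborel. f x)"
  using lborel_integral_real_affine[of "-1" f 0] by simp

lemma sqint_reflect:
  fixes f :: "real \<Rightarrow> 'b::{banach, second_countable_topology}"
  assumes "sqint lborel f" shows "sqint lborel (\<lambda>x. f (- x))"
  using assms lborel_integrable_real_affine[of "\<lambda>x. (norm (f x))\<^sup>2" "-1" 0]
  by (auto simp: sqint_def)

text \<open>The preimage \<open>w\<close> is the \<open>L\<^sup>2\<close> limit of the inverse transforms \<open>wr N\<close> of the truncations of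
  \<open>h\<close>. With \<open>a\<close> the transform of the truncation of \<open>w\<close> to \<open>{-R..R}\<close>, the adjoint relation gives
  \<open>\<langle>a, h\<rangle> = \<parallel>a\<parallel>\<^sup>2\<close>, hence \<open>\<parallel>a - h\<parallel>\<^sup>2 = \<parallel>h\<parallel>\<^sup>2 - \<parallel>a\<parallel>\<^sup>2\<close>, which tends to \<open>0\<close>.\<close>

lemma has_L2_fourier_surjective:
  assumes h: "sqint lborel h" and herm: "\<And>\<xi>. h (- \<xi>) = cnj (h \<xi>)"
  obtains w :: "real \<Rightarrow> real" where "has_L2_fourier (\<lambda>x. complex_of_real (w x)) h"
proof -
  note [measurable] = sqint_measurable[OF h]
  define hN where "hN n \<xi> = indicator {-real n..real n} \<xi> *\<^sub>R h \<xi>" for n \<xi>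
  have hN: "sqint lborel (hN n)" for n
    unfolding hN_def by (rule sqint_truncation[OF h]) auto
  note [measurable] = sqint_measurable[OF hN]
  have hN0: "hN n \<xi> = 0" if "real n < \<bar>\<xi>\<bar>" for n \<xi> using that by (auto simp: hN_def indicator_def)
  have hNi: "integrable lborel (hN n)" for n by (rule sqint_compact_support_integrable[OF hN hN0])
  have hN_herm: "hN n (- \<xi>) = cnj (hN n \<xi>)" for n \<xi>
    unfolding hN_def herm by (auto simp: indicator_def)
  have hN_lim: "(\<lambda>n. LINT \<xi>|lborel. (norm (hN n \<xi> - h \<xi>))\<^sup>2) \<longlonglongrightarrow> integral\<^sup>L (lborel :: real measure) (\<lambda>_. 0)"
  proof (rule integral_dominated_convergence[where w = "\<lambda>\<xi>. (norm (h \<xi>))\<^sup>2"])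
    show "AE \<xi> in lborel. (\<lambda>n. (norm (hN n \<xi> - h \<xi>))\<^sup>2) \<longlonglongrightarrow> 0"
    proof (intro AE_I2 tendsto_eventually)
      fix \<xi>
      show "\<forall>\<^sub>F n in sequentially. (norm (hN n \<xi> - h \<xi>))\<^sup>2 = 0"
        using eventually_ge_at_top[of "nat \<lceil>\<bar>\<xi>\<bar>\<rceil>"]
        by eventually_elim (auto simp: hN_def indicator_def nat_le_iff ceiling_le_iff)
    qed
  qed (use sqint_integrable[OF h] in \<open>auto simp: hN_def indicator_def\<close>)
  then have hN_lim: "(\<lambda>n. LINT \<xi>|lborel. (norm (hN n \<xi> - h \<xi>))\<^sup>2) \<longlonglongrightarrow> 0" by simp
  define wr where "wr n x = Re (ft (hN n) (- x))" for n x
  have wr_eq: "complex_of_real (wr n x) = ft (hN n) (- x)" for n x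
    unfolding wr_def using ft_reflect_Hermitian[of "hN n" "- x", OF hN_herm]
    by (simp add: complex_eq_iff)
  have wr_norm: "(norm (wr m x - wr n x))\<^sup>2 = (norm (ft (\<lambda>\<xi>. hN m \<xi> - hN n \<xi>) (- x)))\<^sup>2" for m n x
    unfolding ft_diff[OF hNi hNi] wr_eq[symmetric] by (simp flip: of_real_diff)
  have wr_norm1: "(norm (wr n x))\<^sup>2 = (norm (ft (hN n) (- x)))\<^sup>2" for n x
    unfolding wr_eq[symmetric] by simp
  have wr: "sqint lborel (wr n)" for n
  proof -
    have "sqint lborel (\<lambda>x. ft (hN n) (- x))"
      by (rule sqint_reflect[OF Plancherel_compact_support(1)[OF hN hN0]])
    then show ?thesis unfolding sqint_def wr_norm1 by (auto simp: wr_def[abs_def])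
  qed
  have wr_diff: "(LINT x|lborel. (norm (wr m x - wr n x))\<^sup>2) = (LINT \<xi>|lborel. (norm (hN m \<xi> - hN n \<xi>))\<^sup>2)" for m n
  proof -
    have "(LINT x|lborel. (norm (wr m x - wr n x))\<^sup>2) = (LINT x|lborel. (norm (ft (\<lambda>\<xi>. hN m \<xi> - hN n \<xi>) x))\<^sup>2)"
      unfolding wr_norm by (rule lborel_integral_reflect)
    also have "\<dots> = (LINT \<xi>|lborel. (norm (hN m \<xi> - hN n \<xi>))\<^sup>2)"
      by (rule Plancherel_compact_support(2)[where R = "max (real m) (real n)"]) (auto intro: sqint_diff hN simp: hN0)
    finally show ?thesis .
  qed
  have wr_int: "(LINT x|lborel. (norm (wr n x))\<^sup>2) = (LINT \<xi>|lborel. (norm (hN n \<xi>))\<^sup>2)" for n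
    using lborel_integral_reflect[of "\<lambda>x. (norm (ft (hN n) x))\<^sup>2"] Plancherel_compact_support(2)[OF hN hN0]
    by (simp only: wr_norm1)
  have Cau: "\<exists>N. \<forall>m\<ge>N. \<forall>n\<ge>N. (LINT x|lborel. (norm (wr m x - wr n x))\<^sup>2) < e" if "e > 0" for e
  proof -
    from hN_lim that have "\<forall>\<^sub>F n in sequentially. (LINT \<xi>|lborel. (norm (hN n \<xi> - h \<xi>))\<^sup>2) < e / 4"
      by (intro order_tendstoD(2)) auto
    then obtain N where N: "\<And>n. n \<ge> N \<Longrightarrow> (LINT \<xi>|lborel. (norm (hN n \<xi> - h \<xi>))\<^sup>2) < e / 4"
      by (auto simp: eventually_sequentially)
    have "(LINT x|lborel. (norm (wr m x - wr n x))\<^sup>2) < e" if "m \<ge> N" "n \<ge> N" for m n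
    proof -
      have "(LINT \<xi>|lborel. (norm (hN m \<xi> - hN n \<xi>))\<^sup>2)
          \<le> (LINT \<xi>|lborel. 2 * (norm (hN m \<xi> - h \<xi>))\<^sup>2 + 2 * (norm (hN n \<xi> - h \<xi>))\<^sup>2)"
      proof (intro integral_mono Bochner_Integration.integrable_add integrable_mult_right sqint_integrable sqint_diff hN h)
        fix \<xi>
        have "hN m \<xi> - hN n \<xi> = (hN m \<xi> - h \<xi>) - (hN n \<xi> - h \<xi>)" by simp
        then show "(norm (hN m \<xi> - hN n \<xi>))\<^sup>2 \<le> 2 * (norm (hN m \<xi> - h \<xi>))\<^sup>2 + 2 * (norm (hN n \<xi> - h \<xi>))\<^sup>2"
          by (simp only: norm_diff_sq_le)
      qed
      also have "\<dots> = 2 * (LINT \<xi>|lborel. (norm (hN m \<xi> - h \<xi>))\<^sup>2) + 2 * (LINT \<xi>|lborel. (norm (hN n \<xi> - h \<xi>))\<^sup>2)"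
        using sqint_integrable[OF sqint_diff[OF hN h]] by simp
      also have "\<dots> < e" using N[OF that(1)] N[OF that(2)] by linarith
      finally show ?thesis unfolding wr_diff .
    qed
    then show ?thesis by blast
  qed
  obtain w where w: "sqint lborel w" and wr_w: "(\<lambda>n. LINT x|lborel. (norm (wr n x - w x))\<^sup>2) \<longlonglongrightarrow> 0"
    using sqint_complete[OF wr Cau] by blast
  note [measurable] = sqint_measurable[OF w]
  have norm_w: "(LINT x|lborel. (w x)\<^sup>2) = (LINT \<xi>|lborel. (norm (h \<xi>))\<^sup>2)"
  proof (rule LIMSEQ_unique)
    show "(\<lambda>n. LINT x|lborel. (norm (wr n x))\<^sup>2) \<longlonglongrightarrow> (LINT x|lborel. (w x)\<^sup>2)"
      using sqint_tendsto_integral_norm[OF wr w wr_w] by simp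
    show "(\<lambda>n. LINT x|lborel. (norm (wr n x))\<^sup>2) \<longlonglongrightarrow> (LINT \<xi>|lborel. (norm (h \<xi>))\<^sup>2)"
      unfolding wr_int by (rule sqint_tendsto_integral_norm[OF hN h hN_lim])
  qed
  define wc where "wc x = complex_of_real (w x)" for x
  have wc: "sqint lborel wc" using w by (auto simp: sqint_def wc_def[abs_def])
  define I where "I R = (LINT x|lborel. indicator {-R..R} x * (w x)\<^sup>2)" for R
  have dist: "(LINT \<xi>|lborel. (norm (truncated_fourier R wc \<xi> - h \<xi>))\<^sup>2) = (LINT x|lborel. (w x)\<^sup>2) - I R" for R
  proof -
    define a where "a = truncated_fourier R wc"
    define v where "v x = indicator {-R..R} x *\<^sub>R wc x" for x
    have a_eq: "a = ft v" unfolding a_def v_def truncated_fourier_eq_ft ..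
    have a: "sqint lborel a" unfolding a_def by (rule truncated_fourier_Plancherel(1)[OF wc])
    have v: "integrable lborel v" unfolding v_def by (rule integrable_truncated_fourier_integrand[OF wc])
    have norm_a: "(LINT \<xi>|lborel. (norm (a \<xi>))\<^sup>2) = I R"
      unfolding a_def truncated_fourier_Plancherel(2)[OF wc] I_def by (simp add: wc_def)
    have wt: "sqint lborel (\<lambda>x. indicator {-R..R} x * w x)"
      using sqint_truncation[OF w, of "{-R..R}"] by simp
    have ach: "integrable lborel (\<lambda>\<xi>. a \<xi> * cnj (g \<xi>))" if "sqint lborel g" for g
      using sqint_mult_integrable[OF a, of "\<lambda>\<xi>. cnj (g \<xi>)"] that by (auto simp: sqint_def)
    \<comment> \<open>The adjoint relation requires an integrable second factor; it is applied to
      the truncations \<open>hN n\<close>, and the limit in n is taken on both sides.\<close>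
    have "(\<lambda>n. LINT \<xi>|lborel. a \<xi> * cnj (hN n \<xi>)) \<longlonglongrightarrow> (LINT \<xi>|lborel. a \<xi> * cnj (h \<xi>))"
    proof (rule integral_dominated_convergence[where w = "\<lambda>\<xi>. norm (a \<xi> * cnj (h \<xi>))"])
      show "AE \<xi> in lborel. (\<lambda>n. a \<xi> * cnj (hN n \<xi>)) \<longlonglongrightarrow> a \<xi> * cnj (h \<xi>)"
      proof (intro AE_I2 tendsto_eventually)
        fix \<xi>
        show "\<forall>\<^sub>F n in sequentially. a \<xi> * cnj (hN n \<xi>) = a \<xi> * cnj (h \<xi>)"
          using eventually_ge_at_top[of "nat \<lceil>\<bar>\<xi>\<bar>\<rceil>"]
          by eventually_elim (auto simp: hN_def indicator_def nat_le_iff ceiling_le_iff)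
      qed
      show "integrable lborel (\<lambda>\<xi>. norm (a \<xi> * cnj (h \<xi>)))" using ach[OF h] by simp
      show "AE \<xi> in lborel. norm (a \<xi> * cnj (hN n \<xi>)) \<le> norm (a \<xi> * cnj (h \<xi>))" for n
        by (intro AE_I2) (auto simp: hN_def indicator_def norm_mult)
      show "(\<lambda>\<xi>. a \<xi> * cnj (h \<xi>)) \<in> borel_measurable lborel" "(\<lambda>\<xi>. a \<xi> * cnj (hN n \<xi>)) \<in> borel_measurable lborel" for n
        using ach[OF h] ach[OF hN] by auto
    qed
    moreover have "(LINT \<xi>|lborel. a \<xi> * cnj (hN n \<xi>)) = complex_of_real (LINT x|lborel. (indicator {-R..R} x * w x) * wr n x)" for n
    proof -
      have "(LINT \<xi>|lborel. a \<xi> * cnj (hN n \<xi>)) = (LINT x|lborel. v x * cnj (complex_of_real (wr n x)))"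
        unfolding a_eq wr_eq by (rule ft_adjoint[OF v hNi])
      also have "\<dots> = (LINT x|lborel. complex_of_real ((indicator {-R..R} x * w x) * wr n x))"
        by (intro Bochner_Integration.integral_cong refl) (simp add: v_def wc_def scaleR_conv_of_real)
      finally show ?thesis by (simp only: integral_complex_of_real)
    qed
    moreover have "(\<lambda>n. LINT x|lborel. (indicator {-R..R} x * w x) * wr n x) \<longlonglongrightarrow> (LINT x|lborel. (indicator {-R..R} x * w x) * w x)"
      using wr_w by (intro sqint_tendsto_inner[OF wr w wt]) simp
    then have "(\<lambda>n. complex_of_real (LINT x|lborel. (indicator {-R..R} x * w x) * wr n x)) \<longlonglongrightarrow> complex_of_real (LINT x|lborel. (indicator {-R..R} x * w x) * w x)"
      by (rule tendsto_of_real)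
    ultimately have "(LINT \<xi>|lborel. a \<xi> * cnj (h \<xi>)) = complex_of_real (LINT x|lborel. (indicator {-R..R} x * w x) * w x)"
      by (simp only:) (rule LIMSEQ_unique)
    then have inner: "(LINT \<xi>|lborel. a \<xi> * cnj (h \<xi>)) = complex_of_real (I R)"
      by (simp add: I_def power2_eq_square mult.assoc)
    define r where "r \<xi> = Re (a \<xi> * cnj (h \<xi>))" for \<xi>
    have r: "integrable lborel r" "(LINT \<xi>|lborel. r \<xi>) = I R"
      unfolding r_def using integrable_Re[OF ach[OF h]] integral_Re[OF ach[OF h]] inner by simp_all
    have "(norm (a \<xi> - h \<xi>))\<^sup>2 = (norm (a \<xi>))\<^sup>2 + (norm (h \<xi>))\<^sup>2 - 2 * r \<xi>" for \<xi>
      unfolding cmod_power2 r_def by (simp add: power2_eq_square algebra_simps)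
    then have "(LINT \<xi>|lborel. (norm (a \<xi> - h \<xi>))\<^sup>2)
        = (LINT \<xi>|lborel. (norm (a \<xi>))\<^sup>2 + (norm (h \<xi>))\<^sup>2 - 2 * r \<xi>)"
      by (simp only:)
    also have "\<dots> = (LINT \<xi>|lborel. (norm (a \<xi>))\<^sup>2) + (LINT \<xi>|lborel. (norm (h \<xi>))\<^sup>2) - 2 * (LINT \<xi>|lborel. r \<xi>)"
      using sqint_integrable[OF a] sqint_integrable[OF h] r(1) by simp
    finally show ?thesis unfolding a_def[symmetric] norm_a r(2) norm_w by simp
  qed
  have "((\<lambda>R. (LINT x|lborel. (w x)\<^sup>2) - I R) \<longlongrightarrow> (LINT x|lborel. (w x)\<^sup>2) - (LINT x|lborel. (w x)\<^sup>2)) at_top"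
    unfolding I_def by (intro tendsto_diff tendsto_const integral_exhaustion_at_top sqint_integrable_real[OF w])
  then have "((\<lambda>R. ennreal ((LINT x|lborel. (w x)\<^sup>2) - I R)) \<longlongrightarrow> ennreal 0) at_top"
    by (intro tendsto_ennrealI) simp
  moreover have "(\<integral>\<^sup>+ \<xi>. ennreal ((norm (truncated_fourier R wc \<xi> - h \<xi>))\<^sup>2) \<partial>lborel) = ennreal ((LINT x|lborel. (w x)\<^sup>2) - I R)" for R
    unfolding dist[symmetric]
    by (intro nn_integral_eq_integral sqint_integrable sqint_diff h truncated_fourier_Plancherel(1)[OF wc]) simp
  ultimately have "has_L2_fourier wc h"
    using wc h by (simp add: has_L2_fourier_def L2_fun_iff_sqint)
  then show thesis using that unfolding wc_def by blast
qed

subsection \<open>The Gagliardo seminorm and the fractional Laplacian\<close>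

lemma ft_indicator_unit_interval:
  assumes "\<xi> \<noteq> 0"
  shows "(norm (ft (indicator {0..1}) \<xi>))\<^sup>2 = (norm (cis \<xi> - 1))\<^sup>2 / (2 * pi * \<xi>\<^sup>2)"
proof -
  define G where "G x = cis (- (x * \<xi>)) / (- \<i> * complex_of_real \<xi>)" for x
  have "(LINT x|lborel. indicator {0..1} x *\<^sub>R cis (- (x * \<xi>))) = G 1 - G 0"
  proof (rule integral_FTC_Icc)
    fix x :: real
    have "((\<lambda>x. exp (complex_of_real x * (- \<i> * complex_of_real \<xi>)) / (- \<i> * complex_of_real \<xi>)) has_vector_derivative
        exp (complex_of_real x * (- \<i> * complex_of_real \<xi>))) (at x within {0..1})"
      using assms by (auto intro!: derivative_eq_intros has_vector_derivative_real_field simp: field_simps)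
    then show "(G has_vector_derivative cis (- (x * \<xi>))) (at x within {0..1})"
      unfolding G_def cis_conv_exp by (simp add: mult_ac)
  qed (auto intro!: continuous_intros)
  moreover have "(LINT x|lborel. cis (- (x * \<xi>)) * indicator {0..1} x) = (LINT x|lborel. indicator {0..1} x *\<^sub>R cis (- (x * \<xi>)))"
    by (intro Bochner_Integration.integral_cong refl) (auto simp: indicator_def)
  ultimately have "ft (indicator {0..1}) \<xi> = complex_of_real (1 / sqrt (2 * pi)) * ((cis (- \<xi>) - 1) / (- \<i> * complex_of_real \<xi>))"
    by (simp add: ft_def G_def diff_divide_distrib)
  moreover have "norm (cis (- \<xi>) - 1) = norm (cis \<xi> - 1)"
    by (metis cis_cnj complex_cnj_diff complex_cnj_one complex_mod_cnj)
  ultimately have "norm (ft (indicator {0..1}) \<xi>) = (1 / sqrt (2 * pi)) * (norm (cis \<xi> - 1) / \<bar>\<xi>\<bar>)"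
    by (simp add: norm_mult norm_divide)
  then show ?thesis by (simp add: power_mult_distrib power_divide)
qed

text \<open>Up to the factor \<open>2 * pi\<close> the integrand is the squared modulus of the
  transform of the indicator of the unit interval, so Plancherel's identity evaluates the integral
  without any residue calculus.\<close>

lemma nn_integral_cis_quotient_1:
  "(\<integral>\<^sup>+ t. ennreal ((norm (cis t - 1))\<^sup>2 / t\<^sup>2) \<partial>lborel) = ennreal (2 * pi)"
proof -
  have s: "sqint lborel (indicator {0..1} :: real \<Rightarrow> complex)"
  proof -
    have "(\<lambda>x. (norm (indicator {0..1} x :: complex))\<^sup>2) = (indicator {0..1} :: real \<Rightarrow> real)"
      by (auto simp: indicator_def)
    then show ?thesis by (simp add: sqint_def)
  qed
  have z: "indicator {0..1} x = (0::complex)" if "1 < \<bar>x\<bar>" for x :: real using that by (auto simp: indicator_def)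
  note P = Plancherel_compact_support[OF s z]
  have "(\<lambda>x. (norm (indicator {0..1} x :: complex))\<^sup>2) = (indicator {0..1} :: real \<Rightarrow> real)"
    by (auto simp: indicator_def)
  then have 1: "(LINT \<xi>|lborel. (norm (ft (indicator {0..1}) \<xi>))\<^sup>2) = 1"
    using P(2) by simp
  have "(\<integral>\<^sup>+ t. ennreal ((norm (cis t - 1))\<^sup>2 / t\<^sup>2) \<partial>lborel)
      = (\<integral>\<^sup>+ \<xi>. ennreal (2 * pi * (norm (ft (indicator {0..1}) \<xi>))\<^sup>2) \<partial>lborel)"
  proof (intro nn_integral_cong_AE)
    show "AE t in lborel. ennreal ((norm (cis t - 1))\<^sup>2 / t\<^sup>2) = ennreal (2 * pi * (norm (ft (indicator {0..1}) t))\<^sup>2)"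
      using AE_lborel_singleton[of 0] by eventually_elim (simp add: ft_indicator_unit_interval)
  qed
  also have "\<dots> = ennreal (LINT \<xi>|lborel. 2 * pi * (norm (ft (indicator {0..1}) \<xi>))\<^sup>2)"
    using sqint_integrable[OF P(1)] by (intro nn_integral_eq_integral) auto
  also have "\<dots> = ennreal (2 * pi)" using 1 by simp
  finally show ?thesis .
qed

text \<open>Scaling of the previous integral. This is the origin of the multiplier
  \<open>\<bar>\<xi>\<bar>\<close> and of the constant \<open>2 * pi\<close> relating the Gagliardo
  seminorm to the quarter Laplacian.\<close>

lemma nn_integral_cis_quotient:
  "(\<integral>\<^sup>+ t. ennreal ((norm (cis (t * \<xi>) - 1))\<^sup>2 / t\<^sup>2) \<partial>lborel) = ennreal (2 * pi * \<bar>\<xi>\<bar>)"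
proof (cases "\<xi> = 0")
  case False
  have "(\<integral>\<^sup>+ t. ennreal ((norm (cis (t * \<xi>) - 1))\<^sup>2 / t\<^sup>2) \<partial>lborel)
    = ennreal \<bar>1 / \<xi>\<bar> * (\<integral>\<^sup>+ t. ennreal ((norm (cis ((0 + (1 / \<xi>) * t) * \<xi>) - 1))\<^sup>2 / (0 + (1 / \<xi>) * t)\<^sup>2) \<partial>lborel)"
    by (rule nn_integral_real_affine) (use False in auto)
  also have "(\<integral>\<^sup>+ t. ennreal ((norm (cis ((0 + (1 / \<xi>) * t) * \<xi>) - 1))\<^sup>2 / (0 + (1 / \<xi>) * t)\<^sup>2) \<partial>lborel)
    = (\<integral>\<^sup>+ t. ennreal (\<xi>\<^sup>2) * ennreal ((norm (cis t - 1))\<^sup>2 / t\<^sup>2) \<partial>lborel)"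
    using False by (intro nn_integral_cong) (simp add: power_divide ennreal_mult[symmetric] mult.commute)
  also have "\<dots> = ennreal (\<xi>\<^sup>2) * ennreal (2 * pi)"
    by (subst nn_integral_cmult) (auto simp: nn_integral_cis_quotient_1)
  also have "ennreal \<bar>1 / \<xi>\<bar> * (ennreal (\<xi>\<^sup>2) * ennreal (2 * pi)) = ennreal (\<bar>1 / \<xi>\<bar> * (\<xi>\<^sup>2 * (2 * pi)))"
    unfolding ennreal_mult'[OF abs_ge_zero] ennreal_mult'[OF zero_le_power2] ..
  also have "\<bar>1 / \<xi>\<bar> * (\<xi>\<^sup>2 * (2 * pi)) = 2 * pi * \<bar>\<xi>\<bar>"
    using False by (simp add: power2_eq_square abs_if field_simps)
  finally show ?thesis .
qed simp

lemma gagliardo_quotient_measurable [measurable]: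
  assumes [measurable]: "u \<in> borel_measurable borel"
  shows "gagliardo_quotient u \<in> borel_measurable (borel \<Otimes>\<^sub>M borel)"
  unfolding gagliardo_quotient_def by measurable

text \<open>With y = x + t, Plancherel's identity for the increment of u by a fixed t produces the
  factor \<open>cis (t * \<xi>) - 1\<close>; the integral over t is then known explicitly. Only
  nonnegative integrals occur, so finiteness of either side need not be known in advance.\<close>

lemma nn_integral_gagliardo_quotient:
  assumes u: "sqint lborel u" and R: "\<And>x. R < \<bar>x\<bar> \<Longrightarrow> u x = 0"
  shows "(\<integral>\<^sup>+ z. ennreal (gagliardo_quotient u z) \<partial>lborel)
    = (\<integral>\<^sup>+ \<xi>. ennreal (2 * pi * \<bar>\<xi>\<bar> * (norm (ft (\<lambda>x. complex_of_real (u x)) \<xi>))\<^sup>2) \<partial>lborel)"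
proof -
  note [measurable] = sqint_measurable[OF u, simplified]
  define uc where "uc x = complex_of_real (u x)" for x
  have uc: "sqint lborel uc" using u by (auto simp: sqint_def uc_def[abs_def])
  note [measurable] = sqint_measurable[OF uc, simplified]
  have uc0: "uc x = 0" if "R < \<bar>x\<bar>" for x using R[OF that] by (simp add: uc_def)
  have D: "(\<integral>\<^sup>+ x. ennreal ((u x - u (x + t))\<^sup>2) \<partial>lborel)
      = (\<integral>\<^sup>+ \<xi>. ennreal ((norm (cis (t * \<xi>) - 1))\<^sup>2 * (norm (ft uc \<xi>))\<^sup>2) \<partial>lborel)" for t
  proof -
    define v where "v x = uc (x + t) - uc x" for x
    have v: "sqint lborel v" unfolding v_def by (intro sqint_diff sqint_shift uc)
    have v0: "v x = 0" if "R + \<bar>t\<bar> < \<bar>x\<bar>" for x using that by (simp add: v_def uc0)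
    have ft_v: "ft v \<xi> = (cis (t * \<xi>) - 1) * ft uc \<xi>" for \<xi>
    proof -
      have "integrable lborel (\<lambda>x. uc (x + t))"
        by (rule sqint_compact_support_integrable[of _ "R + \<bar>t\<bar>"]) (auto intro: sqint_shift uc uc0)
      moreover have "integrable lborel uc"
        by (rule sqint_compact_support_integrable[OF uc uc0])
      ultimately have "ft v \<xi> = ft (\<lambda>x. uc (x + t)) \<xi> - ft uc \<xi>" unfolding v_def by (rule ft_diff)
      then show ?thesis by (simp add: ft_translate algebra_simps)
    qed
    have "(\<integral>\<^sup>+ x. ennreal ((u x - u (x + t))\<^sup>2) \<partial>lborel) = (\<integral>\<^sup>+ x. ennreal ((norm (v x))\<^sup>2) \<partial>lborel)"
    proof (rule nn_integral_cong)
      fix x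
      have "norm (v x) = \<bar>u (x + t) - u x\<bar>" by (simp add: v_def uc_def flip: of_real_diff)
      then show "ennreal ((u x - u (x + t))\<^sup>2) = ennreal ((norm (v x))\<^sup>2)" by (simp add: power2_commute)
    qed
    also have "\<dots> = ennreal (LINT x|lborel. (norm (v x))\<^sup>2)"
      by (intro nn_integral_eq_integral sqint_integrable v) simp
    also have "\<dots> = ennreal (LINT \<xi>|lborel. (norm (ft v \<xi>))\<^sup>2)"
      using Plancherel_compact_support(2)[OF v v0] by simp
    also have "\<dots> = (\<integral>\<^sup>+ \<xi>. ennreal ((norm (ft v \<xi>))\<^sup>2) \<partial>lborel)"
      by (intro nn_integral_eq_integral[symmetric] sqint_integrable Plancherel_compact_support(1)[OF v v0]) simp_all
    finally show ?thesis by (simp add: ft_v norm_mult power_mult_distrib)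
  qed
  have "(\<integral>\<^sup>+ z. ennreal (gagliardo_quotient u z) \<partial>lborel)
      = (\<integral>\<^sup>+ x. \<integral>\<^sup>+ y. ennreal (gagliardo_quotient u (x, y)) \<partial>lborel \<partial>lborel)"
    unfolding lborel_prod[symmetric] by (rule lborel.nn_integral_fst[symmetric]) measurable
  also have "\<dots> = (\<integral>\<^sup>+ x. \<integral>\<^sup>+ t. ennreal (gagliardo_quotient u (x, x + 1 * t)) \<partial>lborel \<partial>lborel)"
  proof (rule nn_integral_cong)
    fix x
    show "(\<integral>\<^sup>+ y. ennreal (gagliardo_quotient u (x, y)) \<partial>lborel) = (\<integral>\<^sup>+ t. ennreal (gagliardo_quotient u (x, x + 1 * t)) \<partial>lborel)"
      by (subst nn_integral_real_affine[of _ 1 x]) auto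
  qed
  also have "\<dots> = (\<integral>\<^sup>+ t. \<integral>\<^sup>+ x. ennreal (gagliardo_quotient u (x, x + 1 * t)) \<partial>lborel \<partial>lborel)"
    by (rule lborel_pair.Fubini'[symmetric]) measurable
  also have "\<dots> = (\<integral>\<^sup>+ t. \<integral>\<^sup>+ \<xi>. ennreal ((norm (cis (t * \<xi>) - 1))\<^sup>2 / t\<^sup>2) * ennreal ((norm (ft uc \<xi>))\<^sup>2) \<partial>lborel \<partial>lborel)"
  proof (rule nn_integral_cong)
    fix t :: real
    have "(\<integral>\<^sup>+ x. ennreal (gagliardo_quotient u (x, x + 1 * t)) \<partial>lborel)
        = (\<integral>\<^sup>+ x. ennreal (1 / t\<^sup>2) * ennreal ((u x - u (x + t))\<^sup>2) \<partial>lborel)"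
      by (intro nn_integral_cong) (simp add: gagliardo_quotient_def ennreal_mult[symmetric])
    also have "\<dots> = ennreal (1 / t\<^sup>2) * (\<integral>\<^sup>+ \<xi>. ennreal ((norm (cis (t * \<xi>) - 1))\<^sup>2 * (norm (ft uc \<xi>))\<^sup>2) \<partial>lborel)"
      by (subst nn_integral_cmult) (auto simp: D)
    also have "\<dots> = (\<integral>\<^sup>+ \<xi>. ennreal (1 / t\<^sup>2) * ennreal ((norm (cis (t * \<xi>) - 1))\<^sup>2 * (norm (ft uc \<xi>))\<^sup>2) \<partial>lborel)"
      by (rule nn_integral_cmult[symmetric]) measurable
    also have "\<dots> = (\<integral>\<^sup>+ \<xi>. ennreal ((norm (cis (t * \<xi>) - 1))\<^sup>2 / t\<^sup>2) * ennreal ((norm (ft uc \<xi>))\<^sup>2) \<partial>lborel)"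
      by (intro nn_integral_cong) (simp add: ennreal_mult[symmetric])
    finally show "(\<integral>\<^sup>+ x. ennreal (gagliardo_quotient u (x, x + 1 * t)) \<partial>lborel)
      = (\<integral>\<^sup>+ \<xi>. ennreal ((norm (cis (t * \<xi>) - 1))\<^sup>2 / t\<^sup>2) * ennreal ((norm (ft uc \<xi>))\<^sup>2) \<partial>lborel)" .
  qed
  also have "\<dots> = (\<integral>\<^sup>+ \<xi>. \<integral>\<^sup>+ t. ennreal ((norm (cis (t * \<xi>) - 1))\<^sup>2 / t\<^sup>2) * ennreal ((norm (ft uc \<xi>))\<^sup>2) \<partial>lborel \<partial>lborel)"
    by (rule lborel_pair.Fubini'[symmetric]) measurable
  also have "\<dots> = (\<integral>\<^sup>+ \<xi>. ennreal (2 * pi * \<bar>\<xi>\<bar> * (norm (ft uc \<xi>))\<^sup>2) \<partial>lborel)"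
  proof (rule nn_integral_cong)
    fix \<xi>
    have "(\<integral>\<^sup>+ t. ennreal ((norm (cis (t * \<xi>) - 1))\<^sup>2 / t\<^sup>2) * ennreal ((norm (ft uc \<xi>))\<^sup>2) \<partial>lborel)
        = (\<integral>\<^sup>+ t. ennreal ((norm (cis (t * \<xi>) - 1))\<^sup>2 / t\<^sup>2) \<partial>lborel) * ennreal ((norm (ft uc \<xi>))\<^sup>2)"
      by (rule nn_integral_multc) measurable
    then show "(\<integral>\<^sup>+ t. ennreal ((norm (cis (t * \<xi>) - 1))\<^sup>2 / t\<^sup>2) * ennreal ((norm (ft uc \<xi>))\<^sup>2) \<partial>lborel)
        = ennreal (2 * pi * \<bar>\<xi>\<bar> * (norm (ft uc \<xi>))\<^sup>2)"
      unfolding nn_integral_cis_quotient by (simp only: ennreal_mult''[OF zero_le_power2])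
  qed
  finally show ?thesis unfolding uc_def .
qed

section \<open>The operator with multiplier \<open>\<bar>\<xi>\<bar> powr (1 / 2)\<close> on
  X\<close>

lemma X_spaceD:
  assumes "u \<in> X_space"
  shows "sqint lborel u" "integrable lborel (gagliardo_quotient u)" "AE x in lborel. x \<notin> {0<..<1} \<longrightarrow> u x = 0"
  using assms by (auto simp: X_space_def H_half_def L2_fun_iff_sqint)

lemma gagliardo_quotient_nonneg [simp]: "0 \<le> gagliardo_quotient u z"
  by (simp add: gagliardo_quotient_def split: prod.split)

lemma X_norm_nonneg [simp]: "0 \<le> X_norm u"
  by (simp add: gagliardo_seminorm_def)

lemma X_norm_sq: "(X_norm u)\<^sup>2 = (LINT z|lborel. gagliardo_quotient u z)"
  by (simp add: gagliardo_seminorm_def)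

text \<open>An exceptional null set on the line produces a vertical and a horizontal strip in the
  plane, both null by Fubini.\<close>

lemma AE_lborel_pair:
  assumes "AE x in (lborel :: real measure). P x"
  shows "AE z in (lborel :: (real \<times> real) measure). P (fst z) \<and> P (snd z)"
proof -
  obtain N where N: "{x \<in> space lborel. \<not> P x} \<subseteq> N" "emeasure lborel N = 0" "N \<in> sets lborel"
    by (rule AE_E[OF assms])
  have [measurable]: "N \<in> sets borel" using N(3) by simp
  have "AE z in (lborel \<Otimes>\<^sub>M lborel). fst z \<notin> N \<and> snd z \<notin> N"
  proof (rule lborel_pair.AE_pair_measure)
    have "AE x in lborel. x \<notin> N" using N by (intro AE_not_in) auto
    then show "AE x in lborel. AE y in lborel. fst (x, y) \<notin> N \<and> snd (x, y) \<notin> N"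
      by eventually_elim (use \<open>AE x in lborel. x \<notin> N\<close> in simp)
  qed measurable
  then have "AE z in (lborel :: (real \<times> real) measure). fst z \<notin> N \<and> snd z \<notin> N"
    unfolding lborel_prod .
  then show ?thesis by eventually_elim (use N(1) in auto)
qed

lemma gagliardo_quotient_cong_AE:
  assumes "AE x in lborel. u x = v x"
  shows "AE z in lborel. gagliardo_quotient u z = gagliardo_quotient v z"
  using AE_lborel_pair[OF assms] by eventually_elim (auto simp: gagliardo_quotient_def split: prod.split)

text \<open>The multiplied transform \<open>h\<close> is square integrable by the Gagliardo identity
  and Hermitian because u is real, so it has a real preimage and the choice in
  \<open>frac_laplacian\<close> is meaningful. The norm formula is stated for every admissible w,
  because later also sums of chosen images are inserted.\<close>

lemma X_space_has_frac_laplacian: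
  assumes u: "u \<in> X_space"
  shows "has_frac_laplacian (1/4) u (frac_laplacian (1/4) u)"
    and "has_frac_laplacian (1/4) u w \<Longrightarrow> sqint lborel w \<and> (LINT x|lborel. (w x)\<^sup>2) = (X_norm u)\<^sup>2 / (2 * pi)"
proof -
  note [measurable] = sqint_measurable[OF X_spaceD(1)[OF u], simplified]
  \<comment> \<open>Plancherel's identity asks for vanishing at every point outside an interval, not
    merely almost everywhere.\<close>
  define v where "v x = indicator {0<..<1} x * u x" for x
  have v: "sqint lborel v" unfolding v_def
    using sqint_truncation[OF X_spaceD(1)[OF u], of "{0<..<1}"] by simp
  note [measurable] = sqint_measurable[OF v, simplified]
  have v0: "v x = 0" if "1 < \<bar>x\<bar>" for x using that by (auto simp: v_def indicator_def)
  have uv: "AE x in lborel. u x = v x"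
    using X_spaceD(3)[OF u] by eventually_elim (auto simp: v_def indicator_def)
  define vc where "vc x = complex_of_real (v x)" for x
  have vc: "sqint lborel vc" using v by (auto simp: sqint_def vc_def[abs_def])
  note [measurable] = sqint_measurable[OF vc, simplified]
  have vc0: "vc x = 0" if "1 < \<bar>x\<bar>" for x using v0[OF that] by (simp add: vc_def)
  define g where "g = ft vc"
  \<comment> \<open>The exponent stays in the unevaluated form of \<open>has_frac_laplacian\<close>;
    the square of the multiplier is \<open>\<bar>\<xi>\<bar>\<close>.\<close>
  define h where "h \<xi> = complex_of_real (\<bar>\<xi>\<bar> powr (2 * (1/4))) * g \<xi>" for \<xi>
  have [measurable]: "g \<in> borel_measurable borel" unfolding g_def by measurable
  have [measurable]: "h \<in> borel_measurable borel" unfolding h_def by measurable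
  have norm_h: "(norm (h \<xi>))\<^sup>2 = \<bar>\<xi>\<bar> * (norm (g \<xi>))\<^sup>2" for \<xi>
    by (simp add: h_def norm_mult power_mult_distrib powr_half_sqrt)
  have int_v: "integrable lborel (gagliardo_quotient v)" and norm_v: "(LINT z|lborel. gagliardo_quotient v z) = (X_norm u)\<^sup>2"
  proof -
    have m: "gagliardo_quotient u \<in> borel_measurable (lborel :: (real \<times> real) measure)"
      "gagliardo_quotient v \<in> borel_measurable (lborel :: (real \<times> real) measure)"
      by (simp_all add: borel_prod[symmetric])
    note c = gagliardo_quotient_cong_AE[OF uv]
    show "integrable lborel (gagliardo_quotient v)"
      using X_spaceD(2)[OF u] integrable_cong_AE[OF m c] by simp
    show "(LINT z|lborel. gagliardo_quotient v z) = (X_norm u)\<^sup>2"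
      using integral_cong_AE[OF m c] by (simp add: X_norm_sq)
  qed
  have nn: "(\<integral>\<^sup>+ \<xi>. ennreal (2 * pi * (norm (h \<xi>))\<^sup>2) \<partial>lborel) = ennreal ((X_norm u)\<^sup>2)"
  proof -
    have "(\<integral>\<^sup>+ \<xi>. ennreal (2 * pi * (norm (h \<xi>))\<^sup>2) \<partial>lborel) = (\<integral>\<^sup>+ z. ennreal (gagliardo_quotient v z) \<partial>lborel)"
      using nn_integral_gagliardo_quotient[OF v v0] by (simp add: norm_h g_def vc_def[abs_def] mult.assoc)
    also have "\<dots> = ennreal ((X_norm u)\<^sup>2)"
      unfolding norm_v[symmetric] by (intro nn_integral_eq_integral int_v) simp
    finally show ?thesis .
  qed
  have i2: "integrable lborel (\<lambda>\<xi>. 2 * pi * (norm (h \<xi>))\<^sup>2)"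
    by (rule integrableI_nonneg) (auto simp: nn)
  have "integrable lborel (\<lambda>\<xi>. (1 / (2 * pi)) * (2 * pi * (norm (h \<xi>))\<^sup>2))"
    by (rule integrable_mult_right[OF i2])
  then have h: "sqint lborel h" by (simp add: sqint_def)
  have "ennreal (LINT \<xi>|lborel. 2 * pi * (norm (h \<xi>))\<^sup>2) = ennreal ((X_norm u)\<^sup>2)"
    using nn by (subst nn_integral_eq_integral[symmetric, OF i2]) auto
  then have int_h: "(LINT \<xi>|lborel. (norm (h \<xi>))\<^sup>2) = (X_norm u)\<^sup>2 / (2 * pi)"
    by (simp add: field_simps)
  have ug: "has_L2_fourier (\<lambda>x. complex_of_real (u x)) g"
  proof (rule has_L2_fourier_cong_AE)
    show "has_L2_fourier vc g" unfolding g_def by (rule has_L2_fourier_compact_support[OF vc vc0])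
    show "AE x in lborel. vc x = complex_of_real (u x)" using uv by eventually_elim (simp add: vc_def)
  qed simp
  have "cnj (g \<xi>) = g (- \<xi>)" for \<xi>
  proof -
    have "cnj (cis (- (x * \<xi>)) * vc x) = cis (- (x * - \<xi>)) * vc x" for x by (simp add: cis_cnj vc_def)
    then show ?thesis unfolding g_def ft_def
      by (simp only: complex_cnj_mult[of "complex_of_real _"] Bochner_Integration.integral_cnj[symmetric] complex_cnj_complex_of_real)
  qed
  then have herm: "h (- \<xi>) = cnj (h \<xi>)" for \<xi> by (simp add: h_def)
  obtain w0 where "has_L2_fourier (\<lambda>x. complex_of_real (w0 x)) h"
    using has_L2_fourier_surjective[OF h herm] by blast
  then have "has_frac_laplacian (1/4) u w0"
    using ug unfolding has_frac_laplacian_def h_def by blast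
  then show "has_frac_laplacian (1/4) u (frac_laplacian (1/4) u)"
    unfolding frac_laplacian_def by (rule someI[where P = "has_frac_laplacian (1/4) u"])
  show "sqint lborel w \<and> (LINT x|lborel. (w x)\<^sup>2) = (X_norm u)\<^sup>2 / (2 * pi)" if "has_frac_laplacian (1/4) u w"
  proof -
    from that obtain g' where g': "has_L2_fourier (\<lambda>x. complex_of_real (u x)) g'"
      and w: "has_L2_fourier (\<lambda>x. complex_of_real (w x)) (\<lambda>\<xi>. complex_of_real (\<bar>\<xi>\<bar> powr (2 * (1/4))) * g' \<xi>)"
      unfolding has_frac_laplacian_def by blast
    have wc: "sqint lborel (\<lambda>x. complex_of_real (w x))" using w by (simp add: has_L2_fourier_def L2_fun_iff_sqint)
    have "(\<lambda>x. Re (complex_of_real (w x))) \<in> borel_measurable lborel"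
      using sqint_measurable[OF wc] by measurable
    then have wm: "w \<in> borel_measurable lborel" by simp
    have "sqint lborel w" using wc wm by (simp add: sqint_def)
    have [measurable]: "g' \<in> borel_measurable borel" using g' by (simp add: has_L2_fourier_def L2_fun_def)
    have "(LINT x|lborel. (w x)\<^sup>2) = (LINT \<xi>|lborel. (norm (complex_of_real (\<bar>\<xi>\<bar> powr (2 * (1/4))) * g' \<xi>))\<^sup>2)"
      using has_L2_fourier_isometry[OF w] by simp
    also have "\<dots> = (LINT \<xi>|lborel. (norm (h \<xi>))\<^sup>2)"
      using has_L2_fourier_unique[OF ug g'] by (intro integral_cong_AE) (auto simp: h_def)
    finally show ?thesis using int_h \<open>sqint lborel w\<close> by simp
  qed
qed

lemma has_frac_laplacian_add_diff:
  assumes "has_frac_laplacian s u w" "has_frac_laplacian s u' w'"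
  shows "has_frac_laplacian s (\<lambda>x. u x + u' x) (\<lambda>x. w x + w' x)"
    and "has_frac_laplacian s (\<lambda>x. u x - u' x) (\<lambda>x. w x - w' x)"
proof -
  obtain g g' where g: "has_L2_fourier (\<lambda>x. complex_of_real (u x)) g"
      "has_L2_fourier (\<lambda>x. complex_of_real (w x)) (\<lambda>\<xi>. complex_of_real (\<bar>\<xi>\<bar> powr (2 * s)) * g \<xi>)"
    and g': "has_L2_fourier (\<lambda>x. complex_of_real (u' x)) g'"
      "has_L2_fourier (\<lambda>x. complex_of_real (w' x)) (\<lambda>\<xi>. complex_of_real (\<bar>\<xi>\<bar> powr (2 * s)) * g' \<xi>)"
    using assms unfolding has_frac_laplacian_def by blast
  show "has_frac_laplacian s (\<lambda>x. u x + u' x) (\<lambda>x. w x + w' x)"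
    unfolding has_frac_laplacian_def
    using has_L2_fourier_add_diff(1)[OF g(1) g'(1)] has_L2_fourier_add_diff(1)[OF g(2) g'(2)]
    by (intro exI[of _ "\<lambda>\<xi>. g \<xi> + g' \<xi>"]) (simp add: distrib_left)
  show "has_frac_laplacian s (\<lambda>x. u x - u' x) (\<lambda>x. w x - w' x)"
    unfolding has_frac_laplacian_def
    using has_L2_fourier_add_diff(2)[OF g(1) g'(1)] has_L2_fourier_add_diff(2)[OF g(2) g'(2)]
    by (intro exI[of _ "\<lambda>\<xi>. g \<xi> - g' \<xi>"]) (simp add: right_diff_distrib)
qed

subsection \<open>The Hilbert space structure of \<open>X\<close>\<close>

text \<open>Through u -> \<open>dq u\<close> the seminorm of X becomes the \<open>L\<^sup>2\<close>
  norm in the plane and \<open>X_inner\<close> the corresponding inner product, so that all Hilbert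
  space facts reduce to those for square integrable functions.\<close>

definition dq :: "(real \<Rightarrow> real) \<Rightarrow> real \<times> real \<Rightarrow> real" where
  "dq u z = (u (fst z) - u (snd z)) / \<bar>fst z - snd z\<bar>"

definition X_inner :: "(real \<Rightarrow> real) \<Rightarrow> (real \<Rightarrow> real) \<Rightarrow> real" where
  "X_inner u v = (LINT z|lborel. dq u z * dq v z)"

lemma gagliardo_quotient_eq_dq: "gagliardo_quotient u z = (dq u z)\<^sup>2"
  by (simp add: gagliardo_quotient_def dq_def power_divide split: prod.split)

lemma dq_measurable [measurable]:
  assumes [measurable]: "u \<in> borel_measurable borel"
  shows "dq u \<in> borel_measurable borel"
  unfolding dq_def borel_prod[symmetric] by measurable

lemma X_space_iff:
  "u \<in> X_space \<longleftrightarrow> sqint lborel u \<and> sqint lborel (dq u) \<and> (AE x in lborel. x \<notin> {0<..<1} \<longrightarrow> u x = 0)"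
proof -
  have "gagliardo_quotient u = (\<lambda>z. (dq u z)\<^sup>2)" by (simp add: fun_eq_iff gagliardo_quotient_eq_dq)
  then show ?thesis
    by (auto simp: X_space_def H_half_def L2_fun_iff_sqint sqint_def)
qed

lemma X_borel: "u \<in> X_space \<Longrightarrow> u \<in> borel_measurable borel"
  and X_sqint: "u \<in> X_space \<Longrightarrow> sqint lborel u"
  and X_dq: "u \<in> X_space \<Longrightarrow> sqint lborel (dq u)"
  and X_AE: "u \<in> X_space \<Longrightarrow> AE x in lborel. x \<notin> {0<..<1} \<longrightarrow> u x = 0"
  by (auto simp: X_space_iff sqint_def)

lemma X_norm_sq_dq: "(X_norm u)\<^sup>2 = (LINT z|lborel. (dq u z)\<^sup>2)"
  by (simp add: X_norm_sq gagliardo_quotient_eq_dq)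

lemma X_inner_self: "X_inner u u = (X_norm u)\<^sup>2"
  by (simp add: X_inner_def X_norm_sq_dq flip: power2_eq_square)

lemma X_inner_commute: "X_inner u v = X_inner v u"
  by (simp add: X_inner_def mult.commute)

lemma dq_add: "dq (\<lambda>x. u x + v x) z = dq u z + dq v z"
  by (simp add: dq_def add_divide_distrib[symmetric] algebra_simps)

lemma dq_diff: "dq (\<lambda>x. u x - v x) z = dq u z - dq v z"
  by (simp add: dq_def diff_divide_distrib[symmetric] algebra_simps)

lemma dq_cmult: "dq (\<lambda>x. c * u x) z = c * dq u z"
  by (simp add: dq_def right_diff_distrib)

lemma dq_sum: "dq (\<lambda>x. \<Sum>i\<in>I. c i * b i x) z = (\<Sum>i\<in>I. c i * dq (b i) z)"
  by (simp add: dq_def sum_subtractf right_diff_distrib diff_divide_distrib sum_divide_distrib)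

lemma X_add: "u \<in> X_space \<Longrightarrow> v \<in> X_space \<Longrightarrow> (\<lambda>x. u x + v x) \<in> X_space"
  unfolding X_space_iff by (auto simp: sqint_add dq_add[abs_def])

lemma X_diff: "u \<in> X_space \<Longrightarrow> v \<in> X_space \<Longrightarrow> (\<lambda>x. u x - v x) \<in> X_space"
  unfolding X_space_iff by (auto simp: sqint_diff dq_diff[abs_def])

lemma X_cmult: "u \<in> X_space \<Longrightarrow> (\<lambda>x. c * u x) \<in> X_space"
  unfolding X_space_iff by (auto simp: sqint_cmult dq_cmult[abs_def])

lemma X_zero: "(\<lambda>_. 0) \<in> X_space"
  by (simp add: X_space_iff dq_def[abs_def])

lemma X_sum:
  assumes "\<And>i. i \<in> I \<Longrightarrow> b i \<in> X_space"
  shows "(\<lambda>x. \<Sum>i\<in>I. c i * b i x) \<in> X_space"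
proof (cases "finite I")
  case True
  then show ?thesis using assms
  proof (induction I)
    case empty show ?case by (simp add: X_zero)
  next
    case (insert i F)
    then have "(\<lambda>x. c i * b i x + (\<Sum>i\<in>F. c i * b i x)) \<in> X_space"
      by (intro X_add X_cmult) auto
    then show ?case using insert by simp
  qed
qed (simp add: X_zero)

lemma X_norm_cmult: "(X_norm (\<lambda>x. c * u x))\<^sup>2 = c\<^sup>2 * (X_norm u)\<^sup>2"
  by (simp add: X_norm_sq_dq dq_cmult power_mult_distrib)

lemma X_inner_cmult_left: "X_inner (\<lambda>x. c * u x) v = c * X_inner u v"
  by (simp add: X_inner_def dq_cmult mult.assoc)

lemma X_inner_sum_left:
  assumes "\<And>i. i \<in> I \<Longrightarrow> b i \<in> X_space" "v \<in> X_space"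
  shows "X_inner (\<lambda>x. \<Sum>i\<in>I. c i * b i x) v = (\<Sum>i\<in>I. c i * X_inner (b i) v)"
proof -
  have "integrable lborel (\<lambda>z. c i * (dq (b i) z * dq v z))" if "i \<in> I" for i
    using that assms by (intro integrable_mult_right sqint_mult_integrable X_dq)
  then show ?thesis
    by (simp add: X_inner_def dq_sum sum_distrib_right mult.assoc)
qed

lemma X_norm_add_sq:
  assumes "u \<in> X_space" "v \<in> X_space"
  shows "(X_norm (\<lambda>x. u x + v x))\<^sup>2 = (X_norm u)\<^sup>2 + 2 * X_inner u v + (X_norm v)\<^sup>2"
proof -
  note s = X_dq[OF assms(1)] X_dq[OF assms(2)]
  have "(X_norm (\<lambda>x. u x + v x))\<^sup>2 = (LINT z|lborel. (dq u z)\<^sup>2 + 2 * (dq u z * dq v z) + (dq v z)\<^sup>2)"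
    by (simp add: X_norm_sq_dq dq_add power2_sum algebra_simps)
  also have "\<dots> = (X_norm u)\<^sup>2 + 2 * X_inner u v + (X_norm v)\<^sup>2"
    using sqint_integrable_real[OF s(1)] sqint_integrable_real[OF s(2)] sqint_mult_integrable[OF s]
    by (simp add: X_norm_sq_dq X_inner_def)
  finally show ?thesis .
qed

lemma X_norm_diff_sq:
  assumes "u \<in> X_space" "v \<in> X_space"
  shows "(X_norm (\<lambda>x. u x - v x))\<^sup>2 = (X_norm u)\<^sup>2 - 2 * X_inner u v + (X_norm v)\<^sup>2"
  using X_norm_add_sq[OF assms(1) X_cmult[OF assms(2), of "-1"]]
    X_inner_cmult_left[of "-1" v u] X_norm_cmult[of "-1" v]
  by (simp add: X_inner_commute)

lemma X_norm_diff_sq_le: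
  assumes "u \<in> X_space" "v \<in> X_space"
  shows "(X_norm (\<lambda>x. u x - v x))\<^sup>2 \<le> 2 * (X_norm u)\<^sup>2 + 2 * (X_norm v)\<^sup>2"
  using X_norm_add_sq[OF assms] X_norm_diff_sq[OF assms] zero_le_power2[of "X_norm (\<lambda>x. u x + v x)"] by linarith

lemma L2_norm_frac_laplacian:
  assumes "u \<in> X_space"
  shows "L2_norm_on UNIV (frac_laplacian (1/4) u) = X_norm u / sqrt (2 * pi)"
  using X_space_has_frac_laplacian(2)[OF assms X_space_has_frac_laplacian(1)[OF assms]]
  by (simp add: L2_norm_on_def set_lebesgue_integral_def real_sqrt_divide)

text \<open>Polarization: the norm formula is used for u, v and u + v. For the sum the image
  inserted is the sum of the two chosen images, not the one chosen for u + v.\<close>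

lemma frac_laplacian_inner:
  assumes u: "u \<in> X_space" and v: "v \<in> X_space"
  shows "(LINT x|lborel. frac_laplacian (1/4) u x * frac_laplacian (1/4) v x) = X_inner u v / (2 * pi)"
proof -
  define a b where "a = frac_laplacian (1/4) u" and "b = frac_laplacian (1/4) v"
  note hu = X_space_has_frac_laplacian(1)[OF u, folded a_def]
  note hv = X_space_has_frac_laplacian(1)[OF v, folded b_def]
  have a: "sqint lborel a" and b: "sqint lborel b"
    using X_space_has_frac_laplacian(2)[OF u hu] X_space_has_frac_laplacian(2)[OF v hv] by auto
  note i = sqint_integrable_real[OF a] sqint_integrable_real[OF b] sqint_mult_integrable[OF a b]
  have "(X_norm (\<lambda>x. u x + v x))\<^sup>2 / (2 * pi) = (LINT x|lborel. (a x + b x)\<^sup>2)"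
    using X_space_has_frac_laplacian(2)[OF X_add[OF u v] has_frac_laplacian_add_diff(1)[OF hu hv]] by simp
  also have "\<dots> = (LINT x|lborel. (a x)\<^sup>2 + (b x)\<^sup>2 + 2 * (a x * b x))"
    by (simp add: power2_sum mult.assoc)
  also have "\<dots> = (LINT x|lborel. (a x)\<^sup>2) + (LINT x|lborel. (b x)\<^sup>2) + 2 * (LINT x|lborel. a x * b x)"
    using i by simp
  also have "\<dots> = (X_norm u)\<^sup>2 / (2 * pi) + (X_norm v)\<^sup>2 / (2 * pi) + 2 * (LINT x|lborel. a x * b x)"
    using X_space_has_frac_laplacian(2)[OF u hu] X_space_has_frac_laplacian(2)[OF v hv] by simp
  finally show ?thesis
    unfolding X_norm_add_sq[OF u v] a_def b_def by (simp add: field_simps)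
qed

text \<open>A normal contraction decreases the difference quotient at every pair of points;
  truncation and the absolute value are instances.\<close>

lemma X_Lipschitz_image:
  assumes u: "u \<in> X_space" and v: "v \<in> borel_measurable borel"
    and le: "\<And>x. \<bar>v x\<bar> \<le> \<bar>u x\<bar>" and lip: "\<And>x y. \<bar>v x - v y\<bar> \<le> \<bar>u x - u y\<bar>"
  shows "v \<in> X_space" "(X_norm v)\<^sup>2 \<le> (X_norm u)\<^sup>2"
proof -
  note [measurable] = X_borel[OF u] v
  have dq_le: "\<bar>dq v z\<bar> \<le> \<bar>dq u z\<bar>" for z
    using lip by (simp add: dq_def divide_right_mono)
  have dqv: "sqint lborel (dq v)"
    by (rule sqint_dominated[OF X_dq[OF u]]) (auto simp: dq_le)
  show "v \<in> X_space"
    unfolding X_space_iff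
  proof (intro conjI dqv)
    show "sqint lborel v" by (rule sqint_dominated[OF X_sqint[OF u]]) (auto simp: le)
    show "AE x in lborel. x \<notin> {0<..<1} \<longrightarrow> v x = 0"
      using X_AE[OF u] by eventually_elim (metis abs_le_zero_iff abs_zero le)
  qed
  show "(X_norm v)\<^sup>2 \<le> (X_norm u)\<^sup>2"
    unfolding X_norm_sq_dq
    using sqint_integrable_real[OF dqv] sqint_integrable_real[OF X_dq[OF u]]
    by (intro integral_mono) (auto simp: dq_le abs_le_square_iff[symmetric])
qed

section \<open>Truncation of elements of X\<close>

definition trunc :: "real \<Rightarrow> real \<Rightarrow> real" where
  "trunc k t = max (-k) (min k t)"

lemma X_trunc:
  assumes u: "u \<in> X_space" and k: "k \<ge> 0"
  shows "(\<lambda>x. trunc k (u x)) \<in> X_space" "(X_norm (\<lambda>x. trunc k (u x)))\<^sup>2 \<le> (X_norm u)\<^sup>2"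
    "(\<lambda>x. u x - trunc k (u x)) \<in> X_space"
proof -
  note [measurable] = X_borel[OF u]
  have m: "(\<lambda>x. trunc k (u x)) \<in> borel_measurable borel" unfolding trunc_def by measurable
  have 1: "\<bar>trunc k (u x)\<bar> \<le> \<bar>u x\<bar>" for x using k by (auto simp: trunc_def)
  have 2: "\<bar>trunc k (u x) - trunc k (u y)\<bar> \<le> \<bar>u x - u y\<bar>" for x y using k by (auto simp: trunc_def)
  show t: "(\<lambda>x. trunc k (u x)) \<in> X_space" by (rule X_Lipschitz_image(1)[OF u m 1 2])
  show "(X_norm (\<lambda>x. trunc k (u x)))\<^sup>2 \<le> (X_norm u)\<^sup>2" by (rule X_Lipschitz_image(2)[OF u m 1 2])
  show "(\<lambda>x. u x - trunc k (u x)) \<in> X_space" by (rule X_diff[OF u t])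
qed

text \<open>At each point the remainder vanishes as soon as n exceeds the value of u there, and
  being a contraction of u it has difference quotients dominated by those of u.\<close>

lemma X_norm_trunc_tendsto:
  assumes u: "u \<in> X_space"
  shows "(\<lambda>n. (X_norm (\<lambda>x. u x - trunc (real n) (u x)))\<^sup>2) \<longlonglongrightarrow> 0"
proof -
  define w where "w n x = u x - trunc (real n) (u x)" for n x
  have w: "w n \<in> X_space" for n unfolding w_def by (intro X_trunc u) simp
  note [measurable] = X_borel[OF u] X_borel[OF w]
  have ev: "\<forall>\<^sub>F n in sequentially. w n x = 0" for x
    using eventually_ge_at_top[of "nat \<lceil>\<bar>u x\<bar>\<rceil>"]
    by eventually_elim (auto simp: w_def trunc_def nat_le_iff ceiling_le_iff)
  have "(\<lambda>n. LINT z|lborel. (dq (w n) z)\<^sup>2) \<longlonglongrightarrow> integral\<^sup>L (lborel :: (real \<times> real) measure) (\<lambda>_. 0)"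
  proof (rule integral_dominated_convergence[where w = "\<lambda>z. (dq u z)\<^sup>2"])
    show "AE z in lborel. (\<lambda>n. (dq (w n) z)\<^sup>2) \<longlonglongrightarrow> 0"
    proof (intro AE_I2 tendsto_eventually)
      fix z :: "real \<times> real"
      show "\<forall>\<^sub>F n in sequentially. (dq (w n) z)\<^sup>2 = 0"
        using ev[of "fst z"] ev[of "snd z"] by eventually_elim (simp add: dq_def)
    qed
    show "AE z in lborel. norm ((dq (w n) z)\<^sup>2) \<le> (dq u z)\<^sup>2" for n
    proof (intro AE_I2)
      fix z
      have "\<bar>w n (fst z) - w n (snd z)\<bar> \<le> \<bar>u (fst z) - u (snd z)\<bar>" by (auto simp: w_def trunc_def)
      then have "\<bar>dq (w n) z\<bar> \<le> \<bar>dq u z\<bar>" by (simp add: dq_def divide_right_mono)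
      then show "norm ((dq (w n) z)\<^sup>2) \<le> (dq u z)\<^sup>2" by (simp add: abs_le_square_iff)
    qed
  qed (use sqint_integrable_real[OF X_dq[OF u]] in auto)
  then show ?thesis by (simp add: X_norm_sq_dq w_def[abs_def])
qed

subsection \<open>The unit interval\<close>

abbreviation I01 :: "real measure" where
  "I01 \<equiv> restrict_space lborel {0<..<1}"

lemma I01_prob: "prob_space I01"
  by (rule prob_spaceI) (simp add: space_restrict_space emeasure_restrict_space)

interpretation I01: prob_space I01
  by (rule I01_prob)

lemma I01_measurable [measurable (raw)]:
  "u \<in> borel_measurable borel \<Longrightarrow> u \<in> borel_measurable I01"
  by (simp add: measurable_restrict_space1)

lemma set_integrable_I01: "set_integrable lborel {0<..<1} f \<longleftrightarrow> integrable I01 f"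
  for f :: "real \<Rightarrow> real"
  by (simp add: set_integrable_def integrable_restrict_space)

lemma set_integral_I01: "(LBINT x:{0<..<1}. f x) = (LINT x|I01. f x)"
  for f :: "real \<Rightarrow> real"
  by (simp add: set_lebesgue_integral_def integral_restrict_space)

lemma AE_I01: "(AE x in lborel. P x) \<Longrightarrow> AE x in I01. P x"
  by (subst AE_restrict_space_iff) (auto elim: eventually_mono)

lemma sqint_I01: "sqint lborel u \<Longrightarrow> sqint I01 u" for u :: "real \<Rightarrow> real"
proof -
  assume u: "sqint lborel u"
  then have "sqint lborel (\<lambda>x. indicator {0<..<1} x *\<^sub>R u x)" by (rule sqint_truncation) auto
  moreover have "(norm (indicator {0<..<1} x *\<^sub>R u x))\<^sup>2 = indicator {0<..<1} x *\<^sub>R (norm (u x))\<^sup>2" for x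
    by (simp add: indicator_def)
  ultimately show "sqint I01 u"
    using u by (auto simp: sqint_def integrable_restrict_space measurable_restrict_space1)
qed

lemma X_sqint_I01: "u \<in> X_space \<Longrightarrow> sqint I01 u"
  by (simp add: X_sqint sqint_I01)

lemma X_L2_I01:
  assumes "u \<in> X_space"
  shows "(LINT x|lborel. (u x)\<^sup>2) = (LINT x|I01. (u x)\<^sup>2)"
proof -
  note [measurable] = X_borel[OF assms]
  have "(LINT x|lborel. (u x)\<^sup>2) = (LINT x|lborel. indicator {0<..<1} x *\<^sub>R (u x)\<^sup>2)"
    by (rule integral_cong_AE) (use X_AE[OF assms] in \<open>auto simp: indicator_def\<close>)
  then show ?thesis by (simp add: integral_restrict_space)
qed

text \<open>Scaling to unit norm reduces this to the definition of \<open>lambda1\<close> as an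
  infimum, the set being bounded below by 0. The sign of \<open>lambda1\<close> plays no part;
  positivity is obtained later from (ii) and (iii).\<close>

lemma lambda1_Poincare:
  assumes u: "u \<in> X_space"
  shows "lambda1 * (LINT x|I01. (u x)\<^sup>2) \<le> (X_norm u)\<^sup>2"
proof (cases "(LINT x|I01. (u x)\<^sup>2) = 0")
  case False
  define s where "s = sqrt (LINT x|I01. (u x)\<^sup>2)"
  have s: "s > 0" "s\<^sup>2 = (LINT x|I01. (u x)\<^sup>2)"
    using False Bochner_Integration.integral_nonneg[of I01 "\<lambda>x. (u x)\<^sup>2"] by (simp_all add: s_def order_less_le)
  define v where "v x = (1 / s) * u x" for x
  have v: "v \<in> X_space" unfolding v_def by (rule X_cmult[OF u])
  have "(LINT x|I01. (v x)\<^sup>2) = 1"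
    using s False by (simp add: v_def power_mult_distrib power_divide)
  then have "L2_norm_on {0<..<1} v = 1"
    by (simp add: L2_norm_on_def set_integral_I01)
  then have "lambda1 \<le> (X_norm v)\<^sup>2"
    unfolding lambda1_def by (intro cInf_lower bdd_belowI[of _ 0]) (use v in auto)
  also have "(X_norm v)\<^sup>2 = (X_norm u)\<^sup>2 / s\<^sup>2"
    unfolding v_def X_norm_cmult by (simp add: power_divide)
  finally have "lambda1 * s\<^sup>2 \<le> (X_norm u)\<^sup>2" using s(1) by (simp add: field_simps)
  then show ?thesis by (simp add: s(2))
qed simp

subsection \<open>Exponential integrability\<close>

text \<open>\<open>(X_norm u)\<^sup>2 \<le> 2 * pi\<close> is the normalization of the
  Trudinger-Moser inequality expressed in the norm of X. On the unit interval, of finite measure,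
  the exponential itself becomes integrable.\<close>

lemma Trudinger_Moser_X:
  assumes tm: "trudinger_moser_constant \<omega>" and \<beta>: "0 < \<beta>" "\<beta> < \<omega>"
  obtains H where "H > 0"
    "\<And>u. u \<in> X_space \<Longrightarrow> (X_norm u)\<^sup>2 \<le> 2 * pi \<Longrightarrow> integrable I01 (\<lambda>x. exp (\<beta> * (u x)\<^sup>2))"
    "\<And>u. u \<in> X_space \<Longrightarrow> (X_norm u)\<^sup>2 \<le> 2 * pi \<Longrightarrow>
       (LINT x|I01. exp (\<beta> * (u x)\<^sup>2) - 1) \<le> H * (LINT x|I01. (u x)\<^sup>2)"
proof -
  obtain H where H: "H > 0" and
    tm: "\<And>u. u \<in> H_half \<Longrightarrow> L2_norm_on UNIV (frac_laplacian (1/4) u) \<le> 1 \<Longrightarrow>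
           (\<integral>\<^sup>+ x. ennreal (exp (\<beta> * (u x)\<^sup>2) - 1) \<partial>lborel) \<le> ennreal (H * (L2_norm_on UNIV u)\<^sup>2)"
    using tm \<beta> unfolding trudinger_moser_constant_def by blast
  have main: "integrable I01 (\<lambda>x. exp (\<beta> * (u x)\<^sup>2)) \<and>
      (LINT x|I01. exp (\<beta> * (u x)\<^sup>2) - 1) \<le> H * (LINT x|I01. (u x)\<^sup>2)"
    if u: "u \<in> X_space" and le: "(X_norm u)\<^sup>2 \<le> 2 * pi" for u
  proof -
    note [measurable] = X_borel[OF u]
    have "X_norm u \<le> sqrt (2 * pi)" using le by (simp add: real_le_rsqrt)
    then have "L2_norm_on UNIV (frac_laplacian (1/4) u) \<le> 1"
      by (simp add: L2_norm_frac_laplacian[OF u])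
    moreover have "u \<in> H_half" using u by (simp add: X_space_def)
    ultimately have *: "(\<integral>\<^sup>+ x. ennreal (exp (\<beta> * (u x)\<^sup>2) - 1) \<partial>lborel) \<le> ennreal (H * (LINT x|lborel. (u x)\<^sup>2))"
      using tm[of u] by (simp add: L2_norm_on_def set_lebesgue_integral_def)
    have nn: "0 \<le> exp (\<beta> * (u x)\<^sup>2) - 1" for x using \<beta> by simp
    have int: "integrable lborel (\<lambda>x. exp (\<beta> * (u x)\<^sup>2) - 1)"
      by (rule integrableI_nonneg) (use nn * in \<open>auto intro: le_less_trans\<close>)
    have "ennreal (LINT x|lborel. exp (\<beta> * (u x)\<^sup>2) - 1) \<le> ennreal (H * (LINT x|lborel. (u x)\<^sup>2))"
      using * nn by (subst nn_integral_eq_integral[symmetric, OF int]) auto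
    then have le1: "(LINT x|lborel. exp (\<beta> * (u x)\<^sup>2) - 1) \<le> H * (LINT x|I01. (u x)\<^sup>2)"
      using H by (subst (asm) ennreal_le_iff) (auto simp: X_L2_I01[OF u])
    have i0: "integrable lborel (\<lambda>x. indicator {0<..<1} x *\<^sub>R (exp (\<beta> * (u x)\<^sup>2) - 1))"
      by (intro integrable_mult_indicator int) simp
    then have i1: "integrable I01 (\<lambda>x. exp (\<beta> * (u x)\<^sup>2) - 1)" by (simp add: integrable_restrict_space)
    have "(LINT x|I01. exp (\<beta> * (u x)\<^sup>2) - 1) = (LINT x|lborel. indicator {0<..<1} x *\<^sub>R (exp (\<beta> * (u x)\<^sup>2) - 1))"
      by (simp add: integral_restrict_space)
    also have "\<dots> \<le> (LINT x|lborel. exp (\<beta> * (u x)\<^sup>2) - 1)"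
      using nn by (intro integral_mono i0 int) (auto simp: indicator_def)
    finally have "(LINT x|I01. exp (\<beta> * (u x)\<^sup>2) - 1) \<le> H * (LINT x|I01. (u x)\<^sup>2)" using le1 by linarith
    moreover have "integrable I01 (\<lambda>x. exp (\<beta> * (u x)\<^sup>2))"
      using Bochner_Integration.integrable_add[OF i1, of "\<lambda>_. 1"] by simp
    ultimately show ?thesis by blast
  qed
  show thesis by (rule that[OF H]) (use main in blast)+
qed

text \<open>Arbitrary exponents are possible for a single u: a high truncation is bounded, and the
  remainder has so small a norm that a large multiple of it still satisfies the Trudinger-Moser
  normalization.\<close>

lemma X_exp_integrable:
  assumes tm: "trudinger_moser_constant \<omega>" and u: "u \<in> X_space"
  shows "integrable I01 (\<lambda>x. exp (a * (u x)\<^sup>2))"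
proof -
  note [measurable] = X_borel[OF u]
  have \<omega>: "\<omega> > 0" using tm by (simp add: trudinger_moser_constant_def)
  then have "0 < \<omega> / 2" "\<omega> / 2 < \<omega>" by auto
  from Trudinger_Moser_X[OF tm this] obtain H where
    TM: "\<And>u. u \<in> X_space \<Longrightarrow> (X_norm u)\<^sup>2 \<le> 2 * pi \<Longrightarrow> integrable I01 (\<lambda>x. exp (\<omega> / 2 * (u x)\<^sup>2))" by blast
  \<comment> \<open>Makes \<open>\<omega> / 2 * c = 2 * (\<bar>a\<bar> + 1)\<close>, the coefficient
    left for the squared remainder after splitting the square of u.\<close>
  define c where "c = 4 * (\<bar>a\<bar> + 1) / \<omega>"
  have c: "c > 0" using \<omega> by (simp add: c_def)
  have "(\<lambda>n. c * (X_norm (\<lambda>x. u x - trunc (real n) (u x)))\<^sup>2) \<longlonglongrightarrow> c * 0"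
    by (intro tendsto_intros X_norm_trunc_tendsto u)
  then have "\<forall>\<^sub>F n in sequentially. c * (X_norm (\<lambda>x. u x - trunc (real n) (u x)))\<^sup>2 < 2 * pi"
    by (intro order_tendstoD(2)) auto
  then obtain n where n: "c * (X_norm (\<lambda>x. u x - trunc (real n) (u x)))\<^sup>2 < 2 * pi"
    by (auto simp: eventually_sequentially)
  define w where "w x = sqrt c * (u x - trunc (real n) (u x))" for x
  have w: "w \<in> X_space" unfolding w_def by (intro X_cmult X_trunc u) simp
  have "(X_norm w)\<^sup>2 \<le> 2 * pi" unfolding w_def X_norm_cmult using n c by simp
  from TM[OF w this] have i: "integrable I01 (\<lambda>x. exp (2 * (\<bar>a\<bar> + 1) * (real n)\<^sup>2) * exp (\<omega> / 2 * (w x)\<^sup>2))"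
    by (rule integrable_mult_right)
  show ?thesis
  proof (rule Bochner_Integration.integrable_bound[OF i])
    show "AE x in I01. norm (exp (a * (u x)\<^sup>2)) \<le> norm (exp (2 * (\<bar>a\<bar> + 1) * (real n)\<^sup>2) * exp (\<omega> / 2 * (w x)\<^sup>2))"
    proof (intro AE_I2)
      fix x
      have t: "\<bar>trunc (real n) (u x)\<bar> \<le> real n" by (auto simp: trunc_def)
      have "(u x)\<^sup>2 \<le> 2 * (trunc (real n) (u x))\<^sup>2 + 2 * (u x - trunc (real n) (u x))\<^sup>2"
        using norm_add_sq_le[of "trunc (real n) (u x)" "u x - trunc (real n) (u x)"] by simp
      also have "\<dots> \<le> 2 * (real n)\<^sup>2 + 2 * (u x - trunc (real n) (u x))\<^sup>2"
        using power_mono[OF t, of 2] by simp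
      finally have *: "(u x)\<^sup>2 \<le> 2 * (real n)\<^sup>2 + 2 * (u x - trunc (real n) (u x))\<^sup>2" .
      have "a * (u x)\<^sup>2 \<le> (\<bar>a\<bar> + 1) * (u x)\<^sup>2" by (intro mult_right_mono) auto
      also have "\<dots> \<le> (\<bar>a\<bar> + 1) * (2 * (real n)\<^sup>2 + 2 * (u x - trunc (real n) (u x))\<^sup>2)"
        by (intro mult_left_mono *) simp
      also have "\<dots> = 2 * (\<bar>a\<bar> + 1) * (real n)\<^sup>2 + \<omega> / 2 * (w x)\<^sup>2"
      proof -
        have "(w x)\<^sup>2 = c * (u x - trunc (real n) (u x))\<^sup>2" using c by (simp add: w_def power_mult_distrib)
        then have "\<omega> / 2 * (w x)\<^sup>2 = 2 * (\<bar>a\<bar> + 1) * (u x - trunc (real n) (u x))\<^sup>2"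
          using \<omega> by (simp add: c_def)
        then show ?thesis by (simp add: algebra_simps)
      qed
      finally show "norm (exp (a * (u x)\<^sup>2)) \<le> norm (exp (2 * (\<bar>a\<bar> + 1) * (real n)\<^sup>2) * exp (\<omega> / 2 * (w x)\<^sup>2))"
        by (simp add: exp_add[symmetric])
    qed
  qed measurable
qed

subsection \<open>Compactness in \<open>L\<^sup>2\<close>\<close>

text \<open>A partition into half-open intervals of length 1 / n, written without division. The
  integrals over n cells determine an element of X in \<open>L\<^sup>2\<close> up to an error of
  order 1 / n controlled by the norm of X, which is the mechanism behind both compactness and
  separability.\<close>

definition cell :: "nat \<Rightarrow> nat \<Rightarrow> real set" where
  "cell n i = {x. real i \<le> real n * x \<and> real n * x < real i + 1}"

definition cell_int :: "(real \<Rightarrow> real) \<Rightarrow> nat \<Rightarrow> nat \<Rightarrow> real" where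
  "cell_int w n i = (LINT x|lborel. indicator (cell n i) x * w x)"

lemma cell_eq: "n > 0 \<Longrightarrow> cell n i = {real i / real n..<(real i + 1) / real n}"
  by (auto simp: cell_def field_simps)

lemma cell_borel [measurable]: "cell n i \<in> sets borel"
  unfolding cell_def by measurable

lemma cell_disjoint: "x \<in> cell n i \<Longrightarrow> x \<in> cell n j \<Longrightarrow> i = j"
  by (auto simp: cell_def)

lemma cell_integrable: "n > 0 \<Longrightarrow> integrable lborel (indicator (cell n i) :: real \<Rightarrow> real)"
  by (simp add: cell_eq divide_right_mono)

lemma cell_measure: "n > 0 \<Longrightarrow> (LINT x|lborel. indicator (cell n i) x) = 1 / real n"
  by (simp add: cell_eq divide_right_mono add_divide_distrib)

lemma cell_cover:
  assumes "n > 0" "x \<in> {0<..<1}"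
  shows "\<exists>i<n. x \<in> cell n i"
proof (intro exI conjI)
  have "0 \<le> real n * x" "real n * x < real n" using assms by auto
  then show "nat \<lfloor>real n * x\<rfloor> < n" "x \<in> cell n (nat \<lfloor>real n * x\<rfloor>)"
    by (auto simp: cell_def) linarith+
qed

text \<open>On each cell the variance identity
  \<open>\<integral>\<integral> (w x - w y)\<^sup>2 = 2 * l * \<integral> w\<^sup>2 - 2 * (\<integral> w)\<^sup>2\<close> holds, where \<open>l = 1 / n\<close> is the length of the cell, and
  \<open>(w x - w y)\<^sup>2 \<le> l\<^sup>2 * (dq w (x, y))\<^sup>2\<close>.\<close>

lemma L2_le_cell_integrals:
  assumes w: "w \<in> X_space" and n: "n > 0"
  shows "(LINT x|I01. (w x)\<^sup>2) \<le> real n * (\<Sum>i<n. (cell_int w n i)\<^sup>2) + (X_norm w)\<^sup>2 / (2 * real n)"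
proof -
  note [measurable] = X_borel[OF w]
  have wi: "integrable lborel (\<lambda>x. (w x)\<^sup>2)" by (rule sqint_integrable_real[OF X_sqint[OF w]])
  define G where "G i z = indicator (cell n i) (fst z) * indicator (cell n i) (snd z) * (dq w z)\<^sup>2" for i z
  have G_int: "integrable lborel (G i)" for i
  proof (rule Bochner_Integration.integrable_bound[OF sqint_integrable_real[OF X_dq[OF w]]])
    have [measurable]: "dq w \<in> borel_measurable (borel \<Otimes>\<^sub>M borel)"
      unfolding borel_prod by measurable
    show "G i \<in> borel_measurable lborel" unfolding G_def by (simp add: borel_prod[symmetric])
  qed (auto simp: G_def indicator_def)
  have loc: "(LINT x|lborel. indicator (cell n i) x * (w x)\<^sup>2)
      \<le> real n * (cell_int w n i)\<^sup>2 + (LINT z|lborel. G i z) / (2 * real n)" for i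
  proof -
    let ?J = "indicator (cell n i) :: real \<Rightarrow> real"
    have Ji: "integrable lborel ?J" by (rule cell_integrable[OF n])
    have Jw2: "integrable lborel (\<lambda>x. ?J x * (w x)\<^sup>2)"
      using integrable_mult_indicator[OF _ wi, of "cell n i"] by simp
    have Jw: "integrable lborel (\<lambda>x. ?J x * w x)"
    proof (rule Bochner_Integration.integrable_bound[OF Bochner_Integration.integrable_add[OF Ji Jw2]])
      show "AE x in lborel. norm (?J x * w x) \<le> norm (?J x + ?J x * (w x)\<^sup>2)"
      proof (intro AE_I2)
        fix x
        have "\<bar>w x\<bar> \<le> 1 + (w x)\<^sup>2"
          using zero_le_power2[of "\<bar>w x\<bar> - 1"] by (simp add: power2_eq_square algebra_simps)
        then show "norm (?J x * w x) \<le> norm (?J x + ?J x * (w x)\<^sup>2)" by (simp add: indicator_def)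
      qed
    qed measurable
    have bound: "?J x * ?J y * (w x - w y)\<^sup>2 \<le> (1 / real n)\<^sup>2 * G i (x, y)" for x y
    proof (cases "x \<in> cell n i \<and> y \<in> cell n i \<and> x \<noteq> y")
      case True
      then have "\<bar>real n * x - real n * y\<bar> \<le> 1" by (auto simp: cell_def)
      then have "real n * \<bar>x - y\<bar> \<le> 1" using n by (simp add: abs_mult flip: right_diff_distrib)
      then have le: "\<bar>x - y\<bar> \<le> 1 / real n" using n by (simp add: field_simps)
      have "(w x - w y)\<^sup>2 = \<bar>x - y\<bar>\<^sup>2 * (dq w (x, y))\<^sup>2" using True by (simp add: dq_def power_divide)
      also have "\<dots> \<le> (1 / real n)\<^sup>2 * (dq w (x, y))\<^sup>2"
        using power_mono[OF le, of 2] by (intro mult_right_mono) auto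
      finally show ?thesis using True by (simp add: G_def)
    next
      case False
      then show ?thesis by (auto simp: G_def indicator_def)
    qed
    have G_fst: "integrable lborel (\<lambda>x. LINT y|lborel. G i (x, y))"
      "(LINT x|lborel. LINT y|lborel. G i (x, y)) = (LINT z|lborel. G i z)"
      "AE x in lborel. integrable lborel (\<lambda>y. G i (x, y))"
      using G_int[of i] lborel_pair.integrable_fst'[of "G i"] lborel_pair.integral_fst'[of "G i"]
        lborel_pair.AE_integrable_fst'[of "G i"] by (simp_all add: lborel_prod)
    have inner: "(LINT y|lborel. ?J x * ?J y * (w x - w y)\<^sup>2)
        = ?J x * ((w x)\<^sup>2 / real n - 2 * w x * cell_int w n i + (LINT y|lborel. ?J y * (w y)\<^sup>2))" for x
    proof -
      have "(LINT y|lborel. ?J x * ?J y * (w x - w y)\<^sup>2)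
          = (LINT y|lborel. ?J x * ((w x)\<^sup>2 * ?J y - 2 * w x * (?J y * w y) + ?J y * (w y)\<^sup>2))"
        by (intro Bochner_Integration.integral_cong refl) (simp add: power2_eq_square algebra_simps)
      also have "\<dots> = ?J x * (LINT y|lborel. (w x)\<^sup>2 * ?J y - 2 * w x * (?J y * w y) + ?J y * (w y)\<^sup>2)"
        by (rule integral_mult_right_zero)
      also have "(LINT y|lborel. (w x)\<^sup>2 * ?J y - 2 * w x * (?J y * w y) + ?J y * (w y)\<^sup>2)
          = (w x)\<^sup>2 / real n - 2 * w x * cell_int w n i + (LINT y|lborel. ?J y * (w y)\<^sup>2)"
        using Ji Jw Jw2 cell_measure[OF n, of i] by (simp add: cell_int_def)
      finally show ?thesis .
    qed
    define m2 where "m2 = (LINT y|lborel. ?J y * (w y)\<^sup>2)"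
    have outer_eq: "?J x * ((w x)\<^sup>2 / real n - 2 * w x * cell_int w n i + m2)
        = (1 / real n) * (?J x * (w x)\<^sup>2) - 2 * cell_int w n i * (?J x * w x) + m2 * ?J x" for x
      by (simp add: algebra_simps)
    have outer_int: "integrable lborel (\<lambda>x. ?J x * ((w x)\<^sup>2 / real n - 2 * w x * cell_int w n i + m2))"
      unfolding outer_eq using Ji Jw Jw2 by simp
    have "(LINT x|lborel. ?J x * ((w x)\<^sup>2 / real n - 2 * w x * cell_int w n i + m2))
        = (1 / real n) * m2 - 2 * cell_int w n i * cell_int w n i + m2 * (1 / real n)"
      unfolding outer_eq using Ji Jw Jw2 cell_measure[OF n, of i] by (simp add: m2_def cell_int_def)
    moreover have "(LINT x|lborel. ?J x * ((w x)\<^sup>2 / real n - 2 * w x * cell_int w n i + m2))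
        \<le> (LINT x|lborel. (1 / real n)\<^sup>2 * (LINT y|lborel. G i (x, y)))"
    proof (rule integral_mono_AE[OF outer_int])
      show "integrable lborel (\<lambda>x. (1 / real n)\<^sup>2 * (LINT y|lborel. G i (x, y)))"
        by (intro integrable_mult_right G_fst)
      show "AE x in lborel. ?J x * ((w x)\<^sup>2 / real n - 2 * w x * cell_int w n i + m2)
          \<le> (1 / real n)\<^sup>2 * (LINT y|lborel. G i (x, y))"
        using G_fst(3)
      proof eventually_elim
        fix x assume Gx: "integrable lborel (\<lambda>y. G i (x, y))"
        have "?J x * ((w x)\<^sup>2 / real n - 2 * w x * cell_int w n i + m2) = (LINT y|lborel. ?J x * ?J y * (w x - w y)\<^sup>2)"
          unfolding inner m2_def ..
        also have "\<dots> \<le> (LINT y|lborel. (1 / real n)\<^sup>2 * G i (x, y))"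
        proof (intro integral_mono bound integrable_mult_right Gx)
          show "integrable lborel (\<lambda>y. ?J x * ?J y * (w x - w y)\<^sup>2)"
          proof (rule Bochner_Integration.integrable_bound[OF integrable_mult_right[OF Gx, of "(1 / real n)\<^sup>2"]])
            show "AE y in lborel. norm (?J x * ?J y * (w x - w y)\<^sup>2) \<le> norm ((1 / real n)\<^sup>2 * G i (x, y))"
            proof (intro AE_I2)
              fix y
              have "0 \<le> ?J x * ?J y * (w x - w y)\<^sup>2" by simp
              then show "norm (?J x * ?J y * (w x - w y)\<^sup>2) \<le> norm ((1 / real n)\<^sup>2 * G i (x, y))"
                using bound[of x y] by (simp only: real_norm_def)
            qed
          qed measurable
        qed
        finally show "?J x * ((w x)\<^sup>2 / real n - 2 * w x * cell_int w n i + m2)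
          \<le> (1 / real n)\<^sup>2 * (LINT y|lborel. G i (x, y))" by simp
      qed
    qed
    ultimately have "(1 / real n) * m2 - 2 * cell_int w n i * cell_int w n i + m2 * (1 / real n)
        \<le> (1 / real n)\<^sup>2 * (LINT z|lborel. G i z)"
      using G_fst(2) by simp
    then have "2 * m2 / real n \<le> 2 * (cell_int w n i)\<^sup>2 + (1 / real n)\<^sup>2 * (LINT z|lborel. G i z)"
      by (simp add: power2_eq_square)
    then have "real n / 2 * (2 * m2 / real n) \<le> real n / 2 * (2 * (cell_int w n i)\<^sup>2 + (1 / real n)\<^sup>2 * (LINT z|lborel. G i z))"
      by (rule mult_left_mono) simp
    also have "\<dots> = real n * (cell_int w n i)\<^sup>2 + (LINT z|lborel. G i z) / (2 * real n)"
      using n by (simp add: power2_eq_square field_simps)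
    finally show ?thesis using n unfolding m2_def[symmetric] by simp
  qed
  have Jw2: "integrable lborel (\<lambda>x. indicator (cell n i) x * (w x)\<^sup>2)" for i
    using integrable_mult_indicator[OF _ wi, of "cell n i"] by simp
  have "(LINT x|I01. (w x)\<^sup>2) = (LINT x|lborel. indicator {0<..<1} x * (w x)\<^sup>2)"
    by (simp add: integral_restrict_space)
  also have "\<dots> \<le> (LINT x|lborel. (\<Sum>i<n. indicator (cell n i) x * (w x)\<^sup>2))"
  proof (intro integral_mono Bochner_Integration.integrable_sum Jw2)
    show "integrable lborel (\<lambda>x. indicator {0<..<1} x * (w x)\<^sup>2)"
      using integrable_mult_indicator[OF _ wi, of "{0<..<1}"] by simp
    fix x
    show "indicator {0<..<1} x * (w x)\<^sup>2 \<le> (\<Sum>i<n. indicator (cell n i) x * (w x)\<^sup>2)"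
    proof (cases "x \<in> {0<..<1}")
      case True
      then obtain j where j: "j < n" "x \<in> cell n j" using cell_cover[OF n] by blast
      then show ?thesis
        using member_le_sum[of j "{..<n}" "\<lambda>i. indicator (cell n i) x * (w x)\<^sup>2"] True by simp
    qed (simp add: sum_nonneg)
  qed
  also have "\<dots> = (\<Sum>i<n. LINT x|lborel. indicator (cell n i) x * (w x)\<^sup>2)"
    by (rule Bochner_Integration.integral_sum) (rule Jw2)
  also have "\<dots> \<le> (\<Sum>i<n. real n * (cell_int w n i)\<^sup>2 + (LINT z|lborel. G i z) / (2 * real n))"
    by (intro sum_mono loc)
  also have "\<dots> = real n * (\<Sum>i<n. (cell_int w n i)\<^sup>2) + (LINT z|lborel. (\<Sum>i<n. G i z)) / (2 * real n)"
    using G_int by (simp add: sum.distrib sum_distrib_left sum_divide_distrib)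
  also have "\<dots> \<le> real n * (\<Sum>i<n. (cell_int w n i)\<^sup>2) + (X_norm w)\<^sup>2 / (2 * real n)"
  proof (intro add_left_mono divide_right_mono)
    show "(LINT z|lborel. (\<Sum>i<n. G i z)) \<le> (X_norm w)\<^sup>2"
      unfolding X_norm_sq_dq
    proof (intro integral_mono Bochner_Integration.integrable_sum G_int sqint_integrable_real X_dq w)
      fix z
      \<comment> \<open>The squares formed by a cell with itself are disjoint, so at most one
        summand is nonzero at z.\<close>
      show "(\<Sum>i<n. G i z) \<le> (dq w z)\<^sup>2"
      proof (cases "\<exists>j<n. fst z \<in> cell n j")
        case True
        then obtain j where j: "j < n" "fst z \<in> cell n j" by blast
        then have "G i z = 0" if "i \<noteq> j" for i using that cell_disjoint by (auto simp: G_def indicator_def)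
        then have "(\<Sum>i<n. G i z) = (\<Sum>i\<in>{j}. G i z)" using j(1) by (intro sum.mono_neutral_right) auto
        also have "\<dots> \<le> (dq w z)\<^sup>2" by (simp add: G_def indicator_def)
        finally show ?thesis .
      next
        case False
        then have "(\<Sum>i<n. G i z) = 0" by (intro sum.neutral) (auto simp: G_def indicator_def)
        then show ?thesis by simp
      qed
    qed
  qed simp
  finally show ?thesis .
qed

lemma cell_int_integrable:
  assumes "u \<in> X_space" "n > 0"
  shows "integrable lborel (\<lambda>x. indicator (cell n i) x * u x)"
    and "\<bar>cell_int u n i\<bar> \<le> 1 / real n + (LINT x|I01. (u x)\<^sup>2)"
proof -
  note [measurable] = X_borel[OF assms(1)]
  let ?J = "indicator (cell n i) :: real \<Rightarrow> real"
  have Ji: "integrable lborel ?J" by (rule cell_integrable[OF assms(2)])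
  note u2 = sqint_integrable_real[OF X_sqint[OF assms(1)]]
  have le: "\<bar>?J x * u x\<bar> \<le> ?J x + (u x)\<^sup>2" for x
  proof -
    have "\<bar>u x\<bar> \<le> 1 + (u x)\<^sup>2"
      using zero_le_power2[of "\<bar>u x\<bar> - 1"] by (simp add: power2_eq_square algebra_simps)
    then show ?thesis by (simp add: indicator_def)
  qed
  show i: "integrable lborel (\<lambda>x. ?J x * u x)"
    by (rule Bochner_Integration.integrable_bound[OF Bochner_Integration.integrable_add[OF Ji u2]])
      (use le in \<open>auto intro: order_trans[OF _ abs_ge_self]\<close>)
  have "\<bar>cell_int u n i\<bar> \<le> (LINT x|lborel. \<bar>?J x * u x\<bar>)"
    unfolding cell_int_def by (rule integral_abs_bound)
  also have "\<dots> \<le> (LINT x|lborel. ?J x + (u x)\<^sup>2)"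
    using i Ji u2 by (intro integral_mono le) auto
  also have "\<dots> = 1 / real n + (LINT x|I01. (u x)\<^sup>2)"
    by (simp only: Bochner_Integration.integral_add[OF Ji u2] cell_measure[OF assms(2)] X_L2_I01[OF assms(1)])
  finally show "\<bar>cell_int u n i\<bar> \<le> 1 / real n + (LINT x|I01. (u x)\<^sup>2)" .
qed

lemma cell_int_diff:
  assumes "u \<in> X_space" "v \<in> X_space" "n > 0"
  shows "cell_int (\<lambda>x. u x - v x) n i = cell_int u n i - cell_int v n i"
  using cell_int_integrable(1)[OF assms(1,3)] cell_int_integrable(1)[OF assms(2,3)]
  by (simp add: cell_int_def right_diff_distrib)

text \<open>Tychonoff's theorem. Points are sequences, so bounds that are 0 from some index on give
  finite-dimensional boxes of every dimension within one type.\<close>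

lemma compact_box:
  fixes C :: "nat \<Rightarrow> real"
  shows "compact {f. \<forall>i. \<bar>f i\<bar> \<le> C i}"
proof -
  have "compactin (product_topology (\<lambda>_. euclidean) UNIV) (PiE UNIV (\<lambda>i. {-C i..C i}))"
    by (subst compactin_PiE) auto
  moreover have "PiE UNIV (\<lambda>i. {-C i..C i}) = {f. \<forall>i. \<bar>f i\<bar> \<le> C i}"
    by (auto simp: PiE_def Pi_def abs_le_iff) (metis minus_le_iff)+
  ultimately show ?thesis by (simp add: euclidean_product_topology)
qed

lemma tendsto_component:
  fixes f :: "'b \<Rightarrow> nat \<Rightarrow> real"
  assumes "(f \<longlongrightarrow> l) F" shows "((\<lambda>k. f k i) \<longlongrightarrow> l i) F"
  by (rule continuous_on_tendsto_compose[OF continuous_on_product_coordinates assms]) auto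

text \<open>Sequential compactness of a box in the countable product replaces the explicit diagonal
  argument.\<close>

lemma diagonal_subsequence:
  fixes a :: "nat \<Rightarrow> nat \<Rightarrow> real"
  assumes "\<And>k i. \<bar>a k i\<bar> \<le> C i"
  obtains r where "strict_mono (r :: nat \<Rightarrow> nat)" "\<And>i. convergent (\<lambda>k. a (r k) i)"
proof -
  have "seq_compact {f :: nat \<Rightarrow> real. \<forall>i. \<bar>f i\<bar> \<le> C i}"
    using compact_box by (simp add: compact_eq_seq_compact_metric)
  then obtain l r where "strict_mono (r :: nat \<Rightarrow> nat)" "(a \<circ> r) \<longlonglongrightarrow> l"
    using assms unfolding seq_compact_def by (auto dest!: spec[of _ a])
  then show thesis
    using that tendsto_component[of "a \<circ> r" l sequentially] by (force simp: convergent_def)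
qed

text \<open>Along a subsequence all cell integrals converge. For a fine partition the estimate by
  cell integrals then makes the subsequence Cauchy in \<open>L\<^sup>2\<close>, and Fatou's lemma
  keeps the limit in X.\<close>

lemma X_Rellich:
  assumes u: "\<And>k. u k \<in> X_space" and B: "\<And>k. (X_norm (u k))\<^sup>2 \<le> B" and C: "\<And>k. (LINT x|I01. (u k x)\<^sup>2) \<le> C"
  obtains v r where "v \<in> X_space" "strict_mono (r :: nat \<Rightarrow> nat)" "AE x in lborel. (\<lambda>k. u (r k) x) \<longlonglongrightarrow> v x"
    "(\<lambda>k. LINT x|I01. (u (r k) x - v x)\<^sup>2) \<longlonglongrightarrow> 0"
proof -
  \<comment> \<open>All pairs of partition and cell are coded in one index; \<open>Suc n\<close>
    excludes the partition into 0 cells.\<close>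
  define a where "a k p = (case prod_decode p of (n, i) \<Rightarrow> cell_int (u k) (Suc n) i)" for k p
  have "\<bar>a k p\<bar> \<le> 1 + C" for k p
  proof -
    obtain n i where p: "prod_decode p = (n, i)" by fastforce
    have "\<bar>a k p\<bar> \<le> 1 / real (Suc n) + (LINT x|I01. (u k x)\<^sup>2)"
      unfolding a_def p using cell_int_integrable(2)[OF u, of "Suc n" k i] by simp
    also have "\<dots> \<le> 1 + C" using C[of k] by (intro add_mono) auto
    finally show ?thesis .
  qed
  then obtain r where r: "strict_mono (r :: nat \<Rightarrow> nat)" "\<And>p. convergent (\<lambda>k. a (r k) p)"
    using diagonal_subsequence[of a "\<lambda>_. 1 + C"] by blast
  have conv: "Cauchy (\<lambda>k. cell_int (u (r k)) (Suc n) i)" for n i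
    using r(2)[of "prod_encode (n, i)"] by (simp add: a_def Cauchy_convergent_iff)
  have sq: "sqint lborel (u (r k))" for k by (rule X_sqint[OF u])
  have Cau: "\<exists>N. \<forall>m\<ge>N. \<forall>n\<ge>N. (LINT x|lborel. (norm (u (r m) x - u (r n) x))\<^sup>2) < e" if e: "e > 0" for e
  proof -
    obtain n where n: "4 * B / e < real (Suc n)" by (meson reals_Archimedean2 lessI less_trans of_nat_less_iff)
    then have Bn: "4 * B / (2 * real (Suc n)) < e / 2" using e by (simp add: field_simps del: of_nat_Suc)
    define s where "s k l = real (Suc n) * (\<Sum>i<Suc n. (cell_int (u (r k)) (Suc n) i - cell_int (u (r l)) (Suc n) i)\<^sup>2)" for k l
    \<comment> \<open>The threshold is such that the squares of \<open>Suc n\<close> cell integrals,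
      weighted by \<open>Suc n\<close>, add up to at most e / 2.\<close>
    have "\<exists>N. \<forall>k\<ge>N. \<forall>l\<ge>N. \<forall>i<Suc n. \<bar>cell_int (u (r k)) (Suc n) i - cell_int (u (r l)) (Suc n) i\<bar> < sqrt (e / (2 * (real (Suc n))\<^sup>2))"
    proof -
      let ?d = "sqrt (e / (2 * (real (Suc n))\<^sup>2))"
      have d: "?d > 0" using e by simp
      have "\<forall>i. \<exists>N. \<forall>k\<ge>N. \<forall>l\<ge>N. \<bar>cell_int (u (r k)) (Suc n) i - cell_int (u (r l)) (Suc n) i\<bar> < ?d"
        using conv d unfolding Cauchy_def dist_real_def by blast
      then obtain N where N: "\<And>i k l. k \<ge> N i \<Longrightarrow> l \<ge> N i \<Longrightarrow> \<bar>cell_int (u (r k)) (Suc n) i - cell_int (u (r l)) (Suc n) i\<bar> < ?d"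
        by metis
      have "N i \<le> Max (N ` {..<Suc n})" if "i < Suc n" for i using that by (intro Max_ge) auto
      then show ?thesis using N by (intro exI[of _ "Max (N ` {..<Suc n})"]) (meson order_trans)
    qed
    then obtain N where N: "\<And>k l i. k \<ge> N \<Longrightarrow> l \<ge> N \<Longrightarrow> i < Suc n \<Longrightarrow>
        \<bar>cell_int (u (r k)) (Suc n) i - cell_int (u (r l)) (Suc n) i\<bar> < sqrt (e / (2 * (real (Suc n))\<^sup>2))" by blast
    have "(LINT x|lborel. (norm (u (r k) x - u (r l) x))\<^sup>2) < e" if "k \<ge> N" "l \<ge> N" for k l
    proof -
      define w where "w x = u (r k) x - u (r l) x" for x
      have w: "w \<in> X_space" unfolding w_def by (intro X_diff u)
      have "(cell_int w (Suc n) i)\<^sup>2 \<le> e / (2 * (real (Suc n))\<^sup>2)" if i: "i < Suc n" for i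
      proof -
        have "\<bar>cell_int w (Suc n) i\<bar> \<le> sqrt (e / (2 * (real (Suc n))\<^sup>2))"
          unfolding w_def cell_int_diff[OF u u zero_less_Suc] using N[OF \<open>k \<ge> N\<close> \<open>l \<ge> N\<close> i] by simp
        from power_mono[OF this, of 2] show ?thesis using e by simp
      qed
      then have "(\<Sum>i<Suc n. (cell_int w (Suc n) i)\<^sup>2) \<le> (\<Sum>i<Suc n. e / (2 * (real (Suc n))\<^sup>2))"
        by (intro sum_mono) simp
      then have s1: "real (Suc n) * (\<Sum>i<Suc n. (cell_int w (Suc n) i)\<^sup>2) \<le> e / 2"
        by (simp add: power2_eq_square field_simps del: of_nat_Suc sum.lessThan_Suc)
      have "(X_norm w)\<^sup>2 \<le> 4 * B" unfolding w_def using X_norm_diff_sq_le[OF u u, of "r k" "r l"] B[of "r k"] B[of "r l"] by linarith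
      then have s2: "(X_norm w)\<^sup>2 / (2 * real (Suc n)) < e / 2"
        using Bn by (meson divide_right_mono le_less_trans mult_nonneg_nonneg of_nat_0_le_iff zero_le_numeral)
      have "(LINT x|lborel. (w x)\<^sup>2) < e"
        unfolding X_L2_I01[OF w] using L2_le_cell_integrals[OF w zero_less_Suc[of n]] s1 s2 by linarith
      then show ?thesis by (simp add: w_def)
    qed
    then show ?thesis by blast
  qed
  obtain v0 r' where v0: "sqint lborel v0" and r': "strict_mono (r' :: nat \<Rightarrow> nat)"
    and ae0: "AE x in lborel. (\<lambda>k. u (r (r' k)) x) \<longlonglongrightarrow> v0 x"
    and lim0: "(\<lambda>n. LINT x|lborel. (norm (u (r n) x - v0 x))\<^sup>2) \<longlonglongrightarrow> 0"
    using sqint_complete[OF sq Cau] by blast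
  note [measurable] = X_borel[OF u]
  have [measurable]: "v0 \<in> borel_measurable borel" using v0 by (simp add: sqint_def)
  have dqae: "AE z in lborel. (\<lambda>k. (dq (u (r (r' k))) z)\<^sup>2) \<longlonglongrightarrow> (dq v0 z)\<^sup>2"
    using AE_lborel_pair[OF ae0]
  proof eventually_elim
    fix z assume z: "(\<lambda>k. u (r (r' k)) (fst z)) \<longlonglongrightarrow> v0 (fst z) \<and> (\<lambda>k. u (r (r' k)) (snd z)) \<longlonglongrightarrow> v0 (snd z)"
    show "(\<lambda>k. (dq (u (r (r' k))) z)\<^sup>2) \<longlonglongrightarrow> (dq v0 z)\<^sup>2"
    proof (cases "fst z = snd z")
      case False
      then show ?thesis unfolding dq_def using z by (intro tendsto_intros) auto
    qed (simp add: dq_def)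
  qed
  have "integrable lborel (\<lambda>z. (dq v0 z)\<^sup>2)"
    by (rule integral_Fatou_bound(1)[where f = "\<lambda>k z. (dq (u (r (r' k))) z)\<^sup>2" and B = B])
      (use B dqae in \<open>auto intro: sqint_integrable_real X_dq u simp: X_norm_sq_dq[symmetric]\<close>)
  then have "sqint lborel (dq v0)" by (simp add: sqint_def)
  moreover have "AE x in lborel. \<forall>k. x \<notin> {0<..<1} \<longrightarrow> u k x = 0"
    unfolding AE_all_countable using X_AE[OF u] by blast
  with ae0 have "AE x in lborel. x \<notin> {0<..<1} \<longrightarrow> v0 x = 0"
  proof eventually_elim
    fix x assume "(\<lambda>k. u (r (r' k)) x) \<longlonglongrightarrow> v0 x" "\<forall>k. x \<notin> {0<..<1} \<longrightarrow> u k x = 0"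
    then show "x \<notin> {0<..<1} \<longrightarrow> v0 x = 0" by (auto dest: LIMSEQ_unique[OF _ tendsto_const])
  qed
  ultimately have v: "v0 \<in> X_space" using v0 by (simp add: X_space_iff)
  have "(LINT x|lborel. (norm (u (r n) x - v0 x))\<^sup>2) = (LINT x|I01. (u (r n) x - v0 x)\<^sup>2)" for n
    using X_L2_I01[OF X_diff[OF u v]] by simp
  then have "(\<lambda>n. LINT x|I01. (u (r n) x - v0 x)\<^sup>2) \<longlonglongrightarrow> 0" using lim0 by simp
  from LIMSEQ_subseq_LIMSEQ[OF this r'] have "(\<lambda>n. LINT x|I01. (u (r (r' n)) x - v0 x)\<^sup>2) \<longlonglongrightarrow> 0"
    by (simp add: comp_def)
  with that[OF v strict_mono_o[OF r(1) r']] ae0 show thesis by (simp add: comp_def)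
qed

text \<open>A countable set of bounded functions is obtained by choosing, for each \<open>m\<close> and \<open>n\<close>, one function
  from every nonempty class of functions bounded by \<open>m\<close> (in the supremum and the \<open>X\<close> norm) whose
  integrals over the \<open>n\<close> cells agree up to \<open>1 / n\<^sup>2\<close>.\<close>

lemma X_countable_dense:
  obtains d :: "nat \<Rightarrow> real \<Rightarrow> real" where
    "\<And>j. d j \<in> X_space" "\<And>j. \<exists>K. \<forall>x. \<bar>d j x\<bar> \<le> K"
    "\<And>v K. v \<in> X_space \<Longrightarrow> (\<And>x. \<bar>v x\<bar> \<le> K) \<Longrightarrow>
       \<exists>\<sigma> B. (\<forall>j. (X_norm (d (\<sigma> j)))\<^sup>2 \<le> B) \<and> (\<lambda>j. LINT x|I01. (d (\<sigma> j) x - v x)\<^sup>2) \<longlonglongrightarrow> 0"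
proof -
  define P where "P = (\<lambda>(m :: nat, n :: nat, z :: int list) v. v \<in> X_space \<and> (X_norm v)\<^sup>2 \<le> real m \<and>
      (\<forall>x. \<bar>v x\<bar> \<le> real m) \<and> (\<forall>i<n. \<lfloor>(real n)\<^sup>2 * cell_int v n i\<rfloor> = z ! i))"
  define e where "e q = (if \<exists>v. P q v then SOME v. P q v else (\<lambda>_. 0))" for q
  have eP: "P q (e q)" if "P q v" for q v
    using that someI_ex[of "P q"] unfolding e_def by auto
  have eX: "e q \<in> X_space" for q
    using eP[of q] X_zero by (cases "\<exists>v. P q v") (auto simp: P_def e_def split: prod.splits)
  have eK: "\<exists>K. \<forall>x. \<bar>e q x\<bar> \<le> K" for q
  proof (cases "\<exists>v. P q v")
    case True
    then show ?thesis using eP[of q] by (auto simp: P_def split: prod.splits)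
  qed (auto simp: e_def)
  \<comment> \<open>The classes are indexed by numbers and lists of integers, a countable type, so
    the chosen representatives form a sequence.\<close>
  define d :: "nat \<Rightarrow> real \<Rightarrow> real" where "d j = e (from_nat j)" for j
  show thesis
  proof (rule that[of d])
    show "d j \<in> X_space" for j unfolding d_def by (rule eX)
    show "\<exists>K. \<forall>x. \<bar>d j x\<bar> \<le> K" for j unfolding d_def by (rule eK)
    fix v :: "real \<Rightarrow> real" and K :: real
    assume v: "v \<in> X_space" and K: "\<And>x. \<bar>v x\<bar> \<le> K"
    obtain m where m: "max ((X_norm v)\<^sup>2) K \<le> real m" using real_arch_simple by blast
    define q where "q n = (m, Suc n, map (\<lambda>i. \<lfloor>(real (Suc n))\<^sup>2 * cell_int v (Suc n) i\<rfloor>) [0..<Suc n])" for n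
    have "P (q n) v" for n
      using v m K by (auto simp: P_def q_def simp del: upt_Suc intro: order_trans)
    then have Pe: "P (q n) (e (q n))" for n by (rule eP)
    define \<sigma> where "\<sigma> n = to_nat (q n)" for n
    have d\<sigma>: "d (\<sigma> n) = e (q n)" for n by (simp add: d_def \<sigma>_def)
    have "(LINT x|I01. (d (\<sigma> n) x - v x)\<^sup>2) \<le> (1 + 2 * real m) / real (Suc n)" for n
    proof -
      define w where "w x = d (\<sigma> n) x - v x" for x
      have dX: "d (\<sigma> n) \<in> X_space" unfolding d_def by (rule eX)
      have w: "w \<in> X_space" unfolding w_def by (intro X_diff dX v)
      define N where "N = real (Suc n)"
      have N: "N \<ge> 1" by (simp add: N_def)
      have ci: "(cell_int w (Suc n) i)\<^sup>2 \<le> 1 / N ^ 4" if i: "i < Suc n" for i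
      proof -
        have "\<lfloor>N\<^sup>2 * cell_int (d (\<sigma> n)) (Suc n) i\<rfloor> = \<lfloor>N\<^sup>2 * cell_int v (Suc n) i\<rfloor>"
          using Pe[of n] i unfolding P_def q_def d\<sigma> N_def by (simp del: upt_Suc of_nat_Suc)
        then have "\<bar>N\<^sup>2 * cell_int (d (\<sigma> n)) (Suc n) i - N\<^sup>2 * cell_int v (Suc n) i\<bar> \<le> 1" by linarith
        then have "\<bar>N\<^sup>2 * cell_int w (Suc n) i\<bar> \<le> 1"
          unfolding w_def cell_int_diff[OF dX v zero_less_Suc] by (simp add: right_diff_distrib)
        then have "(N\<^sup>2 * cell_int w (Suc n) i)\<^sup>2 \<le> 1" by (simp add: abs_square_le_1)
        then have "N ^ 4 * (cell_int w (Suc n) i)\<^sup>2 \<le> 1" by (simp add: power_mult_distrib flip: power_mult)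
        then show ?thesis using N by (simp add: field_simps)
      qed
      have "(\<Sum>i<Suc n. (cell_int w (Suc n) i)\<^sup>2) \<le> (\<Sum>i<Suc n. 1 / N ^ 4)"
        by (intro sum_mono ci) simp
      also have "\<dots> = N * (1 / N ^ 4)" by (simp add: N_def del: of_nat_Suc sum.lessThan_Suc)
      finally have "N * (\<Sum>i<Suc n. (cell_int w (Suc n) i)\<^sup>2) \<le> N * (N * (1 / N ^ 4))"
        using N by (intro mult_left_mono) auto
      also have "\<dots> = (1 / N) * (1 / N)" using N by (simp add: power4_eq_xxxx)
      also have "\<dots> \<le> 1 * (1 / N)" using N by (intro mult_right_mono) auto
      finally have 1: "N * (\<Sum>i<Suc n. (cell_int w (Suc n) i)\<^sup>2) \<le> 1 / N" by simp
      have "(X_norm w)\<^sup>2 \<le> 2 * real m + 2 * real m"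
        unfolding w_def using X_norm_diff_sq_le[OF dX v] Pe[of n] m by (auto simp: P_def q_def d\<sigma>)
      then have 2: "(X_norm w)\<^sup>2 / (2 * N) \<le> 2 * real m / N" using N by (simp add: field_simps)
      have "(LINT x|I01. (w x)\<^sup>2) \<le> 1 / N + 2 * real m / N"
        using L2_le_cell_integrals[OF w zero_less_Suc[of n], folded N_def] 1 2 by linarith
      then show ?thesis by (simp add: w_def N_def add_divide_distrib)
    qed
    then have le: "\<forall>\<^sub>F n in sequentially. (LINT x|I01. (d (\<sigma> n) x - v x)\<^sup>2) \<le> (1 + 2 * real m) / real (Suc n)"
      by (intro always_eventually allI)
    have lim: "(\<lambda>n. (1 + 2 * real m) / real (Suc n)) \<longlonglongrightarrow> 0"
      using LIMSEQ_Suc[OF lim_const_over_n[of "1 + 2 * real m"]] by simp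
    have "(\<lambda>n. LINT x|I01. (d (\<sigma> n) x - v x)\<^sup>2) \<longlonglongrightarrow> 0"
      by (rule tendsto_sandwich[OF _ le tendsto_const lim]) simp
    moreover have "(X_norm (d (\<sigma> n)))\<^sup>2 \<le> real m" for n
      using Pe[of n] by (simp add: P_def q_def d\<sigma>)
    ultimately show "\<exists>\<sigma> B. (\<forall>j. (X_norm (d (\<sigma> j)))\<^sup>2 \<le> B) \<and> (\<lambda>j. LINT x|I01. (d (\<sigma> j) x - v x)\<^sup>2) \<longlonglongrightarrow> 0"
      by blast
  qed
qed

text \<open>Almost everywhere convergence of the functions gives that of their difference quotients,
  which are bounded in \<open>L\<^sup>2\<close> of the plane; weak convergence in
  \<open>L\<^sup>2\<close> then applies.\<close>

lemma X_inner_weak_convergence: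
  assumes u: "\<And>k. u k \<in> X_space" and v: "v \<in> X_space" and w: "w \<in> X_space"
    and ae: "AE x in lborel. (\<lambda>k. u k x) \<longlonglongrightarrow> v x" and B: "\<And>k. (X_norm (u k))\<^sup>2 \<le> B"
  shows "(\<lambda>k. X_inner (u k) w) \<longlonglongrightarrow> X_inner v w"
  unfolding X_inner_def
proof (rule sqint_weak_convergence[where B = B])
  show "AE z in lborel. (\<lambda>k. dq (u k) z) \<longlonglongrightarrow> dq v z"
    using AE_lborel_pair[OF ae]
  proof eventually_elim
    fix z assume z: "(\<lambda>k. u k (fst z)) \<longlonglongrightarrow> v (fst z) \<and> (\<lambda>k. u k (snd z)) \<longlonglongrightarrow> v (snd z)"
    show "(\<lambda>k. dq (u k) z) \<longlonglongrightarrow> dq v z"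
    proof (cases "fst z = snd z")
      case False
      then show ?thesis unfolding dq_def using z by (intro tendsto_intros) auto
    qed (simp add: dq_def)
  qed
qed (use u v w B in \<open>auto intro: X_dq simp: X_norm_sq_dq[symmetric]\<close>)

subsection \<open>A finite-dimensional mountain pass theorem\<close>

lemma tendsto_componentwise:
  fixes f :: "'b \<Rightarrow> nat \<Rightarrow> real"
  assumes "\<And>i. ((\<lambda>k. f k i) \<longlongrightarrow> l i) F" shows "(f \<longlongrightarrow> l) F"
proof -
  have "limitin (product_topology (\<lambda>_. euclidean) UNIV) f l F"
    unfolding limitin_componentwise using assms by (simp add: limitin_canonical_iff)
  then show ?thesis by (simp add: euclidean_product_topology limitin_canonical_iff)
qed

lemma compact_decreasing_nonempty:
  fixes K :: "nat \<Rightarrow> 'a::metric_space set"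
  assumes K: "\<And>n. compact (K n)" "\<And>n. K n \<noteq> {}" and mono: "\<And>n. K (Suc n) \<subseteq> K n"
  shows "(\<Inter>n. K n) \<noteq> {}"
proof -
  have dec: "K n \<subseteq> K m" if "m \<le> n" for m n using lift_Suc_antimono_le[of K, OF mono that] .
  have "\<forall>n. \<exists>x. x \<in> K n" using K(2) by blast
  then obtain x where x: "\<And>n. x n \<in> K n" by metis
  have "seq_compact (K 0)" using K(1) by (simp add: compact_eq_seq_compact_metric)
  moreover have "\<forall>n. x n \<in> K 0" using x dec by blast
  ultimately obtain l r where r: "strict_mono (r :: nat \<Rightarrow> nat)" and l: "(x \<circ> r) \<longlonglongrightarrow> l"
    unfolding seq_compact_def by metis
  have "l \<in> K m" for m
  proof (rule closed_sequentially[OF compact_imp_closed[OF K(1)]])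
    show "(\<lambda>n. (x \<circ> r) (n + m)) \<longlonglongrightarrow> l" using l by (rule LIMSEQ_ignore_initial_segment)
    show "(x \<circ> r) (n + m) \<in> K m" for n
      using x[of "r (n + m)"] dec[of m "r (n + m)"] seq_suble[OF r, of "n + m"] by auto
  qed
  then show ?thesis by blast
qed

text \<open>A separation of the intersection into two closed pieces extends to disjoint open sets,
  obtained by comparing distances to the pieces. By compactness some \<open>K n\<close> already lies
  in their union, contradicting its connectedness.\<close>

lemma connected_decreasing:
  fixes K :: "nat \<Rightarrow> 'a::metric_space set"
  assumes K: "\<And>n. compact (K n)" "\<And>n. connected (K n)" and mono: "\<And>n. K (Suc n) \<subseteq> K n"
  shows "connected (\<Inter>n. K n)"
proof (rule ccontr)
  define L where "L = (\<Inter>n. K n)"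
  assume "\<not> connected (\<Inter>n. K n)"
  then have "\<exists>A B. closed A \<and> closed B \<and> L \<subseteq> A \<union> B \<and> A \<inter> B \<inter> L = {} \<and> A \<inter> L \<noteq> {} \<and> B \<inter> L \<noteq> {}"
    unfolding connected_closed L_def[symmetric] by (simp only: not_not)
  then obtain A B where AB: "closed A" "closed B" "L \<subseteq> A \<union> B" "A \<inter> B \<inter> L = {}"
    "A \<inter> L \<noteq> {}" "B \<inter> L \<noteq> {}"
    by (elim exE conjE) (rule that)
  define A' B' where "A' = A \<inter> L" and "B' = B \<inter> L"
  have "closed L" unfolding L_def using K(1) by (intro closed_INT) (auto intro: compact_imp_closed)
  then have cl: "closed A'" "closed B'" using AB by (auto simp: A'_def B'_def)
  have ne: "A' \<noteq> {}" "B' \<noteq> {}" and disj: "A' \<inter> B' = {}" using AB by (auto simp: A'_def B'_def)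
  define U V where "U = {x. infdist x A' < infdist x B'}" and "V = {x. infdist x B' < infdist x A'}"
  have UV: "open U" "open V" "U \<inter> V = {}"
    unfolding U_def V_def by (auto intro!: open_Collect_less continuous_intros)
  have "0 < infdist x B'" if "x \<in> A'" for x
    using that in_closed_iff_infdist_zero[OF cl(2) ne(2), of x] disj infdist_nonneg[of x B'] by force
  then have UA: "A' \<subseteq> U" by (auto simp: U_def)
  have "0 < infdist x A'" if "x \<in> B'" for x
    using that in_closed_iff_infdist_zero[OF cl(1) ne(1), of x] disj infdist_nonneg[of x A'] by force
  then have VB: "B' \<subseteq> V" by (auto simp: V_def)
  have "\<exists>n. K n \<subseteq> U \<union> V"
  proof (rule ccontr)
    assume "\<nexists>n. K n \<subseteq> U \<union> V"
    then have "(\<Inter>n. K n - (U \<union> V)) \<noteq> {}"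
      using UV mono K(1) by (intro compact_decreasing_nonempty compact_diff open_Un Diff_mono) auto
    then have "L - (U \<union> V) \<noteq> {}" by (simp add: L_def)
    then show False using AB(3) UA VB by (auto simp: A'_def B'_def)
  qed
  then obtain n where n: "K n \<subseteq> U \<union> V" ..
  have "U \<inter> K n \<noteq> {}" "V \<inter> K n \<noteq> {}" using AB(5,6) UA VB by (auto simp: A'_def B'_def L_def)
  then show False using K(2)[of n] n UV unfolding connected_def by blast
qed

text \<open>The mountain pass level is attained by a continuum: the connected components of \<open>p\<close> in the
  sublevel sets of \<open>J\<close> decrease, as the level decreases to \<open>c\<close>, to a connected set.\<close>

lemma minmax_continuum:
  fixes J :: "'a::metric_space \<Rightarrow> real"
  assumes S: "compact S" and J: "continuous_on S J"
    and K0: "connected K\<^sub>0" "K\<^sub>0 \<subseteq> S" "p \<in> K\<^sub>0" "q \<in> K\<^sub>0" "\<And>x. x \<in> K\<^sub>0 \<Longrightarrow> J x \<le> s\<^sub>0"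
    and ridge: "\<And>K. connected K \<Longrightarrow> K \<subseteq> S \<Longrightarrow> p \<in> K \<Longrightarrow> q \<in> K \<Longrightarrow> \<exists>x\<in>K. \<rho> \<le> J x"
  obtains c K where "\<rho> \<le> c" "c \<le> s\<^sub>0" "compact K" "K \<subseteq> S" "p \<in> K" "q \<in> K" "\<And>x. x \<in> K \<Longrightarrow> J x \<le> c"
    "\<And>\<eta>. continuous_on K \<eta> \<Longrightarrow> \<eta> ` K \<subseteq> S \<Longrightarrow> \<eta> p = p \<Longrightarrow> \<eta> q = q \<Longrightarrow> \<exists>x\<in>K. c \<le> J (\<eta> x)"
proof -
  \<comment> \<open>Arbitrary connected sets compete instead of paths: connected components of
    sublevel sets are then admissible, and the infimum can be attained by an intersection of
    them.\<close>
  define lev where "lev s \<longleftrightarrow> (\<exists>K. connected K \<and> K \<subseteq> S \<and> p \<in> K \<and> q \<in> K \<and> (\<forall>x\<in>K. J x \<le> s))" for s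
  have lev0: "lev s\<^sub>0" unfolding lev_def using K0 by blast
  have lev_ge: "\<rho> \<le> s" if "lev s" for s
    using that ridge unfolding lev_def by (meson order_trans)
  define c where "c = Inf {s. lev s}"
  have bdd: "bdd_below {s. lev s}" by (rule bdd_belowI[of _ \<rho>]) (simp add: lev_ge)
  have c_le: "c \<le> s" if "lev s" for s unfolding c_def using that bdd by (auto intro: cInf_lower)
  have c_ge: "\<rho> \<le> c" unfolding c_def using lev0 lev_ge by (intro cInf_greatest) auto
  define T where "T n = {x \<in> S. J x \<le> c + 1 / real (Suc n)}" for n
  have T: "compact (T n)" for n
  proof -
    have "T n = S \<inter> J -` {..c + 1 / real (Suc n)}" by (auto simp: T_def)
    moreover have "closed (S \<inter> J -` {..c + 1 / real (Suc n)})"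
      by (intro continuous_closed_preimage J compact_imp_closed S closed_atMost)
    ultimately have "closed (T n)" by simp
    from compact_Int_closed[OF S this] show ?thesis by (simp add: T_def Int_def conj_ac)
  qed
  define Kn where "Kn n = connected_component_set (T n) p" for n
  have Kn: "compact (Kn n)" "connected (Kn n)" "q \<in> Kn n" "p \<in> Kn n" "Kn n \<subseteq> T n" for n
  proof -
    have "c < c + 1 / real (Suc n)" by simp
    then obtain s where s: "lev s" "s < c + 1 / real (Suc n)"
      using lev0 bdd unfolding c_def by (subst (asm) cInf_less_iff) auto
    then obtain K where K: "connected K" "K \<subseteq> S" "p \<in> K" "q \<in> K" "\<forall>x\<in>K. J x \<le> s" unfolding lev_def by blast
    then have "K \<subseteq> T n" using s(2) by (force simp: T_def)
    then show "q \<in> Kn n" "p \<in> Kn n"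
      using K connected_component_maximal[of p K "T n"] by (auto simp: Kn_def)
    show sub: "Kn n \<subseteq> T n" unfolding Kn_def by (rule connected_component_subset)
    show "connected (Kn n)" unfolding Kn_def by (rule connected_connected_component)
    have "closed (Kn n)" unfolding Kn_def by (intro closed_connected_component compact_imp_closed T)
    from compact_Int_closed[OF T[of n] this] sub show "compact (Kn n)" by (simp add: Int_absorb1)
  qed
  have mono: "Kn (Suc n) \<subseteq> Kn n" for n
  proof -
    have "1 / real (Suc (Suc n)) \<le> 1 / real (Suc n)" by (simp add: field_simps)
    then have "T (Suc n) \<subseteq> T n" by (auto simp: T_def)
    then show ?thesis unfolding Kn_def by (rule connected_component_mono)
  qed
  define K where "K = (\<Inter>n. Kn n)"
  have conK: "connected K" unfolding K_def by (rule connected_decreasing[of Kn, OF Kn(1,2) mono])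
  have pq: "p \<in> K" "q \<in> K" using Kn by (auto simp: K_def)
  have KS: "K \<subseteq> S" using Kn(5)[of 0] by (auto simp: K_def T_def)
  have compK: "compact K"
  proof -
    have "closed K" unfolding K_def using Kn(1) by (intro closed_INT) (auto intro: compact_imp_closed)
    moreover have "K \<subseteq> Kn 0" by (auto simp: K_def)
    ultimately show ?thesis using compact_Int_closed[OF Kn(1)[of 0], of K] by (simp add: Int_absorb1)
  qed
  have J_le: "J x \<le> c" if "x \<in> K" for x
  proof (rule LIMSEQ_le_const)
    have "(\<lambda>n. c + 1 / real (Suc n)) \<longlonglongrightarrow> c + 0"
      by (intro tendsto_intros LIMSEQ_Suc[OF lim_const_over_n])
    then show "(\<lambda>n. c + 1 / real (Suc n)) \<longlonglongrightarrow> c" by simp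
    show "\<exists>N. \<forall>n\<ge>N. J x \<le> c + 1 / real (Suc n)" using that Kn(5) by (auto simp: K_def T_def)
  qed
  show thesis
  proof (rule that[OF c_ge c_le[OF lev0] compK KS pq J_le])
    fix \<eta> :: "'a \<Rightarrow> 'a" assume \<eta>: "continuous_on K \<eta>" "\<eta> ` K \<subseteq> S" "\<eta> p = p" "\<eta> q = q"
    show "\<exists>x\<in>K. c \<le> J (\<eta> x)"
    proof -
      have "continuous_on K (\<lambda>x. J (\<eta> x))"
        by (rule continuous_on_compose2[OF J \<eta>(1) \<eta>(2)])
      then obtain x where x: "x \<in> K" "\<forall>y\<in>K. J (\<eta> y) \<le> J (\<eta> x)"
        using continuous_attains_sup[OF compK] pq by blast
      \<comment> \<open>The deformed continuum is again admissible, so its maximal value is not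
        below the infimum c.\<close>
      have "lev (J (\<eta> x))"
        unfolding lev_def
      proof (intro exI[of _ "\<eta> ` K"] conjI)
        show "connected (\<eta> ` K)" by (rule connected_continuous_image[OF \<eta>(1) conK])
        show "p \<in> \<eta> ` K" using \<eta>(3) pq by (metis image_eqI)
        show "q \<in> \<eta> ` K" using \<eta>(4) pq by (metis image_eqI)
      qed (use \<eta>(2) x in auto)
      then show ?thesis using c_le x(1) by blast
    qed
  qed
qed

text \<open>A single step of the gradient flow replaces the usual deformation. If the step of size
  \<open>1 / (k + 1)\<close> does not lower the maximum on the optimal continuum for any \<open>k\<close>, then the points where
  this fails accumulate at a critical point of level \<open>c\<close>.\<close>

lemma mountain_pass_box:
  fixes J :: "(nat \<Rightarrow> real) \<Rightarrow> real" and G :: "nat \<Rightarrow> (nat \<Rightarrow> real) \<Rightarrow> real" and m :: nat and R :: real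
  defines "S \<equiv> {x. \<forall>i. \<bar>x i\<bar> \<le> (if i < m then R else 0)}"
  assumes R: "R > 0"
    and J: "continuous_on S J" and G: "\<And>i. i < m \<Longrightarrow> continuous_on S (G i)"
    and diff: "\<And>x w x\<^sub>0 w\<^sub>0 \<delta>. (\<And>k. x k \<in> S) \<Longrightarrow> x\<^sub>0 \<in> S \<Longrightarrow> x \<longlonglongrightarrow> x\<^sub>0 \<Longrightarrow> w \<longlonglongrightarrow> w\<^sub>0 \<Longrightarrow>
      (\<And>k. 0 < \<delta> k) \<Longrightarrow> \<delta> \<longlonglongrightarrow> 0 \<Longrightarrow>
      (\<lambda>k. (J (\<lambda>i. x k i + \<delta> k * w k i) - J (x k)) / \<delta> k) \<longlonglongrightarrow> (\<Sum>i<m. w\<^sub>0 i * G i x\<^sub>0)"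
    and bdry: "\<And>x i. x \<in> S \<Longrightarrow> i < m \<Longrightarrow> \<bar>x i\<bar> = R \<Longrightarrow> J x \<le> 0"
    and J0: "J (\<lambda>_. 0) = 0" and q: "q \<in> S" "J q \<le> 0"
    and seg: "\<And>t. 0 \<le> t \<Longrightarrow> t \<le> 1 \<Longrightarrow> J (\<lambda>i. t * q i) \<le> s\<^sub>0"
    and \<rho>: "\<rho> > 0"
    and ridge: "\<And>K. connected K \<Longrightarrow> K \<subseteq> S \<Longrightarrow> (\<lambda>_. 0) \<in> K \<Longrightarrow> q \<in> K \<Longrightarrow> \<exists>x\<in>K. \<rho> \<le> J x"
  obtains x where "x \<in> S" "\<rho> \<le> J x" "J x \<le> s\<^sub>0" "\<And>i. i < m \<Longrightarrow> G i x = 0"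
proof -
  have S: "compact S" unfolding S_def by (rule compact_box)
  define K0 where "K0 = (\<lambda>t i. t * q i) ` {0..1::real}"
  have K0: "connected K0" unfolding K0_def
    by (intro connected_continuous_image continuous_on_coordinatewise_then_product continuous_intros) simp
  have K0S: "K0 \<subseteq> S"
  proof
    fix x assume "x \<in> K0"
    then obtain t where t: "t \<in> {0..1}" "x = (\<lambda>i. t * q i)" by (auto simp: K0_def)
    have "\<bar>t * q i\<bar> \<le> \<bar>q i\<bar>" for i using t(1) by (simp add: abs_mult mult_left_le_one_le)
    moreover have "\<bar>q i\<bar> \<le> (if i < m then R else 0)" for i using q(1) unfolding S_def by blast
    ultimately have "\<bar>t * q i\<bar> \<le> (if i < m then R else 0)" for i by (rule order_trans)
    then show "x \<in> S" unfolding S_def t(2) by blast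
  qed
  have z0: "(\<lambda>_. 0) \<in> K0" unfolding K0_def by (rule image_eqI[of _ _ 0]) auto
  have q0: "q \<in> K0" unfolding K0_def by (rule image_eqI[of _ _ 1]) auto
  have JK0: "J x \<le> s\<^sub>0" if "x \<in> K0" for x using that seg by (auto simp: K0_def)
  obtain c K where c: "\<rho> \<le> c" "c \<le> s\<^sub>0" and K: "compact K" "K \<subseteq> S" "(\<lambda>_. 0) \<in> K" "q \<in> K"
    and JK: "\<And>x. x \<in> K \<Longrightarrow> J x \<le> c"
    and def: "\<And>\<eta>. continuous_on K \<eta> \<Longrightarrow> \<eta> ` K \<subseteq> S \<Longrightarrow> \<eta> (\<lambda>_. 0) = (\<lambda>_. 0) \<Longrightarrow> \<eta> q = q \<Longrightarrow> \<exists>x\<in>K. c \<le> J (\<eta> x)"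
    by (rule minmax_continuum[OF S J K0 K0S z0 q0 JK0 ridge]) (assumption | rule that)+
  \<comment> \<open>The factor \<open>max 0 (J x)\<close> stops the flow where J is not positive; in
    particular both endpoints stay fixed without a separate cutoff function. The truncation in
    \<open>\<eta>\<close> keeps the step inside the box.\<close>
  define w where "w x i = (if i < m then - (max 0 (J x)) * G i x else 0)" for x i
  define \<eta> where "\<eta> k x = (\<lambda>i. trunc (if i < m then R else 0) (x i + 1 / real (Suc k) * w x i))" for k x
  have trunc_le: "\<bar>trunc r t\<bar> \<le> r" if "r \<ge> 0" for r t using that by (auto simp: trunc_def)
  have trunc_id: "trunc r t = t" if "\<bar>t\<bar> \<le> r" for r t using that by (auto simp: trunc_def)
  have trunc_cont: "continuous_on A (trunc r)" for A r unfolding trunc_def by (intro continuous_intros)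
  have \<eta>S: "\<eta> k x \<in> S" for k x using trunc_le R by (simp add: \<eta>_def S_def)
  have w_cont: "continuous_on S (\<lambda>x. w x i)" for i
    unfolding w_def using J G by (cases "i < m") (auto intro!: continuous_intros)
  have coord: "continuous_on A (\<lambda>x::nat \<Rightarrow> real. x i)" for A i
    by (rule continuous_on_subset[OF continuous_on_product_coordinates]) simp
  have \<eta>_cont: "continuous_on K (\<eta> k)" for k
  proof (rule continuous_on_coordinatewise_then_product)
    fix i
    have "continuous_on K (\<lambda>x. x i + 1 / real (Suc k) * w x i)"
      by (intro continuous_intros coord continuous_on_subset[OF w_cont K(2)])
    then show "continuous_on K (\<lambda>x. \<eta> k x i)"
      unfolding \<eta>_def by (rule continuous_on_compose2[OF trunc_cont[of UNIV]]) simp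
  qed
  have "\<exists>x\<in>K. c \<le> J (\<eta> k x)" for k
  proof (rule def[OF \<eta>_cont])
    show "\<eta> k (\<lambda>_. 0) = (\<lambda>_. 0)" using R by (auto simp: \<eta>_def w_def J0 trunc_def)
    have "w q i = 0" for i using q(2) by (simp add: w_def max_def)
    then show "\<eta> k q = q" using q(1) trunc_id by (auto simp: \<eta>_def S_def)
  qed (use \<eta>S in auto)
  then have "\<forall>k. \<exists>x. x \<in> K \<and> c \<le> J (\<eta> k x)" by blast
  from choice[OF this] obtain x where x: "\<And>k. x k \<in> K" and cx: "\<And>k. c \<le> J (\<eta> k (x k))" by blast
  obtain x0 r where x0: "x0 \<in> K" and r: "strict_mono (r :: nat \<Rightarrow> nat)" and lim: "(x \<circ> r) \<longlonglongrightarrow> x0"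
    using K(1)[unfolded compact_eq_seq_compact_metric seq_compact_def, rule_format, of x] x by blast
  have xS: "x k \<in> S" for k using x K(2) by blast
  have x0S: "x0 \<in> S" using x0 K(2) by blast
  define y where "y k = x (r k)" for k
  define \<delta> where "\<delta> k = 1 / real (Suc (r k))" for k
  have y: "y \<longlonglongrightarrow> x0" using lim by (simp add: y_def[abs_def] comp_def)
  have \<delta>: "\<delta> \<longlonglongrightarrow> 0"
    using LIMSEQ_subseq_LIMSEQ[OF LIMSEQ_Suc[OF lim_const_over_n[of 1]] r] by (simp add: \<delta>_def[abs_def] comp_def)
  have yS: "y k \<in> S" for k unfolding y_def by (rule xS)
  have wy: "(\<lambda>k. w (y k) i) \<longlonglongrightarrow> w x0 i" for i
    by (rule continuous_on_tendsto_compose[OF w_cont y x0S]) (simp add: yS)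
  have step: "(\<lambda>k. y k i + \<delta> k * w (y k) i) \<longlonglongrightarrow> x0 i" for i
  proof -
    have "(\<lambda>k. y k i + \<delta> k * w (y k) i) \<longlonglongrightarrow> x0 i + 0 * w x0 i"
      by (intro tendsto_intros \<delta> wy tendsto_component y)
    then show ?thesis by simp
  qed
  have \<eta>_eq: "\<eta> (r k) (y k) = (\<lambda>i. trunc (if i < m then R else 0) (y k i + \<delta> k * w (y k) i))" for k
    by (simp add: \<eta>_def \<delta>_def)
  have "(\<lambda>k. \<eta> (r k) (y k) i) \<longlonglongrightarrow> x0 i" for i
  proof -
    have "(\<lambda>k. \<eta> (r k) (y k) i) \<longlonglongrightarrow> trunc (if i < m then R else 0) (x0 i)"
      unfolding \<eta>_eq by (rule continuous_on_tendsto_compose[OF trunc_cont[of UNIV] step]) auto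
    then show ?thesis using x0S trunc_id by (simp add: S_def)
  qed
  then have \<eta>_lim: "(\<lambda>k. \<eta> (r k) (y k)) \<longlonglongrightarrow> x0" by (rule tendsto_componentwise)
  have "(\<lambda>k. J (\<eta> (r k) (y k))) \<longlonglongrightarrow> J x0"
    by (rule continuous_on_tendsto_compose[OF J \<eta>_lim x0S]) (simp add: \<eta>S)
  then have "c \<le> J x0" using cx by (intro LIMSEQ_le_const) (auto simp: y_def)
  then have Jx0: "J x0 = c" using JK[OF x0] by simp
  \<comment> \<open>J is at most 0 on the boundary but equals c > 0 at \<open>x0\<close>; near
    \<open>x0\<close> the truncation is therefore inactive and the step is a genuine gradient
    step.\<close>
  have interior: "\<bar>x0 i\<bar> < R" if "i < m" for i
  proof -
    have "\<bar>x0 i\<bar> \<le> (if i < m then R else 0)" using x0S unfolding S_def by blast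
    then have "\<bar>x0 i\<bar> \<le> R" using that by simp
    moreover have "\<bar>x0 i\<bar> \<noteq> R" using bdry[OF x0S that] Jx0 c(1) \<rho> by linarith
    ultimately show ?thesis by linarith
  qed
  have ev: "\<forall>\<^sub>F k in sequentially. \<forall>i<m. \<bar>y k i + \<delta> k * w (y k) i\<bar> < R"
  proof -
    have "\<forall>\<^sub>F k in sequentially. \<forall>i\<in>{..<m}. \<bar>y k i + \<delta> k * w (y k) i\<bar> < R"
    proof (rule eventually_ball_finite)
      show "\<forall>i\<in>{..<m}. \<forall>\<^sub>F k in sequentially. \<bar>y k i + \<delta> k * w (y k) i\<bar> < R"
        using interior order_tendstoD(2)[OF tendsto_rabs[OF step]] by blast
    qed simp
    then show ?thesis by (rule eventually_mono) blast
  qed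
  have nn: "\<forall>\<^sub>F k in sequentially. 0 \<le> (J (\<lambda>i. y k i + \<delta> k * w (y k) i) - J (y k)) / \<delta> k"
    using ev
  proof eventually_elim
    fix k assume k: "\<forall>i<m. \<bar>y k i + \<delta> k * w (y k) i\<bar> < R"
    have "\<eta> (r k) (y k) i = y k i + \<delta> k * w (y k) i" for i
    proof (cases "i < m")
      case True
      then have "\<bar>y k i + \<delta> k * w (y k) i\<bar> \<le> R" using k less_imp_le by blast
      from trunc_id[OF this] True show ?thesis by (simp add: \<eta>_eq)
    next
      case False
      have "\<bar>y k i\<bar> \<le> (if i < m then R else 0)" using yS[of k] unfolding S_def by blast
      then have "y k i = 0" "w (y k) i = 0" using False by (simp_all add: w_def)
      then show ?thesis using False by (simp add: \<eta>_eq trunc_def)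
    qed
    then have "\<eta> (r k) (y k) = (\<lambda>i. y k i + \<delta> k * w (y k) i)" by (rule ext)
    then have "c \<le> J (\<lambda>i. y k i + \<delta> k * w (y k) i)" using cx[of "r k"] by (simp add: y_def)
    moreover have "J (y k) \<le> c" unfolding y_def by (rule JK[OF x])
    ultimately show "0 \<le> (J (\<lambda>i. y k i + \<delta> k * w (y k) i) - J (y k)) / \<delta> k"
      by (simp add: \<delta>_def)
  qed
  \<comment> \<open>Base point, direction and step size all vary with k, which explains the form of
    \<open>diff\<close>. The quotients are nonnegative, whereas their limit is -c times the squared
    gradient at \<open>x0\<close>.\<close>
  have lm: "(\<lambda>k. (J (\<lambda>i. y k i + \<delta> k * w (y k) i) - J (y k)) / \<delta> k) \<longlonglongrightarrow> (\<Sum>i<m. w x0 i * G i x0)"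
  proof (rule diff[OF yS x0S y _ _ \<delta>])
    show "(\<lambda>k. w (y k)) \<longlonglongrightarrow> w x0" by (rule tendsto_componentwise) (rule wy)
  qed (simp add: \<delta>_def)
  have "0 \<le> (\<Sum>i<m. w x0 i * G i x0)"
    by (rule tendsto_lowerbound[OF lm nn]) simp
  also have "(\<Sum>i<m. w x0 i * G i x0) = - (c * (\<Sum>i<m. (G i x0)\<^sup>2))"
  proof -
    have "w x0 i * G i x0 = - (c * (G i x0)\<^sup>2)" if "i < m" for i
      using that c(1) \<rho> by (simp add: w_def Jx0 power2_eq_square)
    then show ?thesis by (simp add: sum_negf sum_distrib_left)
  qed
  finally have "c * (\<Sum>i<m. (G i x0)\<^sup>2) \<le> 0" by simp
  then have "(\<Sum>i<m. (G i x0)\<^sup>2) \<le> 0" using c(1) \<rho> by (simp add: mult_le_0_iff)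
  then have "(\<Sum>i<m. (G i x0)\<^sup>2) = 0" by (intro antisym sum_nonneg) auto
  then have "G i x0 = 0" if "i < m" for i using that sum_nonneg_eq_0_iff[of "{..<m}" "\<lambda>i. (G i x0)\<^sup>2"] by simp
  then show thesis using that x0S Jx0 c by simp
qed

subsection \<open>The nonlinearity\<close>

text \<open>The integrals of \<open>g \<circ> u k\<close> over the sets where \<open>u k\<close> is large are uniformly small, so that a continuous
  cutoff reduces the claim to bounded convergence.\<close>

lemma tendsto_integral_uniformly_integrable:
  fixes u :: "nat \<Rightarrow> real \<Rightarrow> real" and g p h :: "real \<Rightarrow> real"
  assumes [measurable]: "\<And>k. u k \<in> borel_measurable borel" "v \<in> borel_measurable borel" "h \<in> borel_measurable borel"
    and g: "continuous_on UNIV g" and [measurable]: "p \<in> borel_measurable borel" and p0: "\<And>t. 0 \<le> p t"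
    and tail: "\<And>e. e > 0 \<Longrightarrow> \<exists>N>0. \<forall>t. N < \<bar>t\<bar> \<longrightarrow> \<bar>g t\<bar> \<le> e * p t"
    and ae: "AE x in I01. (\<lambda>k. u k x) \<longlonglongrightarrow> v x"
    and pu: "\<And>k. integrable I01 (\<lambda>x. p (u k x))" "\<And>k. (LINT x|I01. p (u k x)) \<le> P"
    and pv: "integrable I01 (\<lambda>x. p (v x))" and h: "\<And>x. \<bar>h x\<bar> \<le> K"
  shows "(\<lambda>k. LINT x|I01. g (u k x) * h x) \<longlonglongrightarrow> (LINT x|I01. g (v x) * h x)"
proof -
  have [measurable]: "g \<in> borel_measurable borel" using g by (rule borel_measurable_continuous_onI)
  have K: "K \<ge> 0" using h[of 0] by linarith
  define cut where "cut N t = max 0 (min 1 (2 - \<bar>t\<bar> / N))" for N t :: real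
  have [measurable]: "cut N \<in> borel_measurable borel" for N unfolding cut_def by measurable
  have cut01: "0 \<le> cut N t" "cut N t \<le> 1" for N t by (auto simp: cut_def)
  have cut_1: "cut N t = 1" if "N > 0" "\<bar>t\<bar> \<le> N" for N t
    using that by (simp add: cut_def min_def max_def field_simps)
  have cut_0: "cut N t = 0" if "N > 0" "\<bar>t\<bar> > 2 * N" for N t
    using that by (simp add: cut_def min_def max_def field_simps)
  define b where "b N t = g t * cut N t" for N t
  have [measurable]: "b N \<in> borel_measurable borel" for N unfolding b_def by measurable
  have b_cont: "continuous_on UNIV (b N)" if "N > 0" for N
    unfolding b_def cut_def using that by (intro continuous_intros g) auto
  have b_bound: "\<exists>C. \<forall>t. \<bar>b N t\<bar> \<le> C" if N: "N > 0" for N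
  proof -
    have "bounded (b N ` {-2*N..2*N})"
      by (intro compact_imp_bounded compact_continuous_image continuous_on_subset[OF b_cont[OF N]]) auto
    then obtain C where C: "C > 0" "\<forall>y\<in>b N ` {-2*N..2*N}. norm y \<le> C" unfolding bounded_pos by blast
    have "\<bar>b N t\<bar> \<le> C" for t
    proof (cases "\<bar>t\<bar> \<le> 2 * N")
      case True
      then have "t \<in> {-2*N..2*N}" by auto
      then show ?thesis using C(2) by auto
    next
      case False
      then show ?thesis using C(1) cut_0[OF N, of t] by (simp add: b_def)
    qed
    then show ?thesis by blast
  qed
  have bh_int: "integrable I01 (\<lambda>x. b N (w x) * h x)" if N: "N > 0" and [measurable]: "w \<in> borel_measurable borel" for N w
  proof -
    obtain C where C: "\<And>t. \<bar>b N t\<bar> \<le> C" using b_bound[OF N] by blast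
    show ?thesis
      by (rule I01.integrable_const_bound[where B = "C * K"])
        (auto simp: abs_mult intro!: AE_I2 mult_mono C h order_trans[OF abs_ge_zero C])
  qed
  have rest_le: "\<bar>g t - b N t\<bar> \<le> e * p t" if "N > 0" "e > 0" "\<forall>t. N < \<bar>t\<bar> \<longrightarrow> \<bar>g t\<bar> \<le> e * p t" for N e t
  proof (cases "\<bar>t\<bar> \<le> N")
    case True
    then show ?thesis using cut_1[OF that(1)] p0[of t] that(2) by (simp add: b_def)
  next
    case False
    have "g t - b N t = g t * (1 - cut N t)" by (simp add: b_def algebra_simps)
    then have "\<bar>g t - b N t\<bar> = \<bar>g t\<bar> * (1 - cut N t)" using cut01[of N t] by (simp add: abs_mult)
    also have "\<dots> \<le> \<bar>g t\<bar> * 1" using cut01[of N t] by (intro mult_left_mono) auto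
    also have "\<dots> \<le> e * p t" using that(3) False by simp
    finally show ?thesis .
  qed
  have split: "integrable I01 (\<lambda>x. g (w x) * h x) \<and>
      \<bar>(LINT x|I01. g (w x) * h x) - (LINT x|I01. b N (w x) * h x)\<bar> \<le> e * K * (LINT x|I01. p (w x))"
    if "N > 0" "e > 0" "\<forall>t. N < \<bar>t\<bar> \<longrightarrow> \<bar>g t\<bar> \<le> e * p t"
      and [measurable]: "w \<in> borel_measurable borel" and pw: "integrable I01 (\<lambda>x. p (w x))" for N e w
  proof -
    have le: "\<bar>(g (w x) - b N (w x)) * h x\<bar> \<le> e * K * p (w x)" for x
    proof -
      have "\<bar>(g (w x) - b N (w x)) * h x\<bar> \<le> (e * p (w x)) * K"
        unfolding abs_mult by (intro mult_mono rest_le[OF that(1-3)] h) (use that(2) p0[of "w x"] in auto)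
      then show ?thesis by (simp add: mult_ac)
    qed
    have r: "integrable I01 (\<lambda>x. (g (w x) - b N (w x)) * h x)"
      by (rule Bochner_Integration.integrable_bound[OF integrable_mult_right[OF pw, of "e * K"]])
        (auto intro!: AE_I2 order_trans[OF le abs_ge_self])
    note bi = bh_int[OF that(1,4)]
    have eq: "g (w x) * h x = (g (w x) - b N (w x)) * h x + b N (w x) * h x" for x by (simp add: algebra_simps)
    have gi: "integrable I01 (\<lambda>x. g (w x) * h x)"
      unfolding eq using r bi by (rule Bochner_Integration.integrable_add)
    have "(LINT x|I01. g (w x) * h x) - (LINT x|I01. b N (w x) * h x) = (LINT x|I01. (g (w x) - b N (w x)) * h x)"
      using gi bi by (simp add: left_diff_distrib)
    also have "\<bar>\<dots>\<bar> \<le> (LINT x|I01. \<bar>(g (w x) - b N (w x)) * h x\<bar>)" by (rule integral_abs_bound)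
    also have "\<dots> \<le> (LINT x|I01. e * K * p (w x))" using r pw by (intro integral_mono le) auto
    finally show ?thesis using gi by simp
  qed
  define Q where "Q = \<bar>P\<bar> + (LINT x|I01. p (v x)) + 1"
  have Q: "Q > 0" "P \<le> Q" "(LINT x|I01. p (v x)) \<le> Q"
  proof -
    have "0 \<le> (LINT x|I01. p (v x))" using p0 by simp
    then show "Q > 0" "P \<le> Q" "(LINT x|I01. p (v x)) \<le> Q" unfolding Q_def by linarith+
  qed
  show ?thesis
  proof (rule LIMSEQ_I)
    fix e :: real assume e: "0 < e"
    \<comment> \<open>With this scaling the tails of the sequence and of the limit each cost at most
      e / 4, leaving e / 4 for the bounded part. The increments by 1 keep W positive.\<close>
    define W where "W = (K + 1) * Q"
    have W: "W > 0" "K * Q \<le> W" using K Q by (auto simp: W_def)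
    define e' where "e' = e / (4 * W)"
    have e': "e' > 0" using e W by (simp add: e'_def)
    have "e' * (K * Q) \<le> e' * W" using e' W by (intro mult_left_mono) auto
    also have "\<dots> = e / 4" using W(1) by (simp add: e'_def)
    finally have small: "e' * K * Q \<le> e / 4" by (simp only: mult.assoc)
    obtain N where N: "N > 0" "\<forall>t. N < \<bar>t\<bar> \<longrightarrow> \<bar>g t\<bar> \<le> e' * p t" using tail[OF e'] by blast
    obtain C where C: "\<And>t. \<bar>b N t\<bar> \<le> C" using b_bound[OF N(1)] by blast
    have "(\<lambda>k. LINT x|I01. b N (u k x) * h x) \<longlonglongrightarrow> (LINT x|I01. b N (v x) * h x)"
    proof (rule integral_dominated_convergence[where w = "\<lambda>_. C * K"])
      show "AE x in I01. (\<lambda>k. b N (u k x) * h x) \<longlonglongrightarrow> b N (v x) * h x"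
        using ae
      proof eventually_elim
        fix x assume "(\<lambda>k. u k x) \<longlonglongrightarrow> v x"
        then have "(\<lambda>k. b N (u k x)) \<longlonglongrightarrow> b N (v x)"
          by (intro continuous_on_tendsto_compose[OF b_cont[OF N(1)]]) auto
        then show "(\<lambda>k. b N (u k x) * h x) \<longlonglongrightarrow> b N (v x) * h x" by (rule tendsto_mult_right)
      qed
      show "AE x in I01. norm (b N (u k x) * h x) \<le> C * K" for k
        by (auto simp: abs_mult intro!: AE_I2 mult_mono C h order_trans[OF abs_ge_zero C])
    qed auto
    then have "\<forall>\<^sub>F k in sequentially. dist (LINT x|I01. b N (u k x) * h x) (LINT x|I01. b N (v x) * h x) < e / 4"
      by (rule tendstoD) (use e in simp)
    then have "\<forall>\<^sub>F k in sequentially. norm ((LINT x|I01. g (u k x) * h x) - (LINT x|I01. g (v x) * h x)) < e"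
    proof eventually_elim
      fix k assume k: "dist (LINT x|I01. b N (u k x) * h x) (LINT x|I01. b N (v x) * h x) < e / 4"
      have "e' * K * (LINT x|I01. p (u k x)) \<le> e' * K * Q"
        using e' K pu(2)[of k] Q by (intro mult_left_mono) auto
      then have 1: "\<bar>(LINT x|I01. g (u k x) * h x) - (LINT x|I01. b N (u k x) * h x)\<bar> \<le> e / 4"
        using split[OF N(1) e' N(2) assms(1)[of k] pu(1)[of k]] small by linarith
      have "e' * K * (LINT x|I01. p (v x)) \<le> e' * K * Q"
        using e' K Q by (intro mult_left_mono) auto
      then have 2: "\<bar>(LINT x|I01. g (v x) * h x) - (LINT x|I01. b N (v x) * h x)\<bar> \<le> e / 4"
        using split[OF N(1) e' N(2) assms(2) pv] small by linarith
      show "norm ((LINT x|I01. g (u k x) * h x) - (LINT x|I01. g (v x) * h x)) < e"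
        using 1 2 k e unfolding dist_real_def real_norm_def by linarith
    qed
    then show "\<exists>no. \<forall>n\<ge>no. norm ((LINT x|I01. g (u n x) * h x) - (LINT x|I01. g (v x) * h x)) < e"
      by (simp add: eventually_sequentially)
  qed
qed

text \<open>The setting of the energy estimates. The level condition enters only later, through a
  function \<open>\<psi>\<close> and a real bound \<open>s\<^sub>0\<close> for the energy along its
  ray.\<close>

locale nonlinearity =
  fixes f :: "real \<Rightarrow> real" and \<omega> \<alpha>\<^sub>0 :: real
  assumes omega: "trudinger_moser_constant \<omega>"
    and f_cont: "continuous_on UNIV f"
    and i: "\<exists>t\<^sub>0>0. \<exists>M>0. \<forall>t. \<bar>t\<bar> \<ge> t\<^sub>0 \<longrightarrow> 0 < primitive f t \<and> primitive f t \<le> M * \<bar>f t\<bar>"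
    and ii: "\<forall>t. t \<noteq> 0 \<longrightarrow> 0 < 2 * primitive f t \<and> 2 * primitive f t \<le> f t * t"
    and iii: "Limsup (at 0) (\<lambda>t. ereal (primitive f t / t\<^sup>2)) < ereal (lambda1 / (4 * pi))"
    and \<alpha>\<^sub>0: "0 < \<alpha>\<^sub>0"
    and iv_sub: "\<forall>\<alpha>. 0 < \<alpha> \<and> \<alpha> < \<alpha>\<^sub>0 \<longrightarrow>
                   filterlim (\<lambda>t. \<bar>f t\<bar> / exp (\<alpha> * t\<^sup>2)) at_top at_infinity"
    and iv_super: "\<forall>\<alpha>. \<alpha> > \<alpha>\<^sub>0 \<longrightarrow>
                   ((\<lambda>t. \<bar>f t\<bar> / exp (\<alpha> * t\<^sup>2)) \<longlongrightarrow> 0) at_infinity"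
begin

section \<open>Growth of f and of its primitive\<close>

abbreviation "F \<equiv> primitive f"

lemma \<omega>_pos: "\<omega> > 0"
  using omega by (simp add: trudinger_moser_constant_def)

lemma f_borel [measurable]: "f \<in> borel_measurable borel"
  using f_cont by (rule borel_measurable_continuous_onI)

lemma F_0: "F 0 = 0"
  by (simp add: primitive_def)

lemma F_deriv: "(F has_real_derivative f t) (at t)"
proof -
  define a where "a = \<bar>t\<bar> + 1"
  have t: "-a < t" "t < a" "-a \<le> 0" "0 \<le> a" by (auto simp: a_def)
  have "((\<lambda>u. LBINT y=ereal 0..ereal u. f y) has_vector_derivative (f t)) (at t within {-a..a})"
    by (rule interval_integral_FTC2[OF t(3,4) continuous_on_subset[OF f_cont]]) (use t in auto)
  then have "((\<lambda>u. LBINT y=ereal 0..ereal u. f y) has_real_derivative (f t)) (at t within {-a..a})"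
    by (simp add: has_real_derivative_iff_has_vector_derivative)
  moreover have "(\<lambda>u. LBINT y=ereal 0..ereal u. f y) = F" by (simp add: primitive_def fun_eq_iff)
  moreover have "at t within {-a..a} = at t" using t by (intro at_within_Icc_at) auto
  ultimately show ?thesis by simp
qed

lemma F_cont: "continuous_on UNIV F"
  by (intro continuous_at_imp_continuous_on ballI DERIV_isCont[OF F_deriv])

lemma F_borel [measurable]: "F \<in> borel_measurable borel"
  using F_cont by (rule borel_measurable_continuous_onI)

lemma F_nonneg: "0 \<le> F t" and F_le: "2 * F t \<le> f t * t" and ft_nonneg: "0 \<le> f t * t"
proof -
  show "0 \<le> F t" using ii F_0 by (cases "t = 0") auto
  show le: "2 * F t \<le> f t * t" using ii F_0 by (cases "t = 0") auto
  show "0 \<le> f t * t" using le \<open>0 \<le> F t\<close> by linarith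
qed

lemma ft_abs: "f t * t = \<bar>f t\<bar> * \<bar>t\<bar>"
  using ft_nonneg[of t] by (simp add: abs_mult[symmetric])

lemma f_exp_bound:
  assumes "\<alpha> > \<alpha>\<^sub>0"
  obtains C where "C > 0" "\<And>t. \<bar>f t\<bar> \<le> C * exp (\<alpha> * t\<^sup>2)"
proof -
  have "((\<lambda>t. \<bar>f t\<bar> / exp (\<alpha> * t\<^sup>2)) \<longlongrightarrow> 0) at_infinity" using iv_super assms by blast
  then have "\<forall>\<^sub>F t in at_infinity. \<bar>f t\<bar> / exp (\<alpha> * t\<^sup>2) < 1" by (rule order_tendstoD(2)) simp
  then obtain B where B: "\<And>t. B \<le> \<bar>t\<bar> \<Longrightarrow> \<bar>f t\<bar> / exp (\<alpha> * t\<^sup>2) < 1"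
    by (auto simp: eventually_at_infinity)
  have "bounded (f ` {-\<bar>B\<bar>..\<bar>B\<bar>})"
    by (intro compact_imp_bounded compact_continuous_image continuous_on_subset[OF f_cont]) auto
  then obtain C where C: "C > 0" "\<forall>y\<in>f ` {-\<bar>B\<bar>..\<bar>B\<bar>}. norm y \<le> C" unfolding bounded_pos by blast
  have "\<bar>f t\<bar> \<le> (C + 1) * exp (\<alpha> * t\<^sup>2)" for t
  proof (cases "\<bar>t\<bar> \<le> \<bar>B\<bar>")
    case True
    then have "t \<in> {-\<bar>B\<bar>..\<bar>B\<bar>}" by auto
    then have "\<bar>f t\<bar> \<le> C" using C(2) by auto
    also have "\<dots> \<le> (C + 1) * 1" by simp
    also have "\<dots> \<le> (C + 1) * exp (\<alpha> * t\<^sup>2)" using C(1) assms \<alpha>\<^sub>0 by (intro mult_left_mono) auto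
    finally show ?thesis .
  next
    case False
    then have "\<bar>f t\<bar> < 1 * exp (\<alpha> * t\<^sup>2)" using B[of t] by (simp add: field_simps)
    also have "\<dots> \<le> (C + 1) * exp (\<alpha> * t\<^sup>2)" using C(1) by (intro mult_right_mono) auto
    finally show ?thesis by simp
  qed
  then show thesis using that[of "C + 1"] C(1) by auto
qed

text \<open>For large \<open>\<bar>t\<bar>\<close> condition (i) improves condition (ii) to \<open>4 * F t \<le> f t * t\<close>.\<close>

lemma ft_le_Ambrosetti_Rabinowitz:
  obtains C where "\<And>t. f t * t \<le> 4 * (f t * t / 2 - F t) + C"
proof -
  obtain t0 M where t0: "t0 > 0" "M > 0" "\<And>t. \<bar>t\<bar> \<ge> t0 \<Longrightarrow> F t \<le> M * \<bar>f t\<bar>" using i by blast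
  \<comment> \<open>For arguments of modulus at least \<open>4 * M\<close>, (i) gives \<open>4 * F t
    \<le> 4 * M * \<bar>f t\<bar> \<le> \<bar>t\<bar> * \<bar>f t\<bar>\<close>.\<close>
  define T where "T = max t0 (4 * M)"
  have "continuous_on {-T..T} (\<lambda>t. f t * t)"
    by (intro continuous_intros continuous_on_subset[OF f_cont]) auto
  then have "bounded ((\<lambda>t. f t * t) ` {-T..T})"
    by (intro compact_imp_bounded compact_continuous_image) auto
  then obtain C where C: "C > 0" "\<forall>y\<in>(\<lambda>t. f t * t) ` {-T..T}. norm y \<le> C" unfolding bounded_pos by blast
  have "f t * t \<le> 4 * (f t * t / 2 - F t) + C" for t
  proof (cases "\<bar>t\<bar> \<le> T")
    case True
    then have "t \<in> {-T..T}" by auto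
    then have "norm (f t * t) \<le> C" using C(2) by blast
    then have "f t * t \<le> C" unfolding real_norm_def by (rule order_trans[OF abs_ge_self])
    define a where "a = f t * t"
    have "a \<le> C" "2 * F t \<le> a" using \<open>f t * t \<le> C\<close> F_le[of t] by (auto simp: a_def)
    then have "a \<le> 4 * (a / 2 - F t) + C" by (simp add: algebra_simps)
    then show ?thesis unfolding a_def .
  next
    case False
    then have t: "\<bar>t\<bar> \<ge> t0" "4 * M \<le> \<bar>t\<bar>" by (auto simp: T_def)
    have "4 * F t \<le> 4 * M * \<bar>f t\<bar>" using t0(3)[OF t(1)] by simp
    also have "\<dots> \<le> \<bar>t\<bar> * \<bar>f t\<bar>" using t(2) by (intro mult_right_mono) auto
    finally have "4 * F t \<le> f t * t" unfolding ft_abs by (simp only: mult.commute)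
    define a where "a = f t * t"
    have "4 * F t \<le> a" using \<open>4 * F t \<le> f t * t\<close> by (simp only: a_def)
    then have "a \<le> 4 * (a / 2 - F t) + C" using C(1) by (simp add: algebra_simps)
    then show ?thesis unfolding a_def .
  qed
  then show thesis using that by blast
qed

text \<open>The growth in (iv) below the critical exponent gives
  \<open>2 * A * t\<^sup>2 \<le> f t * t\<close> for large arguments. Hence
  \<open>F t - A * t\<^sup>2\<close> grows outward from T and from -T, where it is at least
  \<open>- A * T\<^sup>2\<close>.\<close>

lemma F_superquadratic:
  assumes A: "A \<ge> 0"
  obtains C where "C \<ge> 0" "\<And>t. A * t\<^sup>2 - C \<le> F t"
proof -
  define a where "a = \<alpha>\<^sub>0 / 2"
  have a: "0 < a" "a < \<alpha>\<^sub>0" using \<alpha>\<^sub>0 by (auto simp: a_def)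
  then have "filterlim (\<lambda>t. \<bar>f t\<bar> / exp (a * t\<^sup>2)) at_top at_infinity" using iv_sub by blast
  then have "\<forall>\<^sub>F t in at_infinity. 2 * A / a \<le> \<bar>f t\<bar> / exp (a * t\<^sup>2)" by (simp add: filterlim_at_top)
  then obtain B where B: "\<And>t. B \<le> \<bar>t\<bar> \<Longrightarrow> 2 * A / a \<le> \<bar>f t\<bar> / exp (a * t\<^sup>2)"
    by (auto simp: eventually_at_infinity)
  define T where "T = max 1 B"
  have T: "T \<ge> 1" by (simp add: T_def)
  have big: "2 * A * t\<^sup>2 \<le> f t * t" if "\<bar>t\<bar> \<ge> T" for t
  proof -
    have t: "\<bar>t\<bar> \<ge> 1" "\<bar>t\<bar> \<ge> B" using that by (auto simp: T_def)
    have "2 * A * \<bar>t\<bar> \<le> 2 * A * (\<bar>t\<bar> * \<bar>t\<bar>)"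
      using t(1) A mult_left_mono[of 1 "\<bar>t\<bar>" "\<bar>t\<bar>"] by (intro mult_left_mono) auto
    also have "\<dots> = 2 * A / a * (a * t\<^sup>2)" using a by (simp add: power2_eq_square)
    also have "\<dots> \<le> 2 * A / a * exp (a * t\<^sup>2)"
    proof (rule mult_left_mono)
      show "a * t\<^sup>2 \<le> exp (a * t\<^sup>2)" using exp_ge_add_one_self[of "a * t\<^sup>2"] by linarith
    qed (use a A in simp)
    also have "\<dots> \<le> \<bar>f t\<bar>" using B[OF t(2)] by (simp add: pos_le_divide_eq)
    finally have "2 * A * \<bar>t\<bar> * \<bar>t\<bar> \<le> \<bar>f t\<bar> * \<bar>t\<bar>" by (intro mult_right_mono) auto
    then show ?thesis by (simp add: ft_abs power2_eq_square mult.assoc)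
  qed
  define D where "D t = F t - A * t\<^sup>2" for t
  have D_deriv: "(D has_real_derivative (f t - 2 * A * t)) (at t)" for t
    unfolding D_def by (auto intro!: derivative_eq_intros F_deriv)
  have "A * t\<^sup>2 - A * T\<^sup>2 \<le> F t" for t
  proof -
    consider "\<bar>t\<bar> \<le> T" | "t > T" | "t < -T" by linarith
    then show ?thesis
    proof cases
      case 1
      then have "t\<^sup>2 \<le> T\<^sup>2" using T by (simp add: abs_le_square_iff[symmetric])
      then have "A * t\<^sup>2 \<le> A * T\<^sup>2" using A by (rule mult_left_mono)
      then show ?thesis using F_nonneg[of t] by linarith
    next
      case 2
      have "D T \<le> D t"
      proof (rule DERIV_nonneg_imp_nondecreasing[of T t D])
        fix s assume s: "T \<le> s" "s \<le> t"
        then have "2 * A * s * s \<le> f s * s" using big[of s] T by (simp add: power2_eq_square mult.assoc)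
        then have "2 * A * s \<le> f s" using s T by (simp add: mult_le_cancel_right)
        then show "\<exists>y. (D has_real_derivative y) (at s) \<and> 0 \<le> y" using D_deriv[of s] by auto
      qed (use 2 in simp)
      then show ?thesis using F_nonneg[of T] by (simp add: D_def)
    next
      case 3
      have "D (-T) \<le> D t"
      proof (rule DERIV_nonpos_imp_nonincreasing[of t "-T" D])
        fix s assume s: "t \<le> s" "s \<le> -T"
        then have "2 * A * s * s \<le> f s * s" using big[of s] T by (simp add: power2_eq_square mult.assoc)
        then have "f s \<le> 2 * A * s" using s T by (simp add: mult_le_cancel_right)
        then show "\<exists>y. (D has_real_derivative y) (at s) \<and> y \<le> 0" using D_deriv[of s] by auto
      qed (use 3 in simp)
      then show ?thesis using F_nonneg[of "-T"] by (simp add: D_def)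
    qed
  qed
  then show thesis using that[of "A * T\<^sup>2"] A by auto
qed

lemma F_near_0:
  obtains y \<delta> where "0 < y" "y < lambda1 / (4 * pi)" "\<delta> > 0" "\<And>t. \<bar>t\<bar> \<le> \<delta> \<Longrightarrow> F t \<le> y * t\<^sup>2"
proof -
  obtain z where z: "Limsup (at 0) (\<lambda>t. ereal (F t / t\<^sup>2)) < ereal z" "ereal z < ereal (lambda1 / (4 * pi))"
    using ereal_dense2[OF iii] by blast
  have "\<forall>\<^sub>F t in at 0. ereal (F t / t\<^sup>2) < ereal z" by (rule Limsup_lessD[OF z(1)])
  then obtain d where d: "d > 0" "\<And>t. t \<noteq> 0 \<Longrightarrow> \<bar>t\<bar> < d \<Longrightarrow> F t / t\<^sup>2 < z"
    by (auto simp: eventually_at dist_real_def)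
  have "0 < F (d / 2) / (d / 2)\<^sup>2" using ii d(1) by simp
  also have "\<dots> < z" using d by simp
  finally have z0: "z > 0" .
  show thesis
  proof (rule that[OF z0])
    show "z < lambda1 / (4 * pi)" using z(2) by simp
    show "d / 2 > 0" using d by simp
    show "F t \<le> z * t\<^sup>2" if "\<bar>t\<bar> \<le> d / 2" for t
    proof (cases "t = 0")
      case False
      then have "F t / t\<^sup>2 < z" using that d by simp
      then show ?thesis using False by (simp add: divide_less_eq)
    qed (simp add: F_0)
  qed
qed

text \<open>F is positive away from 0 by (ii), so the quotient in (iii) is positive, and a number
  above it near 0 still lies below \<open>lambda1 / (4 * pi)\<close>.\<close>

lemma lambda1_pos: "lambda1 > 0"
proof -
  obtain y where "0 < y" "y < lambda1 / (4 * pi)" using F_near_0 by metis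
  then have "0 < lambda1 / (4 * pi)" by linarith
  then show ?thesis by (simp add: zero_less_divide_iff)
qed

section \<open>Integrability of the nonlinear terms and the energy near the origin\<close>

lemma Poincare: "u \<in> X_space \<Longrightarrow> (LINT x|I01. (u x)\<^sup>2) \<le> (X_norm u)\<^sup>2 / lambda1"
  using lambda1_Poincare[of u] lambda1_pos by (simp add: pos_le_divide_eq mult.commute)

lemma exp_sqint:
  assumes "u \<in> X_space" shows "sqint I01 (\<lambda>x. exp (a * (u x)\<^sup>2))"
proof -
  note [measurable] = X_borel[OF assms]
  have "(norm (exp (a * (u x)\<^sup>2)))\<^sup>2 = exp (2 * a * (u x)\<^sup>2)" for x
    by (simp add: power2_eq_square exp_add[symmetric])
  then show ?thesis unfolding sqint_def using X_exp_integrable[OF omega assms, of "2 * a"] by simp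
qed

text \<open>Critical growth is harmless for a fixed element of X, since all exponentials of its
  square are integrable. Consequently every element of X is admissible as a test function.\<close>

lemma f_sqint:
  assumes u: "u \<in> X_space" shows "sqint I01 (\<lambda>x. f (u x))"
proof -
  note [measurable] = X_borel[OF u]
  obtain C where C: "C > 0" "\<And>t. \<bar>f t\<bar> \<le> C * exp ((\<alpha>\<^sub>0 + 1) * t\<^sup>2)" using f_exp_bound[of "\<alpha>\<^sub>0 + 1"] by auto
  show ?thesis
    by (rule sqint_dominated[OF sqint_cmult[OF exp_sqint[OF u], of C "\<alpha>\<^sub>0 + 1"]])
      (use C in \<open>auto simp: abs_mult\<close>)
qed

lemma fv_integrable: "u \<in> X_space \<Longrightarrow> v \<in> X_space \<Longrightarrow> integrable I01 (\<lambda>x. f (u x) * v x)"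
  by (intro sqint_mult_integrable f_sqint X_sqint_I01)

lemma F_integrable:
  assumes u: "u \<in> X_space" shows "integrable I01 (\<lambda>x. F (u x))"
proof -
  note [measurable] = X_borel[OF u]
  show ?thesis
  proof (rule Bochner_Integration.integrable_bound[OF fv_integrable[OF u u]])
    show "AE x in I01. norm (F (u x)) \<le> norm (f (u x) * u x)"
    proof (intro AE_I2)
      fix x show "norm (F (u x)) \<le> norm (f (u x) * u x)"
        using F_le[of "u x"] F_nonneg[of "u x"] ft_nonneg[of "u x"] unfolding real_norm_def by linarith
    qed
  qed measurable
qed

text \<open>Half of the quadratic form of the equation: the factor 1 / (4 pi) makes the derivative
  \<open>X_inner u v / (2 * pi)\<close> minus the integral of f(u) v, the difference of the two
  sides of the weak formulation.\<close>

definition \<Phi> :: "(real \<Rightarrow> real) \<Rightarrow> real" where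
  "\<Phi> u = (X_norm u)\<^sup>2 / (4 * pi) - (LINT x|I01. F (u x))"

text \<open>With y = \<beta> z / 2, half of the exponent absorbs
  \<open>y\<^sup>2 / 2 \<le> exp y - 1\<close>. Keeping the -1 on the right gives exactly the
  integrand of the Trudinger-Moser inequality.\<close>

lemma pow4_exp_le:
  fixes z :: real
  assumes "\<beta> > 0" "z \<ge> 0"
  shows "z\<^sup>2 * exp (\<beta> * z / 2) \<le> 8 / \<beta>\<^sup>2 * (exp (\<beta> * z) - 1)"
proof -
  define y where "y = \<beta> * z / 2"
  have y: "y \<ge> 0" using assms by (simp add: y_def)
  have "exp y * (y\<^sup>2 / 2) \<le> exp y * (exp y - 1)"
    using exp_lower_Taylor_quadratic[OF y] y by (intro mult_left_mono) auto
  also have "\<dots> = exp (2 * y) - exp y" by (simp add: right_diff_distrib flip: exp_add)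
  also have "\<dots> \<le> exp (2 * y) - 1" using y by simp
  finally have "z\<^sup>2 * exp y * (\<beta>\<^sup>2 / 8) \<le> exp (2 * y) - 1"
    by (simp add: y_def power_mult_distrib power_divide mult_ac)
  then show ?thesis using assms by (simp add: y_def field_simps)
qed

text \<open>F is at most a quadratic term with coefficient below \<open>lambda1 / (4 * pi)\<close>
  plus a quartic term with exponential factor. For \<open>(X_norm u)\<^sup>2 = s\<close> the
  quadratic part leaves a gain \<open>\<kappa> * s\<close>, while the quartic part costs only a
  multiple of \<open>s\<^sup>2\<close>.\<close>

lemma mountain_ridge:
  obtains r \<rho> where "r > 0" "\<rho> > 0" "\<And>u. u \<in> X_space \<Longrightarrow> X_norm u = r \<Longrightarrow> \<rho> \<le> \<Phi> u"
proof -
  obtain y \<delta> where y: "0 < y" "y < lambda1 / (4 * pi)" and \<delta>: "\<delta> > 0" "\<And>t. \<bar>t\<bar> \<le> \<delta> \<Longrightarrow> F t \<le> y * t\<^sup>2"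
    using F_near_0 by metis
  define \<alpha> where "\<alpha> = \<alpha>\<^sub>0 + 1"
  have \<alpha>: "\<alpha> > 0" using \<alpha>\<^sub>0 by (simp add: \<alpha>_def)
  obtain C where C: "C > 0" "\<And>t. \<bar>f t\<bar> \<le> C * exp (\<alpha> * t\<^sup>2)" using f_exp_bound[of \<alpha>] by (auto simp: \<alpha>_def)
  define \<beta> where "\<beta> = \<omega> / 2"
  have \<beta>: "0 < \<beta>" "\<beta> < \<omega>" using \<omega>_pos by (auto simp: \<beta>_def)
  obtain H where H: "H > 0"
    "\<And>u. u \<in> X_space \<Longrightarrow> (X_norm u)\<^sup>2 \<le> 2 * pi \<Longrightarrow> integrable I01 (\<lambda>x. exp (\<beta> * (u x)\<^sup>2))"
    "\<And>u. u \<in> X_space \<Longrightarrow> (X_norm u)\<^sup>2 \<le> 2 * pi \<Longrightarrow>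
       (LINT x|I01. exp (\<beta> * (u x)\<^sup>2) - 1) \<le> H * (LINT x|I01. (u x)\<^sup>2)"
    using Trudinger_Moser_X[OF omega \<beta>] by blast
  \<comment> \<open>Beyond \<delta> the factor \<open>(\<bar>t\<bar> / \<delta>) ^ 3 \<ge> 1\<close>
    raises the linear bound for \<open>f t * t\<close> to fourth order.\<close>
  define E where "E = C / \<delta> ^ 3"
  have E: "E > 0" using C \<delta> by (simp add: E_def)
  have F_bound: "F t \<le> y * t\<^sup>2 + E * ((t\<^sup>2)\<^sup>2 * exp (\<alpha> * t\<^sup>2))" for t
  proof (cases "\<bar>t\<bar> \<le> \<delta>")
    case True
    have "0 \<le> E * ((t\<^sup>2)\<^sup>2 * exp (\<alpha> * t\<^sup>2))" using E by simp
    then show ?thesis using \<delta>(2)[OF True] by linarith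
  next
    case False
    have "1 \<le> (\<bar>t\<bar> / \<delta>) ^ 3" using False \<delta> by (intro one_le_power) simp
    have "F t \<le> f t * t" using F_le[of t] F_nonneg[of t] by linarith
    also have "\<dots> = \<bar>f t\<bar> * \<bar>t\<bar>" by (rule ft_abs)
    also have "\<dots> \<le> (C * exp (\<alpha> * t\<^sup>2)) * \<bar>t\<bar>" by (intro mult_right_mono C) simp
    also have "\<dots> \<le> (C * exp (\<alpha> * t\<^sup>2)) * \<bar>t\<bar> * (\<bar>t\<bar> / \<delta>) ^ 3"
      using \<open>1 \<le> (\<bar>t\<bar> / \<delta>) ^ 3\<close> C(1) mult_left_mono[of 1 "(\<bar>t\<bar> / \<delta>) ^ 3" "(C * exp (\<alpha> * t\<^sup>2)) * \<bar>t\<bar>"] by simp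
    also have "\<dots> = E * (\<bar>t\<bar> ^ 4 * exp (\<alpha> * t\<^sup>2))"
      by (simp add: E_def power_divide power4_eq_xxxx power3_eq_cube)
    also have "\<bar>t\<bar> ^ 4 = (t\<^sup>2)\<^sup>2" by (simp flip: power_mult)
    finally show ?thesis using y by (simp add: add_increasing)
  qed
  define \<kappa> where "\<kappa> = 1 / (4 * pi) - y / lambda1"
  have \<kappa>: "\<kappa> > 0" using y lambda1_pos by (simp add: \<kappa>_def field_simps)
  define D where "D = E * (8 / \<beta>\<^sup>2) * H / (2 * pi * lambda1)"
  have D: "D > 0" using E \<beta> H lambda1_pos by (simp add: D_def)
  \<comment> \<open>The first bound keeps the quartic loss below half of the gain
    \<open>\<kappa> * s\<close>; the second keeps the exponent, after normalizing u to
    \<open>w\<close>, at most \<open>\<beta> / 2\<close>, as \<open>pow4_exp_le\<close>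
    requires.\<close>
  define s where "s = min (\<kappa> / (2 * D)) (pi * \<beta> / \<alpha>)"
  have s: "s > 0" "D * s \<le> \<kappa> / 2" "\<alpha> * s / (2 * pi) \<le> \<beta> / 2"
  proof -
    show "s > 0" using \<kappa> D \<beta> \<alpha> by (simp add: s_def)
    have "D * s \<le> D * (\<kappa> / (2 * D))" using D by (intro mult_left_mono) (auto simp: s_def)
    then show "D * s \<le> \<kappa> / 2" using D by simp
    have "\<alpha> * s \<le> \<alpha> * (pi * \<beta> / \<alpha>)" using \<alpha> by (intro mult_left_mono) (auto simp: s_def)
    then show "\<alpha> * s / (2 * pi) \<le> \<beta> / 2" using \<alpha> by (simp add: field_simps)
  qed
  have main: "s * \<kappa> / 2 \<le> \<Phi> u" if u: "u \<in> X_space" and ur: "(X_norm u)\<^sup>2 = s" for u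
  proof -
    note [measurable] = X_borel[OF u]
    define w where "w x = sqrt (2 * pi / s) * u x" for x
    have w: "w \<in> X_space" unfolding w_def by (rule X_cmult[OF u])
    have wn: "(X_norm w)\<^sup>2 = 2 * pi" unfolding w_def X_norm_cmult ur using s by simp
    have w_sq: "(w x)\<^sup>2 = 2 * pi / s * (u x)\<^sup>2" for x using s by (simp add: w_def power_mult_distrib)
    have u_sq: "(u x)\<^sup>2 = s / (2 * pi) * (w x)\<^sup>2" for x unfolding w_sq using s by simp
    have e_int: "integrable I01 (\<lambda>x. exp (\<beta> * (w x)\<^sup>2) - 1)" using H(2)[OF w] wn by simp
    have le: "(LINT x|I01. exp (\<beta> * (w x)\<^sup>2) - 1) \<le> H * (2 * pi / lambda1)"
    proof -
      have "(LINT x|I01. exp (\<beta> * (w x)\<^sup>2) - 1) \<le> H * (LINT x|I01. (w x)\<^sup>2)" using H(3)[OF w] wn by simp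
      also have "\<dots> \<le> H * (2 * pi / lambda1)" using Poincare[OF w] H(1) wn by (intro mult_left_mono) auto
      finally show ?thesis .
    qed
    define Z where "Z = E * ((s / (2 * pi))\<^sup>2 * (8 / \<beta>\<^sup>2))"
    have Z: "Z \<ge> 0" using E by (simp add: Z_def)
    have pt: "F (u x) \<le> y * (u x)\<^sup>2 + Z * (exp (\<beta> * (w x)\<^sup>2) - 1)" for x
    proof -
      have "\<alpha> * (u x)\<^sup>2 = \<alpha> * s / (2 * pi) * (w x)\<^sup>2" by (simp add: u_sq)
      also have "\<dots> \<le> \<beta> / 2 * (w x)\<^sup>2" by (intro mult_right_mono s(3)) simp
      finally have "exp (\<alpha> * (u x)\<^sup>2) \<le> exp (\<beta> * (w x)\<^sup>2 / 2)" by simp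
      then have "((u x)\<^sup>2)\<^sup>2 * exp (\<alpha> * (u x)\<^sup>2) \<le> ((u x)\<^sup>2)\<^sup>2 * exp (\<beta> * (w x)\<^sup>2 / 2)" by (intro mult_left_mono) auto
      also have "\<dots> = (s / (2 * pi))\<^sup>2 * (((w x)\<^sup>2)\<^sup>2 * exp (\<beta> * (w x)\<^sup>2 / 2))"
        unfolding u_sq[of x] power_mult_distrib by (simp only: mult.assoc)
      also have "\<dots> \<le> (s / (2 * pi))\<^sup>2 * (8 / \<beta>\<^sup>2 * (exp (\<beta> * (w x)\<^sup>2) - 1))"
        by (intro mult_left_mono pow4_exp_le \<beta>) auto
      finally have "E * (((u x)\<^sup>2)\<^sup>2 * exp (\<alpha> * (u x)\<^sup>2)) \<le> E * ((s / (2 * pi))\<^sup>2 * (8 / \<beta>\<^sup>2 * (exp (\<beta> * (w x)\<^sup>2) - 1)))"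
        using E by (intro mult_left_mono) auto
      then show ?thesis using F_bound[of "u x"] by (simp add: Z_def mult.assoc)
    qed
    note u2 = sqint_integrable_real[OF X_sqint_I01[OF u]]
    have "(LINT x|I01. F (u x)) \<le> (LINT x|I01. y * (u x)\<^sup>2 + Z * (exp (\<beta> * (w x)\<^sup>2) - 1))"
      using u2 e_int by (intro integral_mono pt F_integrable u) auto
    also have "\<dots> = y * (LINT x|I01. (u x)\<^sup>2) + Z * (LINT x|I01. exp (\<beta> * (w x)\<^sup>2) - 1)"
      using u2 e_int by simp
    also have "\<dots> \<le> y * (s / lambda1) + Z * (H * (2 * pi / lambda1))"
      using Poincare[OF u] ur y Z le by (intro add_mono mult_left_mono) auto
    also have "Z * (H * (2 * pi / lambda1)) = D * s * s"
      by (simp add: Z_def D_def power2_eq_square field_simps)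
    also have "D * s * s \<le> \<kappa> / 2 * s" using s by (intro mult_right_mono) auto
    finally have "(LINT x|I01. F (u x)) \<le> y * (s / lambda1) + \<kappa> / 2 * s" by simp
    moreover have "s / (4 * pi) - y * (s / lambda1) = \<kappa> * s" by (simp add: \<kappa>_def algebra_simps)
    ultimately show ?thesis unfolding \<Phi>_def ur by (simp add: algebra_simps)
  qed
  show thesis
  proof (rule that[of "sqrt s" "s * \<kappa> / 2"])
    show "s * \<kappa> / 2 \<le> \<Phi> u" if "u \<in> X_space" "X_norm u = sqrt s" for u
      using main[OF that(1)] that(2) s(1) by simp
  qed (use s \<kappa> in auto)
qed

end

subsection \<open>Galerkin approximation\<close>

text \<open>Coefficients are sequences of which only the first m count, so subspaces of all
  dimensions share one coefficient type and \<open>compact_box\<close> applies to them.\<close>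

definition lin_comb :: "nat \<Rightarrow> (nat \<Rightarrow> real \<Rightarrow> real) \<Rightarrow> (nat \<Rightarrow> real) \<Rightarrow> real \<Rightarrow> real" where
  "lin_comb m b c x = (\<Sum>i<m. c i * b i x)"

definition lin_indep :: "nat \<Rightarrow> (nat \<Rightarrow> real \<Rightarrow> real) \<Rightarrow> bool" where
  "lin_indep m b \<longleftrightarrow> (\<forall>c. (AE x in lborel. lin_comb m b c x = 0) \<longrightarrow> (\<forall>i<m. c i = 0))"

lemma X_norm_AE_zero:
  assumes u: "u \<in> X_space" and "AE x in lborel. u x = 0" shows "X_norm u = 0"
proof -
  have "AE z in lborel. gagliardo_quotient u z = gagliardo_quotient (\<lambda>_. 0) z"
    by (rule gagliardo_quotient_cong_AE[OF assms(2)])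
  then have "(LINT z|lborel. gagliardo_quotient u z) = 0"
    by (intro integral_eq_zero_AE) (auto simp: gagliardo_quotient_def elim!: eventually_mono split: prod.splits)
  then show ?thesis by (simp add: gagliardo_seminorm_def)
qed

text \<open>The next function is adjoined only if it is not almost everywhere a combination of the
  previous ones. \<open>\<psi>\<close> remains the first basis element, so its ray, which controls
  the level, lies in every subspace.\<close>

lemma lin_indep_extraction:
  fixes d :: "nat \<Rightarrow> real \<Rightarrow> real" and n :: nat
  assumes \<psi>: "\<psi> \<in> X_space" "X_norm \<psi> = 1" and d: "\<And>k. d k \<in> X_space"
  shows "\<exists>m b. 0 < m \<and> b 0 = \<psi> \<and> (\<forall>i<m. b i \<in> X_space) \<and> lin_indep m b
    \<and> (\<forall>k<n. \<exists>c. AE x in lborel. d k x = lin_comb m b c x)"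
proof (induction n)
  case 0
  have "lin_indep 1 (\<lambda>_. \<psi>)"
    unfolding lin_indep_def
  proof (intro allI impI)
    fix c :: "nat \<Rightarrow> real" and i
    assume ae: "AE x in lborel. lin_comb 1 (\<lambda>_. \<psi>) c x = 0" and "i < (1::nat)"
    show "c i = 0"
    proof (rule ccontr)
      assume "c i \<noteq> 0"
      then have "AE x in lborel. \<psi> x = 0" using ae \<open>i < 1\<close> by (auto simp: lin_comb_def elim!: eventually_mono)
      then show False using X_norm_AE_zero[OF \<psi>(1)] \<psi>(2) by simp
    qed
  qed
  then show ?case using \<psi> by (intro exI[of _ 1] exI[of _ "\<lambda>_. \<psi>"]) auto
next
  case (Suc n)
  then obtain m b where b: "0 < m" "b 0 = \<psi>" "\<forall>i<m. b i \<in> X_space" "lin_indep m b"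
    "\<forall>k<n. \<exists>c. AE x in lborel. d k x = lin_comb m b c x" by blast
  show ?case
  proof (cases "\<exists>c. AE x in lborel. d n x = lin_comb m b c x")
    case True
    then show ?thesis using b by (intro exI[of _ m] exI[of _ b]) (auto simp: less_Suc_eq)
  next
    case False
    define b' where "b' = b(m := d n)"
    have lc: "lin_comb (Suc m) b' c x = lin_comb m b c x + c m * d n x" for c x
      by (simp add: lin_comb_def b'_def)
    have "lin_indep (Suc m) b'"
      unfolding lin_indep_def
    proof (intro allI impI)
      fix c :: "nat \<Rightarrow> real" and i
      assume ae: "AE x in lborel. lin_comb (Suc m) b' c x = 0" and i: "i < Suc m"
      have cm: "c m = 0"
      proof (rule ccontr)
        assume "c m \<noteq> 0"
        from ae have "AE x in lborel. d n x = lin_comb m b (\<lambda>i. - c i / c m) x"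
        proof eventually_elim
          fix x assume "lin_comb (Suc m) b' c x = 0"
          then have "c m * d n x = - lin_comb m b c x" by (simp add: lc)
          then have "d n x = - lin_comb m b c x / c m" using \<open>c m \<noteq> 0\<close> by (simp add: field_simps)
          also have "\<dots> = lin_comb m b (\<lambda>i. - c i / c m) x"
            by (simp add: lin_comb_def sum_divide_distrib sum_negf)
          finally show "d n x = lin_comb m b (\<lambda>i. - c i / c m) x" .
        qed
        then show False using False by blast
      qed
      then have "AE x in lborel. lin_comb m b c x = 0" using ae by (simp add: lc)
      then show "c i = 0" using b(4) cm i unfolding lin_indep_def less_Suc_eq by blast
    qed
    moreover have "\<exists>c. AE x in lborel. d k x = lin_comb (Suc m) b' c x" if "k < Suc n" for k
    proof (cases "k = n")
      case True
      have "lin_comb m b (\<lambda>i. if i = m then 1 else 0) x = 0" for x by (simp add: lin_comb_def)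
      then show ?thesis using True by (intro exI[of _ "\<lambda>i. if i = m then 1 else 0"]) (simp add: lc)
    next
      case False
      then have "k < n" using that by simp
      then obtain c where "AE x in lborel. d k x = lin_comb m b c x" using b(5) by blast
      moreover have "lin_comb m b (c(m := 0)) x = lin_comb m b c x" for x
        unfolding lin_comb_def by (intro sum.cong) auto
      ultimately show ?thesis by (intro exI[of _ "c(m := 0)"]) (simp add: lc)
    qed
    moreover have "b' 0 = \<psi>" "\<forall>i<Suc m. b' i \<in> X_space"
      using b(1-3) d by (auto simp: b'_def less_Suc_eq)
    ultimately show ?thesis
      using zero_less_Suc[of m] by blast
  qed
qed

lemma X_lin_comb: "(\<And>i. i < m \<Longrightarrow> b i \<in> X_space) \<Longrightarrow> lin_comb m b c \<in> X_space"
  unfolding lin_comb_def[abs_def] by (intro X_sum) auto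

lemma X_inner_lin_comb_left:
  assumes "\<And>i. i < m \<Longrightarrow> b i \<in> X_space" "v \<in> X_space"
  shows "X_inner (lin_comb m b c) v = (\<Sum>i<m. c i * X_inner (b i) v)"
  unfolding lin_comb_def[abs_def] using assms by (intro X_inner_sum_left) auto

lemma X_inner_lin_comb:
  assumes b: "\<And>i. i < m \<Longrightarrow> b i \<in> X_space"
  shows "X_inner (lin_comb m b c) (lin_comb m b w) = (\<Sum>i<m. c i * (\<Sum>j<m. w j * X_inner (b j) (b i)))"
proof -
  have "X_inner (b i) (lin_comb m b w) = (\<Sum>j<m. w j * X_inner (b j) (b i))" if "i < m" for i
    using X_inner_lin_comb_left[OF b b[OF that], where c = w] by (simp add: X_inner_commute)
  then show ?thesis by (simp add: X_inner_lin_comb_left[OF b X_lin_comb[OF b]])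
qed

lemma X_abs: "u \<in> X_space \<Longrightarrow> (\<lambda>x. \<bar>u x\<bar>) \<in> X_space"
  by (rule X_Lipschitz_image(1)[of u]) (auto dest: X_borel)

section \<open>Continuity and differentiability of the energy on finite-dimensional
  subspaces\<close>

context nonlinearity
begin

text \<open>Combinations of finitely many elements of X with bounded coefficients are dominated by a
  multiple of one W in X, the sum of their absolute values. The present function then dominates the
  integrands in the limit theorems that follow.\<close>

lemma dominating_integrable:
  assumes "W \<in> X_space"
  shows "integrable I01 (\<lambda>x. (C * exp (a * (W x)\<^sup>2)) * (B * W x))"
  by (intro sqint_mult_integrable sqint_cmult exp_sqint X_sqint_I01 assms)

lemma f_le_dominating:
  assumes C: "\<And>t. \<bar>f t\<bar> \<le> C * exp (\<alpha> * t\<^sup>2)" and pos: "C > 0" "\<alpha> > 0" and t: "\<bar>t\<bar> \<le> B * w"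
  shows "\<bar>f t\<bar> \<le> C * exp (\<alpha> * B\<^sup>2 * w\<^sup>2)"
proof -
  have "t\<^sup>2 \<le> (B * w)\<^sup>2" using power_mono[OF t, of 2] by simp
  then have "\<alpha> * t\<^sup>2 \<le> \<alpha> * (B\<^sup>2 * w\<^sup>2)" using pos by (intro mult_left_mono) (auto simp: power_mult_distrib)
  then have "C * exp (\<alpha> * t\<^sup>2) \<le> C * exp (\<alpha> * B\<^sup>2 * w\<^sup>2)" using pos by (intro mult_left_mono) (auto simp: mult.assoc)
  then show ?thesis using C[of t] by linarith
qed

lemma tendsto_integral_f:
  assumes W: "W \<in> X_space"
    and [measurable]: "\<And>k. u k \<in> borel_measurable borel" "u\<^sub>0 \<in> borel_measurable borel"
      "\<And>k. h k \<in> borel_measurable borel" "h\<^sub>0 \<in> borel_measurable borel"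
    and u: "\<And>k x. \<bar>u k x\<bar> \<le> B * W x" and h: "\<And>k x. \<bar>h k x\<bar> \<le> B' * W x"
    and lim: "\<And>x. (\<lambda>k. u k x) \<longlonglongrightarrow> u\<^sub>0 x" "\<And>x. (\<lambda>k. h k x) \<longlonglongrightarrow> h\<^sub>0 x"
  shows "(\<lambda>k. LINT x|I01. f (u k x) * h k x) \<longlonglongrightarrow> (LINT x|I01. f (u\<^sub>0 x) * h\<^sub>0 x)"
proof -
  obtain C where C: "C > 0" "\<And>t. \<bar>f t\<bar> \<le> C * exp ((\<alpha>\<^sub>0 + 1) * t\<^sup>2)" using f_exp_bound[of "\<alpha>\<^sub>0 + 1"] by auto
  have \<alpha>: "\<alpha>\<^sub>0 + 1 > 0" using \<alpha>\<^sub>0 by simp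
  show ?thesis
  proof (rule integral_dominated_convergence[OF _ _ dominating_integrable[OF W, of C "(\<alpha>\<^sub>0 + 1) * B\<^sup>2" B']])
    show "AE x in I01. (\<lambda>k. f (u k x) * h k x) \<longlonglongrightarrow> f (u\<^sub>0 x) * h\<^sub>0 x"
      by (intro AE_I2 tendsto_mult lim continuous_on_tendsto_compose[OF f_cont lim(1)]) auto
    show "AE x in I01. norm (f (u k x) * h k x) \<le> C * exp ((\<alpha>\<^sub>0 + 1) * B\<^sup>2 * (W x)\<^sup>2) * (B' * W x)" for k
      unfolding real_norm_def abs_mult
      using f_le_dominating[OF C(2,1) \<alpha> u] h C(1) by (intro AE_I2 mult_mono) auto
  qed measurable
qed

lemma F_mean_value: "\<exists>z. \<bar>z - a\<bar> \<le> \<bar>h\<bar> \<and> F (a + h) - F a = h * f z"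
proof -
  consider "h = 0" | "h > 0" | "h < 0" by linarith
  then show ?thesis
  proof cases
    case 2
    then obtain z where "a < z" "z < a + h" "F (a + h) - F a = (a + h - a) * f z"
      using MVT2[of a "a + h" F f] F_deriv by auto
    then show ?thesis using 2 by (intro exI[of _ z]) auto
  next
    case 3
    then obtain z where "a + h < z" "z < a" "F a - F (a + h) = (a - (a + h)) * f z"
      using MVT2[of "a + h" a F f] F_deriv by auto
    then show ?thesis using 3 by (intro exI[of _ z]) auto
  qed (auto intro: exI[of _ a])
qed

text \<open>By the mean value theorem the quotient equals \<open>f (z k x) * h k x\<close> with
  intermediate points \<open>z k x\<close> that tend to the limit of \<open>u k x\<close> and are
  dominated like it. Moving base points and directions are allowed because the flow argument
  produces them.\<close>

lemma tendsto_integral_F_quotient: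
  assumes W: "W \<in> X_space" and B: "B \<ge> 0" "B' \<ge> 0"
    and [measurable]: "\<And>k. u k \<in> borel_measurable borel" "u\<^sub>0 \<in> borel_measurable borel"
      "\<And>k. h k \<in> borel_measurable borel" "h\<^sub>0 \<in> borel_measurable borel"
    and u: "\<And>k x. \<bar>u k x\<bar> \<le> B * W x" and h: "\<And>k x. \<bar>h k x\<bar> \<le> B' * W x"
    and lim: "\<And>x. (\<lambda>k. u k x) \<longlonglongrightarrow> u\<^sub>0 x" "\<And>x. (\<lambda>k. h k x) \<longlonglongrightarrow> h\<^sub>0 x"
    and \<delta>: "\<And>k. 0 < \<delta> k" "\<delta> \<longlonglongrightarrow> 0"
  shows "(\<lambda>k. LINT x|I01. (F (u k x + \<delta> k * h k x) - F (u k x)) / \<delta> k) \<longlonglongrightarrow> (LINT x|I01. f (u\<^sub>0 x) * h\<^sub>0 x)"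
proof -
  obtain C where C: "C > 0" "\<And>t. \<bar>f t\<bar> \<le> C * exp ((\<alpha>\<^sub>0 + 1) * t\<^sup>2)" using f_exp_bound[of "\<alpha>\<^sub>0 + 1"] by auto
  have \<alpha>: "\<alpha>\<^sub>0 + 1 > 0" using \<alpha>\<^sub>0 by simp
  obtain D where D: "D > 0" "\<And>k. \<bar>\<delta> k\<bar> \<le> D"
    using convergent_imp_Bseq[OF convergentI[OF \<delta>(2)]] unfolding Bseq_def by auto
  have "\<forall>k x. \<exists>z. \<bar>z - u k x\<bar> \<le> \<bar>\<delta> k * h k x\<bar> \<and> F (u k x + \<delta> k * h k x) - F (u k x) = (\<delta> k * h k x) * f z"
    using F_mean_value by blast
  \<comment> \<open>The points are chosen separately for each x; measurability of the integrand is
    taken from the difference quotient instead.\<close>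
  then obtain z where z: "\<And>k x. \<bar>z k x - u k x\<bar> \<le> \<bar>\<delta> k * h k x\<bar>"
    "\<And>k x. F (u k x + \<delta> k * h k x) - F (u k x) = (\<delta> k * h k x) * f (z k x)" by metis
  have quot: "(F (u k x + \<delta> k * h k x) - F (u k x)) / \<delta> k = f (z k x) * h k x" for k x
    using \<delta>(1)[of k] z(2)[of k x] by simp
  have z_le: "\<bar>z k x\<bar> \<le> (B + D * B') * W x" for k x
  proof -
    have "\<bar>\<delta> k * h k x\<bar> \<le> D * (B' * W x)" unfolding abs_mult using D h by (intro mult_mono) auto
    then show ?thesis using z(1)[of k x] u[of k x] by (simp add: algebra_simps)
  qed
  have z_lim: "(\<lambda>k. z k x) \<longlonglongrightarrow> u\<^sub>0 x" for x
  proof -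
    have "(\<lambda>k. \<bar>\<delta> k * h k x\<bar>) \<longlonglongrightarrow> \<bar>0 * h\<^sub>0 x\<bar>" by (intro tendsto_intros \<delta> lim)
    then have d0: "(\<lambda>k. \<bar>\<delta> k * h k x\<bar>) \<longlonglongrightarrow> 0" by simp
    have "(\<lambda>k. z k x - u k x) \<longlonglongrightarrow> 0"
      by (rule Lim_null_comparison[OF _ d0]) (simp add: z(1))
    from tendsto_add[OF this lim(1)[of x]] show ?thesis by simp
  qed
  show ?thesis
  proof (rule integral_dominated_convergence[OF _ _ dominating_integrable[OF W, of C "(\<alpha>\<^sub>0 + 1) * (B + D * B')\<^sup>2" B']])
    show "AE x in I01. (\<lambda>k. (F (u k x + \<delta> k * h k x) - F (u k x)) / \<delta> k) \<longlonglongrightarrow> f (u\<^sub>0 x) * h\<^sub>0 x"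
      unfolding quot
      by (intro AE_I2 tendsto_mult lim continuous_on_tendsto_compose[OF f_cont z_lim]) auto
    show "AE x in I01. norm ((F (u k x + \<delta> k * h k x) - F (u k x)) / \<delta> k)
        \<le> C * exp ((\<alpha>\<^sub>0 + 1) * (B + D * B')\<^sup>2 * (W x)\<^sup>2) * (B' * W x)" for k
      unfolding quot real_norm_def abs_mult
      using f_le_dominating[OF C(2,1) \<alpha> z_le] h C(1) by (intro AE_I2 mult_mono) auto
  qed measurable
qed

lemma tendsto_integral_F:
  assumes W: "W \<in> X_space" and B: "B \<ge> 0"
    and [measurable]: "\<And>k. u k \<in> borel_measurable borel" "u\<^sub>0 \<in> borel_measurable borel"
    and u: "\<And>k x. \<bar>u k x\<bar> \<le> B * W x" and lim: "\<And>x. (\<lambda>k. u k x) \<longlonglongrightarrow> u\<^sub>0 x"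
  shows "(\<lambda>k. LINT x|I01. F (u k x)) \<longlonglongrightarrow> (LINT x|I01. F (u\<^sub>0 x))"
proof -
  obtain C where C: "C > 0" "\<And>t. \<bar>f t\<bar> \<le> C * exp ((\<alpha>\<^sub>0 + 1) * t\<^sup>2)" using f_exp_bound[of "\<alpha>\<^sub>0 + 1"] by auto
  have \<alpha>: "\<alpha>\<^sub>0 + 1 > 0" using \<alpha>\<^sub>0 by simp
  show ?thesis
  proof (rule integral_dominated_convergence[OF _ _ dominating_integrable[OF W, of C "(\<alpha>\<^sub>0 + 1) * B\<^sup>2" B]])
    show "AE x in I01. (\<lambda>k. F (u k x)) \<longlonglongrightarrow> F (u\<^sub>0 x)"
      by (intro AE_I2 lim continuous_on_tendsto_compose[OF F_cont lim]) auto
    show "AE x in I01. norm (F (u k x)) \<le> C * exp ((\<alpha>\<^sub>0 + 1) * B\<^sup>2 * (W x)\<^sup>2) * (B * W x)" for k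
    proof (intro AE_I2)
      fix x
      have "norm (F (u k x)) \<le> f (u k x) * u k x"
        using F_nonneg[of "u k x"] F_le[of "u k x"] unfolding real_norm_def by linarith
      also have "\<dots> = \<bar>f (u k x)\<bar> * \<bar>u k x\<bar>" by (rule ft_abs)
      also have "\<dots> \<le> C * exp ((\<alpha>\<^sub>0 + 1) * B\<^sup>2 * (W x)\<^sup>2) * (B * W x)"
        using f_le_dominating[OF C(2,1) \<alpha> u[of k x]] u C(1) by (intro mult_mono) auto
      finally show "norm (F (u k x)) \<le> C * exp ((\<alpha>\<^sub>0 + 1) * B\<^sup>2 * (W x)\<^sup>2) * (B * W x)" .
    qed
  qed measurable
qed

text \<open>Linear independence makes the \<open>L\<^sup>2\<close> norm of \<open>lin_comb m b x\<close> comparable to the largest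
  coefficient, so the superquadratic growth of \<open>F\<close> dominates the \<open>X\<close> norm.\<close>

lemma \<Phi>_coercive:
  assumes b: "\<And>i. i < m \<Longrightarrow> b i \<in> X_space" and indep: "lin_indep m b" and m: "0 < m"
  obtains R\<^sub>0 where "\<And>R x i. R \<ge> R\<^sub>0 \<Longrightarrow> (\<And>j. \<bar>x j\<bar> \<le> (if j < m then R else 0)) \<Longrightarrow> i < m \<Longrightarrow> \<bar>x i\<bar> = R \<Longrightarrow>
      \<Phi> (lin_comb m b x) \<le> 0"
proof -
  \<comment> \<open>The unit sphere of the maximum norm in the first m coordinates; linear
    independence bounds the \<open>L\<^sup>2\<close> norm away from 0 on it.\<close>
  define E where "E = {c :: nat \<Rightarrow> real. \<forall>i. \<bar>c i\<bar> \<le> (if i < m then 1 else 0)} \<inter> (\<Union>i<m. {c. \<bar>c i\<bar> = 1})"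
  have coord: "continuous_on A (\<lambda>x::nat \<Rightarrow> real. x i)" for A i
    by (rule continuous_on_subset[OF continuous_on_product_coordinates]) simp
  have "closed {c :: nat \<Rightarrow> real. \<bar>c i\<bar> = 1}" for i
    by (intro closed_Collect_eq continuous_intros coord)
  then have E: "compact E"
    unfolding E_def by (intro compact_Int_closed compact_box closed_UN) auto
  define N where "N c = (LINT x|I01. (lin_comb m b c x)\<^sup>2)" for c
  have N_eq: "N c = (\<Sum>i<m. \<Sum>j<m. c i * c j * (LINT x|I01. b i x * b j x))" for c
  proof -
    have "(lin_comb m b c x)\<^sup>2 = (\<Sum>i<m. \<Sum>j<m. c i * c j * (b i x * b j x))" for x
      unfolding lin_comb_def power2_eq_square sum_product by (simp add: mult_ac)
    moreover have "integrable I01 (\<lambda>x. c i * c j * (b i x * b j x))" if "i < m" "j < m" for i j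
      using that by (intro integrable_mult_right sqint_mult_integrable X_sqint_I01 b)
    then have "(LINT x|I01. (\<Sum>i<m. \<Sum>j<m. c i * c j * (b i x * b j x)))
        = (\<Sum>i<m. \<Sum>j<m. LINT x|I01. c i * c j * (b i x * b j x))"
      by (subst Bochner_Integration.integral_sum; (intro Bochner_Integration.integrable_sum sum.cong refl Bochner_Integration.integral_sum)?) auto
    ultimately show ?thesis unfolding N_def by simp
  qed
  have N_cont: "continuous_on E N"
    unfolding N_eq by (intro continuous_intros coord)
  have "(\<lambda>i. if i = 0 then 1 else 0) \<in> E" using m by (auto simp: E_def)
  then obtain c0 where c0: "c0 \<in> E" "\<And>c. c \<in> E \<Longrightarrow> N c0 \<le> N c"
    using continuous_attains_inf[OF E _ N_cont] by blast
  have N0: "N c0 > 0"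
  proof (rule ccontr)
    assume "\<not> N c0 > 0"
    then have "N c0 = 0" unfolding N_def by (simp add: order_less_le)
    have u0: "lin_comb m b c0 \<in> X_space" by (rule X_lin_comb[OF b])
    have "(LINT x|lborel. (norm (lin_comb m b c0 x))\<^sup>2) = 0"
      using X_L2_I01[OF u0] \<open>N c0 = 0\<close> by (simp add: N_def)
    then have "AE x in lborel. lin_comb m b c0 x = 0"
      by (rule sqint_integral_zero_AE[OF X_sqint[OF u0]])
    then have "\<forall>i<m. c0 i = 0" using indep unfolding lin_indep_def by blast
    then show False using c0(1) by (auto simp: E_def)
  qed
  define K where "K = (\<Sum>i<m. \<Sum>j<m. \<bar>X_inner (b j) (b i)\<bar>)"
  have K: "K \<ge> 0" unfolding K_def by (intro sum_nonneg) auto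
  have XK: "(X_norm (lin_comb m b c))\<^sup>2 \<le> K" if c: "c \<in> E" for c
  proof -
    have c1: "\<bar>c i\<bar> \<le> 1" for i
    proof -
      have "\<bar>c i\<bar> \<le> (if i < m then 1 else 0)" using c unfolding E_def by blast
      then show ?thesis by (auto split: if_splits)
    qed
    have "X_inner (lin_comb m b c) (lin_comb m b c) = (\<Sum>i<m. c i * (\<Sum>j<m. c j * X_inner (b j) (b i)))"
      by (rule X_inner_lin_comb[OF b])
    then have "(X_norm (lin_comb m b c))\<^sup>2 = (\<Sum>i<m. \<Sum>j<m. c i * (c j * X_inner (b j) (b i)))"
      by (simp add: X_inner_self sum_distrib_left)
    also have "\<dots> \<le> K" unfolding K_def
    proof (intro sum_mono)
      fix i j
      have "c i * (c j * X_inner (b j) (b i)) \<le> \<bar>c i\<bar> * (\<bar>c j\<bar> * \<bar>X_inner (b j) (b i)\<bar>)"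
        using abs_ge_self[of "c i * (c j * X_inner (b j) (b i))"] by (simp add: abs_mult)
      also have "\<dots> \<le> 1 * (1 * \<bar>X_inner (b j) (b i)\<bar>)"
        by (intro mult_mono c1) auto
      finally show "c i * (c j * X_inner (b j) (b i)) \<le> \<bar>X_inner (b j) (b i)\<bar>" by simp
    qed
    finally show ?thesis .
  qed
  \<comment> \<open>On vectors of maximum norm R the quadratic lower bound for F exceeds the energy
    term by at least \<open>R\<^sup>2\<close>, which absorbs the constant C once R is at least 1 +
    C.\<close>
  define A where "A = (K / (4 * pi) + 1) / N c0"
  have A: "A \<ge> 0" "A * N c0 = K / (4 * pi) + 1" using K N0 by (auto simp: A_def)
  obtain C where C: "C \<ge> 0" "\<And>t. A * t\<^sup>2 - C \<le> F t" using F_superquadratic[OF A(1)] by blast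
  show thesis
  proof (rule that[of "1 + C"])
    fix R x i
    assume R: "1 + C \<le> R" and x: "\<And>j. \<bar>x j\<bar> \<le> (if j < m then R else 0)" and i: "i < m" "\<bar>x i\<bar> = R"
    have R1: "R \<ge> 1" "R > 0" using R C by linarith+
    define c where "c j = x j / R" for j
    have cE: "c \<in> E"
    proof -
      have "\<bar>c j\<bar> \<le> (if j < m then 1 else 0)" for j
        using x[of j] R1 by (auto simp: c_def abs_divide split: if_splits)
      moreover have "\<bar>c i\<bar> = 1" using i R1 by (simp add: c_def)
      ultimately show ?thesis unfolding E_def using i by auto
    qed
    have xc: "lin_comb m b x = (\<lambda>y. R * lin_comb m b c y)"
      using R1 by (auto simp: lin_comb_def c_def sum_distrib_left fun_eq_iff intro!: sum.cong)
    have u: "lin_comb m b x \<in> X_space" by (rule X_lin_comb[OF b])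
    have c: "lin_comb m b c \<in> X_space" by (rule X_lin_comb[OF b])
    have i2: "integrable I01 (\<lambda>y. (lin_comb m b c y)\<^sup>2)" by (rule sqint_integrable_real[OF X_sqint_I01[OF c]])
    have "A * R\<^sup>2 * N c - C = (LINT y|I01. A * R\<^sup>2 * (lin_comb m b c y)\<^sup>2 - C)"
      using i2 I01.prob_space by (simp add: N_def space_restrict_space)
    also have "\<dots> \<le> (LINT y|I01. F (lin_comb m b x y))"
    proof (intro integral_mono F_integrable u)
      show "integrable I01 (\<lambda>y. A * R\<^sup>2 * (lin_comb m b c y)\<^sup>2 - C)" using i2 by simp
      show "A * R\<^sup>2 * (lin_comb m b c y)\<^sup>2 - C \<le> F (lin_comb m b x y)" for y
        using C(2)[of "lin_comb m b x y"] by (simp add: xc power_mult_distrib mult.assoc)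
    qed
    finally have 1: "A * R\<^sup>2 * N c - C \<le> (LINT y|I01. F (lin_comb m b x y))" .
    have "R\<^sup>2 * (A * N c0) \<le> R\<^sup>2 * (A * N c)" using c0(2)[OF cE] A(1) by (intro mult_left_mono) auto
    then have 2: "R\<^sup>2 * (K / (4 * pi)) + R\<^sup>2 \<le> A * R\<^sup>2 * N c"
      unfolding A(2) by (simp add: algebra_simps)
    have "R\<^sup>2 * (X_norm (lin_comb m b c))\<^sup>2 \<le> R\<^sup>2 * K" using XK[OF cE] by (intro mult_left_mono) auto
    then have 3: "(X_norm (lin_comb m b x))\<^sup>2 / (4 * pi) \<le> R\<^sup>2 * (K / (4 * pi))"
      unfolding xc X_norm_cmult by (simp add: divide_right_mono)
    have "R * 1 \<le> R * R" using R1 by (intro mult_left_mono) auto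
    then have "C \<le> R\<^sup>2" using R by (simp add: power2_eq_square)
    then show "\<Phi> (lin_comb m b x) \<le> 0" unfolding \<Phi>_def using 1 2 3 by linarith
  qed
qed

text \<open>The mountain pass theorem is used in the coefficients. Its far endpoint is R times the
  first basis vector: it lies on the boundary of the box, where the energy is not positive, and the
  segment from 0 runs along the ray of \<open>b 0\<close>, where the energy is at most
  \<open>s\<^sub>0\<close>.\<close>

lemma Galerkin_critical_point:
  assumes b: "\<And>i. i < m \<Longrightarrow> b i \<in> X_space" and indep: "lin_indep m b" and m: "0 < m"
    and b0: "X_norm (b 0) = 1" and s0: "0 \<le> s\<^sub>0" "\<And>t. 0 < t \<Longrightarrow> \<Phi> (\<lambda>x. t * b 0 x) \<le> s\<^sub>0"
    and r: "r > 0" "\<rho> > 0" "\<And>u. u \<in> X_space \<Longrightarrow> X_norm u = r \<Longrightarrow> \<rho> \<le> \<Phi> u"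
  obtains c where "\<rho> \<le> \<Phi> (lin_comb m b c)" "\<Phi> (lin_comb m b c) \<le> s\<^sub>0"
    "\<And>i. i < m \<Longrightarrow> X_inner (lin_comb m b c) (b i) / (2 * pi) = (LINT x|I01. f (lin_comb m b c x) * b i x)"
proof -
  obtain R0 where R0: "\<And>R x i. R \<ge> R0 \<Longrightarrow> (\<And>j. \<bar>x j\<bar> \<le> (if j < m then R else 0)) \<Longrightarrow> i < m \<Longrightarrow> \<bar>x i\<bar> = R \<Longrightarrow>
      \<Phi> (lin_comb m b x) \<le> 0"
    using \<Phi>_coercive[OF b indep m] by blast
  \<comment> \<open>As \<open>b 0\<close> has norm 1, exceeding r places the far endpoint beyond the
    ridge.\<close>
  define R where "R = max R0 (r + 1)"
  have R: "R \<ge> R0" "R > r" "R > 0" using r by (auto simp: R_def)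
  define S where "S = {x :: nat \<Rightarrow> real. \<forall>i. \<bar>x i\<bar> \<le> (if i < m then R else 0)}"
  have S_le: "\<bar>x i\<bar> \<le> R" if "x \<in> S" for x i
  proof -
    have "\<bar>x i\<bar> \<le> (if i < m then R else 0)" using that unfolding S_def by blast
    then show ?thesis using R by (auto split: if_splits)
  qed
  define U where "U = lin_comb m b"
  have UX: "U c \<in> X_space" for c unfolding U_def by (rule X_lin_comb[OF b])
  note [measurable] = X_borel[OF UX]
  define W where "W x = (\<Sum>i<m. \<bar>b i x\<bar>)" for x
  have W: "W \<in> X_space"
    using X_sum[of "{..<m}" "\<lambda>i x. \<bar>b i x\<bar>" "\<lambda>_. 1"] X_abs b by (simp add: W_def[abs_def])
  have U_le: "\<bar>U c x\<bar> \<le> B * W x" if "\<And>i. i < m \<Longrightarrow> \<bar>c i\<bar> \<le> B" for c B x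
  proof -
    have "\<bar>U c x\<bar> \<le> (\<Sum>i<m. \<bar>c i * b i x\<bar>)" unfolding U_def lin_comb_def by (rule sum_abs)
    also have "\<dots> \<le> (\<Sum>i<m. B * \<bar>b i x\<bar>)" using that by (intro sum_mono) (auto simp: abs_mult mult_right_mono)
    finally show ?thesis by (simp add: W_def sum_distrib_left)
  qed
  have U_lim: "(\<lambda>k. U (c k) x) \<longlonglongrightarrow> U c0 x" if "c \<longlonglongrightarrow> c0" for c c0 x
    unfolding U_def lin_comb_def by (intro tendsto_intros tendsto_component that)
  have b_le: "\<bar>b i x\<bar> \<le> 1 * W x" if "i < m" for i x
    using member_le_sum[of i "{..<m}" "\<lambda>i. \<bar>b i x\<bar>"] that by (simp add: W_def)
  have inner_lim: "(\<lambda>k. X_inner (U (c k)) (U (w k))) \<longlonglongrightarrow> X_inner (U c0) (U w0)"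
    if "c \<longlonglongrightarrow> c0" "w \<longlonglongrightarrow> w0" for c c0 w w0
  proof -
    have e: "X_inner (U c) (U w) = (\<Sum>i<m. c i * (\<Sum>j<m. w j * X_inner (b j) (b i)))" for c w
      unfolding U_def by (rule X_inner_lin_comb[OF b])
    show ?thesis unfolding e by (intro tendsto_intros tendsto_component that)
  qed
  have norm_lim: "(\<lambda>k. (X_norm (U (c k)))\<^sup>2) \<longlonglongrightarrow> (X_norm (U c0))\<^sup>2" if "c \<longlonglongrightarrow> c0" for c c0
    unfolding X_inner_self[symmetric] by (rule inner_lim[OF that that])
  define J where "J c = \<Phi> (U c)" for c
  define G where "G i c = X_inner (U c) (b i) / (2 * pi) - (LINT x|I01. f (U c x) * b i x)" for i c
  have J_cont: "continuous_on S J"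
    unfolding continuous_on_sequentially comp_def
  proof (intro allI ballI impI)
    fix c c0 assume c0: "c0 \<in> S" and c: "(\<forall>n. c n \<in> S) \<and> c \<longlonglongrightarrow> c0"
    have "(\<lambda>k. LINT x|I01. F (U (c k) x)) \<longlonglongrightarrow> (LINT x|I01. F (U c0 x))"
      using c R by (intro tendsto_integral_F[OF W, of R] U_le U_lim) (auto intro: S_le)
    then show "(\<lambda>k. J (c k)) \<longlonglongrightarrow> J c0"
      unfolding J_def \<Phi>_def using c by (intro tendsto_intros norm_lim) auto
  qed
  have G_cont: "continuous_on S (G i)" if i: "i < m" for i
    unfolding continuous_on_sequentially comp_def
  proof (intro allI ballI impI)
    fix c c0 assume c0: "c0 \<in> S" and c: "(\<forall>n. c n \<in> S) \<and> c \<longlonglongrightarrow> c0"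
    note [measurable] = X_borel[OF b[OF i]]
    have 1: "(\<lambda>k. LINT x|I01. f (U (c k) x) * b i x) \<longlonglongrightarrow> (LINT x|I01. f (U c0 x) * b i x)"
      using c by (intro tendsto_integral_f[OF W, where B = R and B' = 1] U_le b_le i U_lim) (auto intro: S_le)
    have "(\<lambda>k. X_inner (U (c k)) (b i)) \<longlonglongrightarrow> X_inner (U c0) (b i)"
    proof -
      have e: "X_inner (U c) (b i) = (\<Sum>j<m. c j * X_inner (b j) (b i))" for c
        unfolding U_def by (rule X_inner_lin_comb_left[OF b b[OF i]])
      show ?thesis unfolding e using c by (intro tendsto_intros tendsto_component) auto
    qed
    then show "(\<lambda>k. G i (c k)) \<longlonglongrightarrow> G i c0"
      unfolding G_def by (intro tendsto_intros 1) auto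
  qed
  have J_diff: "(\<lambda>k. (J (\<lambda>i. c k i + \<delta> k * w k i) - J (c k)) / \<delta> k) \<longlonglongrightarrow> (\<Sum>i<m. w0 i * G i c0)"
    if cS: "\<And>k. c k \<in> S" and c0: "c0 \<in> S" "c \<longlonglongrightarrow> c0" and w: "w \<longlonglongrightarrow> w0" and \<delta>: "\<And>k. 0 < \<delta> k" "\<delta> \<longlonglongrightarrow> 0"
    for c w c0 w0 \<delta>
  proof -
    have "\<exists>B. \<forall>k. \<bar>w k i\<bar> \<le> B" for i
      using convergent_imp_Bseq[OF convergentI[OF tendsto_component[OF w]], of i] unfolding Bseq_def by auto
    then obtain B where B: "\<And>i k. \<bar>w k i\<bar> \<le> B i" by metis
    define B' where "B' = (\<Sum>i<m. \<bar>B i\<bar>)"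
    have B': "\<bar>w k i\<bar> \<le> B'" if "i < m" for i k
      using B[of k i] member_le_sum[of i "{..<m}" "\<lambda>i. \<bar>B i\<bar>"] that unfolding B'_def by fastforce
    have B'0: "B' \<ge> 0" unfolding B'_def by (intro sum_nonneg) auto
    have add: "U (\<lambda>i. c k i + \<delta> k * w k i) = (\<lambda>x. U (c k) x + \<delta> k * U (w k) x)" for k
      by (simp add: U_def lin_comb_def fun_eq_iff sum.distrib sum_distrib_left algebra_simps)
    have Fi: "integrable I01 (\<lambda>x. F (U (c k) x + \<delta> k * U (w k) x))" for k
      using F_integrable[OF UX[of "\<lambda>i. c k i + \<delta> k * w k i"]] by (simp add: add)
    have eq: "(J (\<lambda>i. c k i + \<delta> k * w k i) - J (c k)) / \<delta> k
        = (2 * X_inner (U (c k)) (U (w k)) + \<delta> k * (X_norm (U (w k)))\<^sup>2) / (4 * pi)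
          - (LINT x|I01. (F (U (c k) x + \<delta> k * U (w k) x) - F (U (c k) x)) / \<delta> k)" for k
    proof -
      have i1: "(LINT x|I01. (F (U (c k) x + \<delta> k * U (w k) x) - F (U (c k) x)) / \<delta> k)
          = ((LINT x|I01. F (U (c k) x + \<delta> k * U (w k) x)) - (LINT x|I01. F (U (c k) x))) / \<delta> k"
        using Fi[of k] F_integrable[OF UX[of "c k"]] by simp
      have n1: "(X_norm (\<lambda>x. U (c k) x + \<delta> k * U (w k) x))\<^sup>2
          = (X_norm (U (c k)))\<^sup>2 + \<delta> k * (2 * X_inner (U (c k)) (U (w k)) + \<delta> k * (X_norm (U (w k)))\<^sup>2)"
        unfolding X_norm_add_sq[OF UX X_cmult[OF UX]] X_norm_cmult X_inner_commute[of "U (c k)" "\<lambda>x. \<delta> k * U (w k) x"]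
          X_inner_cmult_left X_inner_commute[of "U (w k)"]
        by (simp add: power2_eq_square algebra_simps)
      show ?thesis
        unfolding J_def \<Phi>_def add n1 i1 using \<delta>(1)[of k] by (simp add: field_simps)
    qed
    have l1: "(\<lambda>k. LINT x|I01. (F (U (c k) x + \<delta> k * U (w k) x) - F (U (c k) x)) / \<delta> k) \<longlonglongrightarrow> (LINT x|I01. f (U c0 x) * U w0 x)"
      using R B'0 by (intro tendsto_integral_F_quotient[OF W, where B = R and B' = B'] U_le U_lim S_le cS B' c0 w \<delta>) auto
    have "(\<lambda>k. (J (\<lambda>i. c k i + \<delta> k * w k i) - J (c k)) / \<delta> k)
        \<longlonglongrightarrow> (2 * X_inner (U c0) (U w0) + 0 * (X_norm (U w0))\<^sup>2) / (4 * pi) - (LINT x|I01. f (U c0 x) * U w0 x)"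
      unfolding eq by (intro tendsto_intros inner_lim norm_lim l1 c0 w \<delta>) auto
    moreover have "(2 * X_inner (U c0) (U w0) + 0 * (X_norm (U w0))\<^sup>2) / (4 * pi) - (LINT x|I01. f (U c0 x) * U w0 x)
        = (\<Sum>i<m. w0 i * G i c0)"
    proof -
      have "X_inner (U c0) (U w0) = (\<Sum>i<m. w0 i * X_inner (U c0) (b i))"
        using X_inner_lin_comb_left[OF b UX[of c0], where c = w0] by (simp add: U_def X_inner_commute)
      moreover have "(LINT x|I01. f (U c0 x) * U w0 x) = (\<Sum>i<m. w0 i * (LINT x|I01. f (U c0 x) * b i x))"
      proof -
        have e1: "f (U c0 x) * U w0 x = (\<Sum>i<m. w0 i * (f (U c0 x) * b i x))" for x
          by (simp add: U_def lin_comb_def[of _ _ w0] sum_distrib_left mult_ac)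
        have e2: "integrable I01 (\<lambda>x. w0 i * (f (U c0 x) * b i x))" if "i < m" for i
          using that by (intro integrable_mult_right fv_integrable UX b)
        show ?thesis unfolding e1 using e2 by (subst Bochner_Integration.integral_sum) auto
      qed
      ultimately show ?thesis
        by (simp add: G_def right_diff_distrib sum_subtractf sum_divide_distrib)
    qed
    ultimately show ?thesis by simp
  qed
  define q where "q i = (if i = 0 then R else 0)" for i :: nat
  have Uq: "U (\<lambda>i. t * q i) x = t * R * b 0 x" for t x
  proof -
    have "U (\<lambda>i. t * q i) x = (\<Sum>i\<in>{0}. t * q i * b i x)"
      unfolding U_def lin_comb_def using m by (intro sum.mono_neutral_right) (auto simp: q_def)
    then show ?thesis by (simp add: q_def)
  qed
  have Uq1: "U q x = R * b 0 x" for x using Uq[of 1 x] by simp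
  have U0: "U (\<lambda>_. 0) = (\<lambda>_. 0)" by (simp add: U_def lin_comb_def fun_eq_iff)
  have \<Phi>0: "\<Phi> (\<lambda>_. 0) = 0" using X_norm_AE_zero[OF X_zero] by (simp add: \<Phi>_def F_0)
  have qS: "q \<in> S" using m R by (auto simp: S_def q_def)
  have Jq: "J q \<le> 0"
    unfolding J_def U_def by (rule R0[OF R(1) _ m]) (use m R in \<open>auto simp: q_def\<close>)
  have seg: "J (\<lambda>i. t * q i) \<le> s\<^sub>0" if "0 \<le> t" "t \<le> 1" for t
  proof (cases "t = 0")
    case True
    then show ?thesis using s0(1) \<Phi>0 by (simp add: J_def U0)
  next
    case False
    then have "t * R > 0" using that R by simp
    from s0(2)[OF this] show ?thesis by (simp add: J_def Uq[abs_def])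
  qed
  have Xn_cont: "continuous_on A (\<lambda>c. X_norm (U c))" for A
    unfolding continuous_on_sequentially comp_def
  proof (intro allI ballI impI)
    fix c c0 assume c: "(\<forall>n. c n \<in> A) \<and> c \<longlonglongrightarrow> c0"
    then have "(\<lambda>k. sqrt ((X_norm (U (c k)))\<^sup>2)) \<longlonglongrightarrow> sqrt ((X_norm (U c0))\<^sup>2)"
      by (intro tendsto_intros norm_lim) auto
    then show "(\<lambda>k. X_norm (U (c k))) \<longlonglongrightarrow> X_norm (U c0)" by simp
  qed
  have ridge: "\<exists>c\<in>K. \<rho> \<le> J c" if K: "connected K" "(\<lambda>_. 0) \<in> K" "q \<in> K" and "K \<subseteq> S" for K
  proof -
    have con: "connected ((\<lambda>c. X_norm (U c)) ` K)" by (rule connected_continuous_image[OF Xn_cont K(1)])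
    have "X_norm (U (\<lambda>_. 0)) = 0" unfolding U0 using X_norm_AE_zero[OF X_zero] by simp
    moreover have "(X_norm (U q))\<^sup>2 = R\<^sup>2"
      unfolding Uq1[abs_def] X_norm_cmult by (simp add: b0)
    then have "X_norm (U q) = R" using R by (simp add: power2_eq_iff_nonneg)
    \<comment> \<open>Intermediate value argument: the norm is 0 at one point of the connected set
      and R > r at another, so the set meets the ridge.\<close>
    ultimately have "r \<in> (\<lambda>c. X_norm (U c)) ` K"
      using connectedD_interval[OF con imageI[OF K(2)] imageI[OF K(3)], of r] r(1) R(2) by simp
    then obtain c where "c \<in> K" "X_norm (U c) = r" by auto
    then show ?thesis using r(3)[OF UX] unfolding J_def by blast
  qed
  have bdry: "J x \<le> 0" if "x \<in> S" "i < m" "\<bar>x i\<bar> = R" for x i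
    unfolding J_def U_def by (rule R0[of R x i, OF R(1) _ that(2,3)]) (use that(1) in \<open>simp add: S_def\<close>)
  have J0: "J (\<lambda>_. 0) = 0" by (simp add: J_def U0 \<Phi>0)
  note crit = that
  show thesis
  proof (rule mountain_pass_box[of R m J G q s\<^sub>0 \<rho>, folded S_def])
    show "thesis" if "x \<in> S" "\<rho> \<le> J x" "J x \<le> s\<^sub>0" "\<And>i. i < m \<Longrightarrow> G i x = 0" for x
      using that(2-4) by (intro crit[of x]) (simp_all add: J_def G_def U_def)
    show "R > 0" by (rule R(3))
    show "continuous_on S J" by (rule J_cont)
    show "continuous_on S (G i)" if "i < m" for i using that by (rule G_cont)
    show "(\<lambda>k. (J (\<lambda>i. x k i + \<delta> k * w k i) - J (x k)) / \<delta> k) \<longlonglongrightarrow> (\<Sum>i<m. w\<^sub>0 i * G i x\<^sub>0)"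
      if "\<And>k. x k \<in> S" "x\<^sub>0 \<in> S" "x \<longlonglongrightarrow> x\<^sub>0" "w \<longlonglongrightarrow> w\<^sub>0" "\<And>k. 0 < \<delta> k" "\<delta> \<longlonglongrightarrow> 0" for x w x\<^sub>0 w\<^sub>0 \<delta>
      using that by (rule J_diff)
    show "J x \<le> 0" if "x \<in> S" "i < m" "\<bar>x i\<bar> = R" for x i using that by (rule bdry)
    show "J (\<lambda>_. 0) = 0" by (rule J0)
    show "q \<in> S" by (rule qS)
    show "J q \<le> 0" by (rule Jq)
    show "J (\<lambda>i. t * q i) \<le> s\<^sub>0" if "0 \<le> t" "t \<le> 1" for t using that by (rule seg)
    show "\<rho> > 0" by (rule r(2))
    show "\<exists>x\<in>K. \<rho> \<le> J x" if "connected K" "K \<subseteq> S" "(\<lambda>_. 0) \<in> K" "q \<in> K" for K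
      using that by (intro ridge)
  qed
qed

end

subsection \<open>Passage to the limit\<close>

lemma X_inner_cong_AE:
  assumes "u \<in> X_space" "v \<in> X_space" "w \<in> X_space" "AE x in lborel. v x = w x"
  shows "X_inner u v = X_inner u w"
  unfolding X_inner_def
proof (rule integral_cong_AE)
  note [measurable] = X_borel[OF assms(1)] X_borel[OF assms(2)] X_borel[OF assms(3)]
  show "(\<lambda>z. dq u z * dq v z) \<in> borel_measurable lborel" "(\<lambda>z. dq u z * dq w z) \<in> borel_measurable lborel"
    by measurable
  show "AE z in lborel. dq u z * dq v z = dq u z * dq w z"
    using AE_lborel_pair[OF assms(4)] by eventually_elim (simp add: dq_def)
qed

lemma sqint_tendsto_unique:
  fixes u :: "nat \<Rightarrow> 'a \<Rightarrow> real"
  assumes u: "\<And>k. sqint M (u k)" and v: "sqint M v" "sqint M w"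
    and lim: "(\<lambda>k. LINT x|M. (u k x - v x)\<^sup>2) \<longlonglongrightarrow> 0" "(\<lambda>k. LINT x|M. (u k x - w x)\<^sup>2) \<longlonglongrightarrow> 0"
  shows "AE x in M. v x = w x"
proof -
  note d = sqint_diff[OF u v(1)] sqint_diff[OF u v(2)] sqint_diff[OF v]
  have "(LINT x|M. (v x - w x)\<^sup>2) \<le> 2 * (LINT x|M. (u k x - v x)\<^sup>2) + 2 * (LINT x|M. (u k x - w x)\<^sup>2)" for k
  proof -
    have "(LINT x|M. (v x - w x)\<^sup>2) \<le> (LINT x|M. 2 * (u k x - v x)\<^sup>2 + 2 * (u k x - w x)\<^sup>2)"
    proof (intro integral_mono Bochner_Integration.integrable_add integrable_mult_right sqint_integrable_real d)
      fix x show "(v x - w x)\<^sup>2 \<le> 2 * (u k x - v x)\<^sup>2 + 2 * (u k x - w x)\<^sup>2"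
        using norm_diff_sq_le[of "u k x - w x" "u k x - v x"] by simp
    qed
    also have "\<dots> = 2 * (LINT x|M. (u k x - v x)\<^sup>2) + 2 * (LINT x|M. (u k x - w x)\<^sup>2)"
      using sqint_integrable_real[OF d(1)] sqint_integrable_real[OF d(2)] by simp
    finally show ?thesis .
  qed
  moreover have "(\<lambda>k. 2 * (LINT x|M. (u k x - v x)\<^sup>2) + 2 * (LINT x|M. (u k x - w x)\<^sup>2)) \<longlonglongrightarrow> 2 * 0 + 2 * 0"
    by (intro tendsto_intros lim)
  ultimately have "(LINT x|M. (v x - w x)\<^sup>2) \<le> 2 * 0 + 2 * 0"
    by (intro LIMSEQ_le_const) auto
  then have "(LINT x|M. (norm (v x - w x))\<^sup>2) = 0"
    by (intro antisym) auto
  from sqint_integral_zero_AE[OF d(3) this] show ?thesis by simp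
qed

lemma AE_I01_X_eq:
  assumes "u \<in> X_space" "v \<in> X_space" "AE x in I01. u x = v x"
  shows "AE x in lborel. u x = v x"
proof -
  have "AE x in lborel. x \<in> {0<..<1} \<longrightarrow> u x = v x"
    using assms(3) by (subst (asm) AE_restrict_space_iff) auto
  then show ?thesis using X_AE[OF assms(1)] X_AE[OF assms(2)] by eventually_elim auto
qed

text \<open>Compactness yields a subsequence converging almost everywhere, its limit is identified
  with w by uniqueness of limits in \<open>L\<^sup>2\<close>, and boundedness in X then gives weak
  convergence.\<close>

lemma X_inner_tendsto:
  assumes v: "v \<in> X_space" and d: "\<And>j. d j \<in> X_space" "\<And>j. (X_norm (d j))\<^sup>2 \<le> B" and w: "w \<in> X_space"
    and lim: "(\<lambda>j. LINT x|I01. (d j x - w x)\<^sup>2) \<longlonglongrightarrow> 0"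
  obtains r where "strict_mono (r :: nat \<Rightarrow> nat)" "(\<lambda>j. X_inner v (d (r j))) \<longlonglongrightarrow> X_inner v w"
proof -
  have "(\<lambda>j. LINT x|I01. (d j x)\<^sup>2) \<longlonglongrightarrow> (LINT x|I01. (w x)\<^sup>2)"
    using sqint_tendsto_integral_norm[of I01 d w] X_sqint_I01 d(1) w lim by simp
  from convergent_imp_Bseq[OF convergentI[OF this]]
  obtain C where "\<And>j. norm (LINT x|I01. (d j x)\<^sup>2) \<le> C" unfolding Bseq_def by blast
  then have C: "(LINT x|I01. (d j x)\<^sup>2) \<le> C" for j
    unfolding real_norm_def by (rule order_trans[OF abs_ge_self])
  obtain w' r where w': "w' \<in> X_space" and r: "strict_mono (r :: nat \<Rightarrow> nat)"
    and ae: "AE x in lborel. (\<lambda>k. d (r k) x) \<longlonglongrightarrow> w' x"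
    and lim': "(\<lambda>k. LINT x|I01. (d (r k) x - w' x)\<^sup>2) \<longlonglongrightarrow> 0"
    by (rule X_Rellich[OF d C]) (rule that; assumption)
  have "(\<lambda>k. LINT x|I01. (d (r k) x - w x)\<^sup>2) \<longlonglongrightarrow> 0"
    using LIMSEQ_subseq_LIMSEQ[OF lim r] by (simp add: comp_def)
  from sqint_tendsto_unique[OF _ _ _ lim' this] have "AE x in I01. w' x = w x"
    using d(1) w w' by (simp add: X_sqint_I01)
  then have "AE x in lborel. w' x = w x" by (rule AE_I01_X_eq[OF w' w])
  then have "X_inner v w' = X_inner v w" by (rule X_inner_cong_AE[OF v w' w])
  moreover have "(\<lambda>j. X_inner (d (r j)) v) \<longlonglongrightarrow> X_inner w' v"
    by (rule X_inner_weak_convergence[OF d(1) w' v ae d(2)])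
  ultimately show thesis using that[OF r] by (simp add: X_inner_commute)
qed

context nonlinearity
begin

text \<open>Criticality in the basis directions extends to the whole span by linearity: to each
  \<open>d k\<close> with k < n, and to u itself. The latter identity expresses the norm through the
  integral of f(u) u.\<close>

lemma critical_sequence:
  fixes d :: "nat \<Rightarrow> real \<Rightarrow> real" and n :: nat
  assumes \<psi>: "\<psi> \<in> X_space" "X_norm \<psi> = 1" and s0: "0 \<le> s\<^sub>0" "\<And>t. 0 < t \<Longrightarrow> \<Phi> (\<lambda>x. t * \<psi> x) \<le> s\<^sub>0"
    and r: "r > 0" "\<rho> > 0" "\<And>u. u \<in> X_space \<Longrightarrow> X_norm u = r \<Longrightarrow> \<rho> \<le> \<Phi> u" and d: "\<And>k. d k \<in> X_space"
  obtains u where "u \<in> X_space" "\<rho> \<le> \<Phi> u" "\<Phi> u \<le> s\<^sub>0" "(X_norm u)\<^sup>2 / (2 * pi) = (LINT x|I01. f (u x) * u x)"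
    "\<And>k. k < n \<Longrightarrow> X_inner u (d k) / (2 * pi) = (LINT x|I01. f (u x) * d k x)"
proof -
  obtain m b where m: "0 < m" and b0: "b 0 = \<psi>" and b: "\<And>i. i < m \<Longrightarrow> b i \<in> X_space" and indep: "lin_indep m b"
    and span: "\<And>k. k < n \<Longrightarrow> \<exists>c. AE x in lborel. d k x = lin_comb m b c x"
    using lin_indep_extraction[of \<psi> d n] \<psi> d by blast
  obtain c where c: "\<rho> \<le> \<Phi> (lin_comb m b c)" "\<Phi> (lin_comb m b c) \<le> s\<^sub>0"
    "\<And>i. i < m \<Longrightarrow> X_inner (lin_comb m b c) (b i) / (2 * pi) = (LINT x|I01. f (lin_comb m b c x) * b i x)"
  proof (rule Galerkin_critical_point[OF b indep m _ s0(1) _ r])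
    show "X_norm (b 0) = 1" using \<psi>(2) b0 by simp
    show "\<Phi> (\<lambda>x. t * b 0 x) \<le> s\<^sub>0" if "0 < t" for t using s0(2)[OF that] b0 by simp
  qed (assumption | (rule that; assumption))+
  define u where "u = lin_comb m b c"
  have u: "u \<in> X_space" unfolding u_def by (rule X_lin_comb[OF b])
  have test: "X_inner u (lin_comb m b a) / (2 * pi) = (LINT x|I01. f (u x) * lin_comb m b a x)" for a
  proof -
    have "X_inner u (lin_comb m b a) = (\<Sum>i<m. a i * X_inner u (b i))"
      using X_inner_lin_comb_left[OF b u, where c = a] by (simp add: X_inner_commute)
    then have "X_inner u (lin_comb m b a) / (2 * pi) = (\<Sum>i<m. a i * (X_inner u (b i) / (2 * pi)))"
      by (simp add: sum_divide_distrib)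
    also have "\<dots> = (\<Sum>i<m. a i * (LINT x|I01. f (u x) * b i x))"
      using c(3) by (intro sum.cong refl) (simp add: u_def)
    also have "\<dots> = (LINT x|I01. (\<Sum>i<m. a i * (f (u x) * b i x)))"
      using fv_integrable[OF u b] by (subst Bochner_Integration.integral_sum) auto
    also have "\<dots> = (LINT x|I01. f (u x) * lin_comb m b a x)"
      by (simp add: lin_comb_def[of _ _ a] sum_distrib_left mult_ac)
    finally show ?thesis .
  qed
  show thesis
  proof (rule that[OF u])
    show "\<rho> \<le> \<Phi> u" "\<Phi> u \<le> s\<^sub>0" using c by (simp_all add: u_def)
    show "(X_norm u)\<^sup>2 / (2 * pi) = (LINT x|I01. f (u x) * u x)"
      using test[of c] by (simp add: u_def[symmetric] X_inner_self)
    fix k assume "k < n"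
    then obtain a where a: "AE x in lborel. d k x = lin_comb m b a x" using span by blast
    have aX: "lin_comb m b a \<in> X_space" by (rule X_lin_comb[OF b])
    note [measurable] = X_borel[OF u] X_borel[OF aX] X_borel[OF d[of k]]
    have "(LINT x|I01. f (u x) * d k x) = (LINT x|I01. f (u x) * lin_comb m b a x)"
      by (rule integral_cong_AE) (use AE_I01[OF a] in auto)
    then show "X_inner u (d k) / (2 * pi) = (LINT x|I01. f (u x) * d k x)"
      using test[of a] X_inner_cong_AE[OF u d aX a] by simp
  qed
qed

text \<open>For large arguments f is a small fraction of \<open>f t * t\<close>; a bound on the
  integrals of f(u) u thus makes the functions f(u) uniformly integrable.\<close>

lemma tail_f: "e > 0 \<Longrightarrow> \<exists>N>0. \<forall>t. N < \<bar>t\<bar> \<longrightarrow> \<bar>f t\<bar> \<le> e * (f t * t)"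
proof (intro exI conjI allI impI)
  assume e: "e > 0"
  then show "1 / e > 0" by simp
  fix t assume "1 / e < \<bar>t\<bar>"
  then have "1 \<le> e * \<bar>t\<bar>" using e by (simp add: field_simps)
  then have "1 * \<bar>f t\<bar> \<le> (e * \<bar>t\<bar>) * \<bar>f t\<bar>" by (intro mult_right_mono) auto
  then show "\<bar>f t\<bar> \<le> e * (f t * t)" unfolding ft_abs by (simp add: mult_ac)
qed

text \<open>Condition (i) reduces the tail of F to that of f.\<close>

lemma tail_F:
  assumes e: "e > 0" shows "\<exists>N>0. \<forall>t. N < \<bar>t\<bar> \<longrightarrow> \<bar>F t\<bar> \<le> e * (f t * t)"
proof -
  obtain t0 M where t0: "t0 > 0" "M > 0" "\<And>t. \<bar>t\<bar> \<ge> t0 \<Longrightarrow> F t \<le> M * \<bar>f t\<bar>" using i by blast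
  obtain N where N: "N > 0" "\<And>t. N < \<bar>t\<bar> \<Longrightarrow> \<bar>f t\<bar> \<le> e / M * (f t * t)"
    using tail_f[of "e / M"] e t0 by auto
  have "\<bar>F t\<bar> \<le> e * (f t * t)" if "max t0 N < \<bar>t\<bar>" for t
  proof -
    have "\<bar>F t\<bar> \<le> M * \<bar>f t\<bar>" using t0(3)[of t] F_nonneg[of t] that by simp
    also have "\<dots> \<le> M * (e / M * (f t * t))" using N(2)[of t] that t0 by (intro mult_left_mono) auto
    finally show ?thesis using t0 by simp
  qed
  then show ?thesis using N(1) by (intro exI[of _ "max t0 N"]) auto
qed

text \<open>The gap between the exponents \<alpha> and \<gamma> absorbs the extra factor
  \<open>\<bar>t\<bar>\<close>, because
  \<open>\<kappa> * t\<^sup>2 \<le> exp (\<kappa> * t\<^sup>2)\<close>.\<close>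

lemma tail_exp:
  assumes C: "C > 0" "\<And>t. \<bar>f t\<bar> \<le> C * exp (\<alpha> * t\<^sup>2)" and \<alpha>: "\<alpha> < \<gamma>" and e: "e > 0"
  shows "\<exists>N>0. \<forall>t. N < \<bar>t\<bar> \<longrightarrow> \<bar>f t * t\<bar> \<le> e * exp (\<gamma> * t\<^sup>2)"
proof (intro exI conjI allI impI)
  define \<kappa> where "\<kappa> = \<gamma> - \<alpha>"
  have \<kappa>: "\<kappa> > 0" using \<alpha> by (simp add: \<kappa>_def)
  show "C / (e * \<kappa>) > 0" using C e \<kappa> by simp
  fix t assume "C / (e * \<kappa>) < \<bar>t\<bar>"
  then have "C \<le> e * \<kappa> * \<bar>t\<bar>" using e \<kappa> by (simp add: field_simps)
  then have "C * \<bar>t\<bar> \<le> e * \<kappa> * \<bar>t\<bar> * \<bar>t\<bar>" by (intro mult_right_mono) auto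
  also have "\<dots> = e * (\<kappa> * t\<^sup>2)" by (simp add: power2_eq_square)
  also have "\<dots> \<le> e * exp (\<kappa> * t\<^sup>2)"
  proof (rule mult_left_mono)
    show "\<kappa> * t\<^sup>2 \<le> exp (\<kappa> * t\<^sup>2)" using exp_ge_add_one_self[of "\<kappa> * t\<^sup>2"] by linarith
  qed (use e in simp)
  finally have 1: "C * \<bar>t\<bar> \<le> e * exp (\<kappa> * t\<^sup>2)" .
  have "\<bar>f t * t\<bar> \<le> (C * exp (\<alpha> * t\<^sup>2)) * \<bar>t\<bar>"
    unfolding abs_mult by (intro mult_right_mono C) simp
  also have "\<dots> = exp (\<alpha> * t\<^sup>2) * (C * \<bar>t\<bar>)" by simp
  also have "\<dots> \<le> exp (\<alpha> * t\<^sup>2) * (e * exp (\<kappa> * t\<^sup>2))" by (intro mult_left_mono 1) simp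
  also have "\<dots> = e * exp (\<gamma> * t\<^sup>2)"
  proof -
    have "\<gamma> * t\<^sup>2 = \<alpha> * t\<^sup>2 + \<kappa> * t\<^sup>2" by (simp add: \<kappa>_def left_diff_distrib)
    then show ?thesis by (simp add: exp_add)
  qed
  finally show "\<bar>f t * t\<bar> \<le> e * exp (\<gamma> * t\<^sup>2)" .
qed

theorem nontrivial_weak_solution:
  assumes \<psi>: "\<psi> \<in> X_space" "X_norm \<psi> = 1" and s0: "0 \<le> s\<^sub>0" "\<And>t. 0 < t \<Longrightarrow> \<Phi> (\<lambda>x. t * \<psi> x) \<le> s\<^sub>0"
    and level: "s\<^sub>0 < \<omega> / (2 * \<alpha>\<^sub>0)"
  shows "\<exists>u. weak_solution f u \<and> \<not> (AE x in lborel. u x = 0)"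
proof -
  obtain r \<rho> where r: "r > 0" "\<rho> > 0" "\<And>u. u \<in> X_space \<Longrightarrow> X_norm u = r \<Longrightarrow> \<rho> \<le> \<Phi> u"
    using mountain_ridge by blast
  obtain d :: "nat \<Rightarrow> real \<Rightarrow> real" where d: "\<And>j. d j \<in> X_space" "\<And>j. \<exists>K. \<forall>x. \<bar>d j x\<bar> \<le> K"
    and dense: "\<And>v K. v \<in> X_space \<Longrightarrow> (\<And>x. \<bar>v x\<bar> \<le> K) \<Longrightarrow>
       \<exists>\<sigma> B. (\<forall>j. (X_norm (d (\<sigma> j)))\<^sup>2 \<le> B) \<and> (\<lambda>j. LINT x|I01. (d (\<sigma> j) x - v x)\<^sup>2) \<longlonglongrightarrow> 0"
    using X_countable_dense by blast
  define good where "good n u \<longleftrightarrow> u \<in> X_space \<and> \<rho> \<le> \<Phi> u \<and> \<Phi> u \<le> s\<^sub>0 \<and>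
      (X_norm u)\<^sup>2 / (2 * pi) = (LINT x|I01. f (u x) * u x) \<and>
      (\<forall>k<n. X_inner u (d k) / (2 * pi) = (LINT x|I01. f (u x) * d k x))" for n :: nat and u
  have "\<exists>u. good n u" for n
  proof (rule critical_sequence[OF \<psi> s0 r, where d = d and n = n])
    fix u assume "u \<in> X_space" "\<rho> \<le> \<Phi> u" "\<Phi> u \<le> s\<^sub>0" "(X_norm u)\<^sup>2 / (2 * pi) = (LINT x|I01. f (u x) * u x)"
      "\<And>k. k < n \<Longrightarrow> X_inner u (d k) / (2 * pi) = (LINT x|I01. f (u x) * d k x)"
    then have "good n u" unfolding good_def by blast
    then show "\<exists>u. good n u" by blast
  qed (assumption | rule d(1))+
  then have "\<forall>n. \<exists>u. good n u" by blast
  from choice[OF this] obtain U where "\<And>n. good n (U n)" by blast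
  then have U: "\<And>n. U n \<in> X_space" "\<And>n. \<rho> \<le> \<Phi> (U n)" "\<And>n. \<Phi> (U n) \<le> s\<^sub>0"
    "\<And>n. (X_norm (U n))\<^sup>2 / (2 * pi) = (LINT x|I01. f (U n x) * U n x)"
    "\<And>n k. k < n \<Longrightarrow> X_inner (U n) (d k) / (2 * pi) = (LINT x|I01. f (U n x) * d k x)"
    unfolding good_def by blast+
  obtain C where C: "\<And>t. f t * t \<le> 4 * (f t * t / 2 - F t) + C" using ft_le_Ambrosetti_Rabinowitz by blast
  \<comment> \<open>By the critical point identity \<open>\<Phi> (U n)\<close> equals the integral
    of \<open>f t * t / 2 - F t\<close> at t = \<open>U n x\<close>, so the pointwise inequality
    integrates to four times the energy plus C.\<close>
  define P where "P = 4 * s\<^sub>0 + C"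
  have P: "(LINT x|I01. f (U n x) * U n x) \<le> P" for n
  proof -
    note i = fv_integrable[OF U(1) U(1), of n n] F_integrable[OF U(1), of n]
    have e: "4 * (f (U n x) * U n x / 2 - F (U n x)) + C = 2 * (f (U n x) * U n x) - 4 * F (U n x) + C" for x by simp
    have "(LINT x|I01. f (U n x) * U n x) \<le> (LINT x|I01. 2 * (f (U n x) * U n x) - 4 * F (U n x) + C)"
    proof (intro integral_mono Bochner_Integration.integrable_add Bochner_Integration.integrable_diff
        integrable_mult_right i I01.integrable_const)
      show "f (U n x) * U n x \<le> 2 * (f (U n x) * U n x) - 4 * F (U n x) + C" for x
        using C[of "U n x"] unfolding e .
    qed
    also have "\<dots> = 2 * (LINT x|I01. f (U n x) * U n x) - 4 * (LINT x|I01. F (U n x)) + C"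
      using i I01.prob_space by (simp add: space_restrict_space)
    also have "\<dots> = 4 * \<Phi> (U n) + C"
      unfolding \<Phi>_def U(4)[symmetric] by simp
    finally show ?thesis using U(3)[of n] by (simp add: P_def)
  qed
  have XB: "(X_norm (U n))\<^sup>2 \<le> 2 * pi * P" for n
    using P[of n] U(4)[of n] by (simp add: field_simps)
  have L2B: "(LINT x|I01. (U n x)\<^sup>2) \<le> 2 * pi * P / lambda1" for n
  proof -
    have "(LINT x|I01. (U n x)\<^sup>2) \<le> (X_norm (U n))\<^sup>2 / lambda1" by (rule Poincare[OF U(1)])
    also have "\<dots> \<le> 2 * pi * P / lambda1" using XB[of n] lambda1_pos by (intro divide_right_mono) auto
    finally show ?thesis .
  qed
  obtain v q where v: "v \<in> X_space" and q: "strict_mono (q :: nat \<Rightarrow> nat)"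
    and ae: "AE x in lborel. (\<lambda>k. U (q k) x) \<longlonglongrightarrow> v x"
    by (rule X_Rellich[OF U(1) XB L2B]) (rule that; assumption)
  define u where "u k = U (q k)" for k
  have u: "u k \<in> X_space" for k unfolding u_def by (rule U(1))
  have ae: "AE x in lborel. (\<lambda>k. u k x) \<longlonglongrightarrow> v x" using ae by (simp add: u_def)
  note [measurable] = X_borel[OF u] X_borel[OF v]
  \<comment> \<open>\<open>d j\<close> is bounded, as uniform integrability requires, and it is
    tested by \<open>u k\<close> for every k > j because \<open>q k\<close> is at least k.\<close>
  have eq_d: "X_inner v (d j) / (2 * pi) = (LINT x|I01. f (v x) * d j x)" for j
  proof -
    obtain K where K: "\<And>x. \<bar>d j x\<bar> \<le> K" using d(2) by blast
    have "(\<lambda>k. LINT x|I01. f (u k x) * d j x) \<longlonglongrightarrow> (LINT x|I01. f (v x) * d j x)"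
    proof (rule tendsto_integral_uniformly_integrable[where g = f and u = u and v = v and h = "d j"
          and p = "\<lambda>t. f t * t" and P = P and K = K])
      show "(LINT x|I01. f (u k x) * u k x) \<le> P" for k unfolding u_def by (rule P)
      show "AE x in I01. (\<lambda>k. u k x) \<longlonglongrightarrow> v x" by (rule AE_I01[OF ae])
      show "(\<lambda>t. f t * t) \<in> borel_measurable borel" by measurable
    qed (rule X_borel[OF u] X_borel[OF v] X_borel[OF d(1)] f_cont ft_nonneg
        fv_integrable[OF u u] fv_integrable[OF v v] K | erule tail_f)+
    moreover have "(\<lambda>k. X_inner (u k) (d j) / (2 * pi)) \<longlonglongrightarrow> X_inner v (d j) / (2 * pi)"
      by (intro tendsto_intros X_inner_weak_convergence[OF u v d(1) ae]) (use XB in \<open>auto simp: u_def\<close>)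
    moreover have "\<forall>\<^sub>F k in sequentially. X_inner (u k) (d j) / (2 * pi) = (LINT x|I01. f (u k x) * d j x)"
      using eventually_gt_at_top[of j]
    proof eventually_elim
      fix k assume "j < k"
      then have "j < q k" using seq_suble[OF q, of k] by simp
      then show "X_inner (u k) (d j) / (2 * pi) = (LINT x|I01. f (u k x) * d j x)" unfolding u_def by (rule U(5))
    qed
    ultimately show ?thesis
      using tendsto_cong[of "\<lambda>k. X_inner (u k) (d j) / (2 * pi)" "\<lambda>k. LINT x|I01. f (u k x) * d j x" sequentially]
        LIMSEQ_unique by blast
  qed
  \<comment> \<open>The left side needs only weak convergence along a subsequence of the
    approximants; the right side passes to the limit since f(v) is square integrable.\<close>
  have eq_bounded: "X_inner v w / (2 * pi) = (LINT x|I01. f (v x) * w x)" if w: "w \<in> X_space" "\<And>x. \<bar>w x\<bar> \<le> K" for w K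
  proof -
    obtain \<sigma> B where \<sigma>: "\<And>j. (X_norm (d (\<sigma> j)))\<^sup>2 \<le> B" "(\<lambda>j. LINT x|I01. (d (\<sigma> j) x - w x)\<^sup>2) \<longlonglongrightarrow> 0"
      using dense[OF w] by blast
    obtain r where r: "strict_mono (r :: nat \<Rightarrow> nat)" "(\<lambda>j. X_inner v (d (\<sigma> (r j)))) \<longlonglongrightarrow> X_inner v w"
      by (rule X_inner_tendsto[OF v d(1) \<sigma>(1) w(1) \<sigma>(2)]) (rule that; assumption)
    have "(\<lambda>j. LINT x|I01. f (v x) * d (\<sigma> j) x) \<longlonglongrightarrow> (LINT x|I01. f (v x) * w x)"
      by (rule sqint_tendsto_inner[OF X_sqint_I01[OF d(1)] X_sqint_I01[OF w(1)] f_sqint[OF v] \<sigma>(2)])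
    from LIMSEQ_subseq_LIMSEQ[OF this r(1)]
    have "(\<lambda>j. LINT x|I01. f (v x) * d (\<sigma> (r j)) x) \<longlonglongrightarrow> (LINT x|I01. f (v x) * w x)" by (simp add: comp_def)
    then have "(\<lambda>j. X_inner v (d (\<sigma> (r j))) / (2 * pi)) \<longlonglongrightarrow> (LINT x|I01. f (v x) * w x)"
      by (simp add: eq_d)
    moreover have "(\<lambda>j. X_inner v (d (\<sigma> (r j))) / (2 * pi)) \<longlonglongrightarrow> X_inner v w / (2 * pi)"
      by (intro tendsto_intros r(2)) simp
    ultimately show ?thesis by (rule LIMSEQ_unique[rotated])
  qed
  have eq: "X_inner v w / (2 * pi) = (LINT x|I01. f (v x) * w x)" if w: "w \<in> X_space" for w
  proof -
    note [measurable] = X_borel[OF w]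
    define wn where "wn n x = trunc (real n) (w x)" for n x
    have wn: "wn n \<in> X_space" "(X_norm (wn n))\<^sup>2 \<le> (X_norm w)\<^sup>2" for n
      unfolding wn_def by (intro X_trunc w; simp)+
    note [measurable] = X_borel[OF wn(1)]
    have wn_lim: "(\<lambda>n. wn n x) \<longlonglongrightarrow> w x" for x
    proof (rule tendsto_eventually)
      show "\<forall>\<^sub>F n in sequentially. wn n x = w x"
        using eventually_ge_at_top[of "nat \<lceil>\<bar>w x\<bar>\<rceil>"]
        by eventually_elim (auto simp: wn_def trunc_def nat_le_iff ceiling_le_iff)
    qed
    have "X_inner v (wn n) / (2 * pi) = (LINT x|I01. f (v x) * wn n x)" for n
      by (rule eq_bounded[OF wn(1), of _ "real n"]) (auto simp: wn_def trunc_def)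
    moreover have "(\<lambda>n. X_inner v (wn n) / (2 * pi)) \<longlonglongrightarrow> X_inner v w / (2 * pi)"
      unfolding X_inner_commute[of v]
      by (intro tendsto_intros X_inner_weak_convergence[OF wn(1) w v _ wn(2)]) (simp_all add: wn_lim)
    moreover have "(\<lambda>n. LINT x|I01. f (v x) * wn n x) \<longlonglongrightarrow> (LINT x|I01. f (v x) * w x)"
    proof (rule integral_dominated_convergence[where w = "\<lambda>x. \<bar>f (v x) * w x\<bar>"])
      show "AE x in I01. (\<lambda>n. f (v x) * wn n x) \<longlonglongrightarrow> f (v x) * w x" by (intro AE_I2 tendsto_intros wn_lim)
      show "AE x in I01. norm (f (v x) * wn n x) \<le> \<bar>f (v x) * w x\<bar>" for n
        by (intro AE_I2) (auto simp: abs_mult wn_def trunc_def intro!: mult_left_mono)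
      show "integrable I01 (\<lambda>x. \<bar>f (v x) * w x\<bar>)" using fv_integrable[OF v w] by simp
    qed measurable
    ultimately show ?thesis by (simp add: LIMSEQ_unique)
  qed
  have sol: "weak_solution f v"
    unfolding weak_solution_def using v fv_integrable[OF v] eq
    by (simp add: set_integrable_I01 set_integral_I01 frac_laplacian_inner)
  have "\<not> (AE x in lborel. v x = 0)"
  proof
    assume v0: "AE x in lborel. v x = 0"
    have ae0: "AE x in I01. (\<lambda>k. u k x) \<longlonglongrightarrow> (\<lambda>_. 0) x"
      using AE_I01[OF ae] AE_I01[OF v0] by eventually_elim simp
    have "(\<lambda>k. LINT x|I01. F (u k x) * 1) \<longlonglongrightarrow> (LINT x|I01. F 0 * 1)"
    proof (rule tendsto_integral_uniformly_integrable[where g = F and u = u and v = "\<lambda>_. 0" and h = "\<lambda>_. 1"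
          and p = "\<lambda>t. f t * t" and P = P and K = 1])
      show "(LINT x|I01. f (u k x) * u k x) \<le> P" for k unfolding u_def by (rule P)
      show "(\<lambda>t. f t * t) \<in> borel_measurable borel" by measurable
      show "AE x in I01. (\<lambda>k. u k x) \<longlonglongrightarrow> 0" using ae0 by simp
    qed (rule X_borel[OF u] F_cont ft_nonneg fv_integrable[OF u u] | erule tail_F | simp)+
    then have F_lim: "(\<lambda>k. LINT x|I01. F (u k x)) \<longlonglongrightarrow> 0" by (simp add: F_0)
    \<comment> \<open>The level condition multiplied by 4 pi \<open>\<alpha>\<^sub>0\<close>. Being
      strict, it leaves room for an \<eta> serving three purposes: exponent
      \<open>\<alpha>\<^sub>0 + \<eta>\<close> for the growth of f, exponent
      \<open>\<alpha>\<^sub>0 + 2 * \<eta>\<close> for the exponential weight, and energy bound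
      \<open>s\<^sub>0 + \<eta>\<close>.\<close>
    have lev: "\<alpha>\<^sub>0 * (4 * pi * s\<^sub>0) < 2 * pi * \<omega>"
      using level \<alpha>\<^sub>0 by (simp add: field_simps)
    have "((\<lambda>\<eta>. (\<alpha>\<^sub>0 + 2 * \<eta>) * (4 * pi * (s\<^sub>0 + \<eta>))) \<longlongrightarrow> (\<alpha>\<^sub>0 + 2 * 0) * (4 * pi * (s\<^sub>0 + 0))) (at_right 0)"
      by (intro tendsto_intros)
    then have "\<forall>\<^sub>F \<eta> in at_right 0. (\<alpha>\<^sub>0 + 2 * \<eta>) * (4 * pi * (s\<^sub>0 + \<eta>)) < 2 * pi * \<omega>"
      using lev by (intro order_tendstoD(2)) auto
    then have "\<forall>\<^sub>F \<eta> in at_right 0. (\<alpha>\<^sub>0 + 2 * \<eta>) * (4 * pi * (s\<^sub>0 + \<eta>)) < 2 * pi * \<omega> \<and> 0 < \<eta>"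
      using eventually_at_right_less[of "0::real"] by eventually_elim simp
    then obtain \<eta> where \<eta>: "(\<alpha>\<^sub>0 + 2 * \<eta>) * (4 * pi * (s\<^sub>0 + \<eta>)) < 2 * pi * \<omega>" "0 < \<eta>"
      using eventually_happens'[OF trivial_limit_at_right_real] by blast
    define S where "S = 4 * pi * (s\<^sub>0 + \<eta>)"
    have S: "S > 0" using \<eta>(2) s0(1) by (simp add: S_def)
    define \<gamma> where "\<gamma> = \<alpha>\<^sub>0 + 2 * \<eta>"
    \<comment> \<open>The exponent obtained by rescaling from squared norm S to
      \<open>2 * pi\<close>; the choice of \<eta> makes it smaller than \<omega>.\<close>
    define \<beta> where "\<beta> = \<gamma> * S / (2 * pi)"
    have \<beta>: "0 < \<beta>" "\<beta> < \<omega>" 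
    proof -
      have "\<gamma> * S < 2 * pi * \<omega>" "\<gamma> > 0" using \<eta> \<alpha>\<^sub>0 unfolding \<gamma>_def S_def by linarith+
      then show "0 < \<beta>" "\<beta> < \<omega>" using S by (simp_all add: \<beta>_def divide_less_eq mult_ac)
    qed
    obtain H where H: "H > 0"
      "\<And>u. u \<in> X_space \<Longrightarrow> (X_norm u)\<^sup>2 \<le> 2 * pi \<Longrightarrow> integrable I01 (\<lambda>x. exp (\<beta> * (u x)\<^sup>2))"
      "\<And>u. u \<in> X_space \<Longrightarrow> (X_norm u)\<^sup>2 \<le> 2 * pi \<Longrightarrow>
       (LINT x|I01. exp (\<beta> * (u x)\<^sup>2) - 1) \<le> H * (LINT x|I01. (u x)\<^sup>2)"
      using Trudinger_Moser_X[OF omega \<beta>] by blast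
    define E where "E = 1 + H * (2 * pi / lambda1)"
    have "\<forall>\<^sub>F k in sequentially. (LINT x|I01. F (u k x)) < \<eta>"
      by (rule order_tendstoD(2)[OF F_lim \<eta>(2)])
    then obtain k0 where k0: "\<And>k. k \<ge> k0 \<Longrightarrow> (LINT x|I01. F (u k x)) < \<eta>" by (auto simp: eventually_sequentially)
    have exp_bound: "integrable I01 (\<lambda>x. exp (\<gamma> * (u k x)\<^sup>2)) \<and> (LINT x|I01. exp (\<gamma> * (u k x)\<^sup>2)) \<le> E" if "k \<ge> k0" for k
    proof -
      have "(X_norm (u k))\<^sup>2 = 4 * pi * (\<Phi> (u k) + (LINT x|I01. F (u k x)))" by (simp add: \<Phi>_def)
      also have "\<dots> \<le> S" unfolding S_def using U(3)[of "q k"] k0[OF that]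
        by (intro mult_left_mono add_mono) (auto simp: u_def)
      finally have XS: "(X_norm (u k))\<^sup>2 \<le> S" .
      define w where "w x = sqrt (2 * pi / S) * u k x" for x
      have w: "w \<in> X_space" unfolding w_def by (rule X_cmult[OF u])
      have wn: "(X_norm w)\<^sup>2 \<le> 2 * pi"
        unfolding w_def X_norm_cmult using XS S by (simp add: field_simps)
      have ew: "\<beta> * (w x)\<^sup>2 = \<gamma> * (u k x)\<^sup>2" for x using S by (simp add: w_def \<beta>_def power_mult_distrib)
      have i1: "integrable I01 (\<lambda>x. exp (\<gamma> * (u k x)\<^sup>2))" using H(2)[OF w wn] by (simp add: ew)
      have "(LINT x|I01. exp (\<gamma> * (u k x)\<^sup>2)) - 1 = (LINT x|I01. exp (\<beta> * (w x)\<^sup>2) - 1)"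
        unfolding ew using i1 I01.prob_space by (simp add: space_restrict_space)
      also have "\<dots> \<le> H * (LINT x|I01. (w x)\<^sup>2)" by (rule H(3)[OF w wn])
      also have "\<dots> \<le> H * (2 * pi / lambda1)"
      proof (rule mult_left_mono)
        have "(LINT x|I01. (w x)\<^sup>2) \<le> (X_norm w)\<^sup>2 / lambda1" by (rule Poincare[OF w])
        also have "\<dots> \<le> 2 * pi / lambda1" using wn lambda1_pos by (intro divide_right_mono) auto
        finally show "(LINT x|I01. (w x)\<^sup>2) \<le> 2 * pi / lambda1" .
      qed (use H(1) in simp)
      finally show ?thesis using i1 by (simp add: E_def)
    qed
    obtain C' where C': "C' > 0" "\<And>t. \<bar>f t\<bar> \<le> C' * exp ((\<alpha>\<^sub>0 + \<eta>) * t\<^sup>2)" using f_exp_bound[of "\<alpha>\<^sub>0 + \<eta>"] \<eta>(2) by auto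
    \<comment> \<open>Bounded exponential integrals with the larger exponent \<gamma> make f(u) u
      uniformly integrable, whereas a bound on its own integrals would not.\<close>
    have "(\<lambda>k. LINT x|I01. (f (u (k + k0) x) * u (k + k0) x) * 1) \<longlonglongrightarrow> (LINT x|I01. (f 0 * 0) * 1)"
    proof (rule tendsto_integral_uniformly_integrable[where g = "\<lambda>t. f t * t" and u = "\<lambda>k. u (k + k0)" and v = "\<lambda>_. 0"
          and h = "\<lambda>_. 1" and p = "\<lambda>t. exp (\<gamma> * t\<^sup>2)" and P = E and K = 1])
      show "continuous_on UNIV (\<lambda>t. f t * t)" by (intro continuous_intros f_cont)
      show "\<exists>N>0. \<forall>t. N < \<bar>t\<bar> \<longrightarrow> \<bar>f t * t\<bar> \<le> e * exp (\<gamma> * t\<^sup>2)" if "e > 0" for e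
        by (rule tail_exp[OF C' _ that]) (simp add: \<gamma>_def \<eta>)
      show "AE x in I01. (\<lambda>k. u (k + k0) x) \<longlonglongrightarrow> 0"
        using ae0 by eventually_elim (rule LIMSEQ_ignore_initial_segment)
    qed (use exp_bound in auto)
    then have "(\<lambda>k. (X_norm (u (k + k0)))\<^sup>2 / (2 * pi)) \<longlonglongrightarrow> 0"
      using U(4) by (simp add: u_def)
    then have lim: "(\<lambda>k. (X_norm (u (k + k0)))\<^sup>2 / (2 * pi) / 2) \<longlonglongrightarrow> 0 / 2" by (intro tendsto_intros) auto
    \<comment> \<open>The ridge height bounds the energy from below, and dropping the nonnegative
      integral of F leaves the quadratic term.\<close>
    have le: "\<rho> \<le> (X_norm (u (k + k0)))\<^sup>2 / (2 * pi) / 2" for k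
    proof -
      have "0 \<le> (LINT x|I01. F (u (k + k0) x))" by (intro Bochner_Integration.integral_nonneg F_nonneg)
      then show ?thesis using U(2)[of "q (k + k0)"] by (simp add: \<Phi>_def u_def)
    qed
    have "\<rho> \<le> 0 / 2" by (rule LIMSEQ_le_const[OF lim]) (use le in blast)
    then show False using r(2) by simp
  qed
  then show ?thesis using sol by blast
qed

end

theorem theorem1p3:
  fixes f :: "real \<Rightarrow> real" and \<omega> \<alpha>\<^sub>0 :: real
  defines "F \<equiv> primitive f"
  assumes omega: "trudinger_moser_constant \<omega>"
    and f_cont: "continuous_on UNIV f"
    and f_zero: "f 0 = 0"
    and i: "\<exists>t\<^sub>0>0. \<exists>M>0. \<forall>t. \<bar>t\<bar> \<ge> t\<^sub>0 \<longrightarrow> 0 < F t \<and> F t \<le> M * \<bar>f t\<bar>"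
    and ii: "\<forall>t. t \<noteq> 0 \<longrightarrow> 0 < 2 * F t \<and> 2 * F t \<le> f t * t"
    and iii: "Limsup (at 0) (\<lambda>t. ereal (F t / t\<^sup>2)) < ereal (lambda1 / (4 * pi))"
    and iv_range: "0 < \<alpha>\<^sub>0" "\<alpha>\<^sub>0 < 2 * pi * \<omega>"
    and iv_sub: "\<forall>\<alpha>. 0 < \<alpha> \<and> \<alpha> < \<alpha>\<^sub>0 \<longrightarrow>
                   filterlim (\<lambda>t. \<bar>f t\<bar> / exp (\<alpha> * t\<^sup>2)) at_top at_infinity"
    and iv_super: "\<forall>\<alpha>. \<alpha> > \<alpha>\<^sub>0 \<longrightarrow>
                   ((\<lambda>t. \<bar>f t\<bar> / exp (\<alpha> * t\<^sup>2)) \<longlongrightarrow> 0) at_infinity"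
    and v: "\<exists>\<psi>\<in>X_space. X_norm \<psi> = 1 \<and>
              (SUP t\<in>{0<..}. ereal (t\<^sup>2 / (4 * pi) - (LBINT x:{0<..<1}. F (t * \<psi> x))))
                < ereal (\<omega> / (2 * \<alpha>\<^sub>0))"
  shows "\<exists>u. weak_solution f u \<and> \<not> (AE x in lborel. u x = 0)"
proof -
  interpret nonlinearity f \<omega> \<alpha>\<^sub>0
    using omega f_cont i ii iii iv_range iv_sub iv_super unfolding F_def by unfold_locales
  obtain \<psi> where \<psi>: "\<psi> \<in> X_space" "X_norm \<psi> = 1"
    and sup: "(SUP t\<in>{0<..}. ereal (t\<^sup>2 / (4 * pi) - (LBINT x:{0<..<1}. F (t * \<psi> x)))) < ereal (\<omega> / (2 * \<alpha>\<^sub>0))"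
    using v by blast
  \<comment> \<open>A real number strictly between the extended real supremum and the threshold
    serves as the level.\<close>
  obtain z where z: "(SUP t\<in>{0<..}. ereal (t\<^sup>2 / (4 * pi) - (LBINT x:{0<..<1}. F (t * \<psi> x)))) < ereal z"
    "ereal z < ereal (\<omega> / (2 * \<alpha>\<^sub>0))"
    using ereal_dense2[OF sup] by blast
  show ?thesis
  \<comment> \<open>The maximum with 0 accounts for the starting point of the segment, whose energy
    is 0; it stays below the threshold because \<omega> and \<open>\<alpha>\<^sub>0\<close> are
    positive.\<close>
  proof (rule nontrivial_weak_solution[OF \<psi>, of "max 0 z"])
    show "max 0 z < \<omega> / (2 * \<alpha>\<^sub>0)" using z(2) \<omega>_pos iv_range(1) by simp
    fix t :: real assume t: "0 < t"
    have "ereal (t\<^sup>2 / (4 * pi) - (LBINT x:{0<..<1}. F (t * \<psi> x)))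
        \<le> (SUP t\<in>{0<..}. ereal (t\<^sup>2 / (4 * pi) - (LBINT x:{0<..<1}. F (t * \<psi> x))))"
      by (rule SUP_upper) (use t in simp)
    then have "ereal (t\<^sup>2 / (4 * pi) - (LBINT x:{0<..<1}. F (t * \<psi> x))) < ereal z"
      using z(1) by (rule le_less_trans)
    then show "\<Phi> (\<lambda>x. t * \<psi> x) \<le> max 0 z"
      unfolding \<Phi>_def X_norm_cmult by (simp add: \<psi>(2) set_integral_I01 F_def)
  qed simp
qed

end
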